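(* Let $\sigma>0$, $\tau\in(0,(1+\sqrt5)/2)$, and for $i\in\{1,\dots,s\}$, $j\in\{1,\dots,t\}$ let $\mathcal S_i$ and $\mathcal T_j$ be self-adjoint (possibly indefinite) linear operators on $\mathcal Y_i$ and $\mathcal Z_j$ with $$\mathcal S_i\succeq-\tfrac12\widehat\Sigma_{f_i},\quad \mathcal T_j\succeq-\tfrac12\widehat\Sigma_{g_j},\quad \tfrac12\widehat\Sigma_{f_i}+\mathcal S_i+\sigma\mathcal A_i\mathcal A_i^*\succ0,\quad \tfrac12\widehat\Sigma_{g_j}+\mathcal T_j+\sigma\mathcal B_j\mathcal B_j^*\succ0 .$$ Let $\{u^k:=(y^k,z^k,x^k)\}$ be the infinite sequence generated by the majorized sGS-iPADMM applied to the multi-block problem (MP), and let the proximal terms $\mathcal S$ and $\mathcal T$ be defined by $\mathcal S=\mathrm{Diag}(\mathcal S_1,\dots,\mathcal S_s)+\mathrm{sGS}(\widetilde{\mathcal M})$ and $\mathcal T=\mathrm{Diag}(\mathcal T_1,\dots,\mathcal T_t)+\mathrm{sGS}(\widetilde{\mathcal N})$. Then: (a) The sequence $\{(y^k,z^k)\}$ converges to an optimal solution of problem (MP) and $\{x^k\}$ converges to an optimal solution of the dual of problem (MP). (b) Suppose that the sequence $\{(y^k,z^k,x^k)\}$ converges to a KKT point $\bar u:=(\bar y,\bar z,\bar x)$ and that the KKT mapping $\mathcal R$ is metrically subregular at $(\bar u,0)\in\mathrm{gph}\,\mathcal R$. Then the sequence $\{u^k\}$ is linearly convergent to $\bar u$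.
   Context: **Problem (MP).** Let $\mathcal X$, $\mathcal Y_i$, $\mathcal Z_j$ be finite dimensional Euclidean spaces, $\mathcal Y=\mathcal Y_1\times\dots\times\mathcal Y_s$, $\mathcal Z=\mathcal Z_1\times\dots\times\mathcal Z_t$, $y=(y_1,\dots,y_s)$, $z=(z_1,\dots,z_t)$. Problem (MP) is $$\min_{y,z}\ p(y_1)+f(y)+q(z_1)+g(z)\quad\text{s.t.}\quad\mathcal A^*y+\mathcal B^*z=c,$$ where $f(y)=\sum_{i=1}^sf_i(y_i)$, $g(z)=\sum_{j=1}^tg_j(z_j)$, each $f_i:\mathcal Y_i\to\mathbb R$ and $g_j:\mathcal Z_j\to\mathbb R$ is convex and differentiable with Lipschitz continuous gradient, $p:\mathcal Y_1\to(-\infty,+\infty]$ and $q:\mathcal Z_1\to(-\infty,+\infty]$ are closed proper convex, $\mathcal A^*y=\sum_i\mathcal A_i^*y_i$, $\mathcal B^*z=\sum_j\mathcal B_j^*z_j$ with $\mathcal A_i:\mathcal X\to\mathcal Y_i$, $\mathcal B_j:\mathcal X\to\mathcal Z_j$ linear, and $c\in\mathcal X$. The dual of (MP) is $\max_x\inf_{y,z}\{p(y_1)+f(y)+q(z_1)+g(z)+\langle x,\mathcal A^*y+\mathcal B^*z-c\rangle\}$. **Notation.** $\|x\|_{\mathcal G}^2:=\langle x,\mathcal Gx\rangle$ for self-adjoint $\mathcal G$. $\widehat\Sigma_{f_i},\widehat\Sigma_{g_j}$ are self-adjoint positive semidefinite operators such that $f_i(y_i)\le f_i(y_i')+\langle\nabla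 f_i(y_i'),y_i-y_i'\rangle+\frac12\|y_i-y_i'\|^2_{\widehat\Sigma_{f_i}}$ for all $y_i,y_i'$ and likewise for $g_j$ with $\widehat\Sigma_{g_j}$. Set $\widehat\Sigma_f=\mathrm{Diag}(\widehat\Sigma_{f_1},\dots,\widehat\Sigma_{f_s})$, $\widehat\Sigma_g=\mathrm{Diag}(\widehat\Sigma_{g_1},\dots,\widehat\Sigma_{g_t})$, $\hat f(y,y')=f(y')+\langle\nabla f(y'),y-y'\rangle+\frac12\|y-y'\|^2_{\widehat\Sigma_f}$, $\hat g(z,z')=g(z')+\langle\nabla g(z'),z-z'\rangle+\frac12\|z-z'\|^2_{\widehat\Sigma_g}$, and $$\widehat{\mathcal L}_\sigma(y,z,x;y',z')=\hat f(y,y')+p(y_1)+\hat g(z,z')+q(z_1)+\langle x,\mathcal A^*y+\mathcal B^*z-c\rangle+\tfrac\sigma2\|\mathcal A^*y+\mathcal B^*z-c\|^2 .$$ **Majorized sGS-iPADMM.** Start from $(y^0,z^0,x^0)\in\mathrm{dom}\,p\times\mathrm{dom}\,q\times\mathcal X$ (with $p,q$ viewed as functions of $y,z$). Write $y_{\le i-1}=(y_1,\dots,y_{i-1})$, $y_{\ge i+1}=(y_{i+1},\dots,y_s)$, etc. For $k=0,1,2,\dots$: - (1a) for $i=s,\dots,2$: $\bar y_i^k=\arg\min_{y_i}\widehat{\mathcal L}_\sigma(y^k_{\le i-1},y_i,\bar y^k_{\ge i+1},z^k,x^k;y^k,z^k)+\frac12\|y_i-y_i^k\|^2_{\mathcal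 S_i}$; then $y_1^{k+1}=\arg\min_{y_1}\widehat{\mathcal L}_\sigma(y_1,\bar y^k_{\ge2},z^k,x^k;y^k,z^k)+\frac12\|y_1-y_1^k\|^2_{\mathcal S_1}$. - (1b) for $i=2,\dots,s$: $y_i^{k+1}=\arg\min_{y_i}\widehat{\mathcal L}_\sigma(y^{k+1}_{\le i-1},y_i,\bar y^k_{\ge i+1},z^k,x^k;y^k,z^k)+\frac12\|y_i-y_i^k\|^2_{\mathcal S_i}$. - (1c) for $j=t,\dots,2$: $\bar z_j^k=\arg\min_{z_j}\widehat{\mathcal L}_\sigma(y^{k+1},z^k_{\le j-1},z_j,\bar z^k_{\ge j+1},x^k;y^k,z^k)+\frac12\|z_j-z_j^k\|^2_{\mathcal T_j}$; then $z_1^{k+1}=\arg\min_{z_1}\widehat{\mathcal L}_\sigma(y^{k+1},z_1,\bar z^k_{\ge2},x^k;y^k,z^k)+\frac12\|z_1-z_1^k\|^2_{\mathcal T_1}$. - (1d) for $j=2,\dots,t$: $z_j^{k+1}=\arg\min_{z_j}\widehat{\mathcal L}_\sigma(y^{k+1},z^{k+1}_{\le j-1},z_j,\bar z^k_{\ge j+1},x^k;y^k,z^k)+\frac12\|z_j-z_j^k\|^2_{\mathcal T_j}$. - (2) $x^{k+1}=x^k+\tau\sigma(\mathcal A^*y^{k+1}+\mathcal B^*z^{k+1}-c)$. **Associated operators.** $\widetilde{\mathcal M}:=\frac12\widehat\Sigma_f+\sigma\mathcal A\mathcal A^*+\mathrm{Diag}(\mathcal S_1,\dots,\mathcal S_s)$,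 $\widetilde{\mathcal N}:=\frac12\widehat\Sigma_g+\sigma\mathcal B\mathcal B^*+\mathrm{Diag}(\mathcal T_1,\dots,\mathcal T_t)$; $\mathrm{sGS}(\widetilde{\mathcal M}):=\widetilde{\mathcal M}_u\widetilde{\mathcal M}_d^{-1}\widetilde{\mathcal M}_u^*$, where $\widetilde{\mathcal M}_u$ and $\widetilde{\mathcal M}_d$ are the strictly upper triangular and diagonal block parts of $\widetilde{\mathcal M}$; similarly for $\widetilde{\mathcal N}$. **KKT.** Regard $p$ and $q$ as functions of $y$ and $z$ via $p(y)=p(y_1)$, $q(z)=q(z_1)$. $(y,z,x)$ is a KKT point if $0\in\partial p(y)+\nabla f(y)+\mathcal Ax$, $0\in\partial q(z)+\nabla g(z)+\mathcal Bx$, $\mathcal A^*y+\mathcal B^*z=c$; $\overline\Omega$ is the set of KKT points. Standing assumption: $\overline\Omega\ne\emptyset$. With $\mathrm{Pr}_\theta(v):=\arg\min_{v'}\{\theta(v')+\frac12\|v'-v\|^2\}$, for $u=(y,z,x)$, $$\mathcal R(u):=\big(y-\mathrm{Pr}_p[y-(\nabla f(y)+\mathcal Ax)],\ z-\mathrm{Pr}_q[z-(\nabla g(z)+\mathcal Bx)],\ c-\mathcal A^*y-\mathcal B^*z\big).$$ $\mathcal R$ is metrically subregular at $(\bar u,0)\in\mathrm{gph}\,\mathcal R$ if there are $\eta,\rho>0$ with $\mathrm{dist}(u,\overline\Omega)\le\eta\|\mathcal R(u)\|$ whenever $\|u-\bar u\|\le\rho$. *)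

theory Defs
  imports "HOL-Analysis.Analysis"
begin

(* The spaces Y_1, ..., Y_s may have different dimensions, so they are taken to be linear
   subspaces Y i of one Euclidean space 'a (every finite family of Euclidean spaces embeds
   isometrically in this way).  The index set {1, ..., s} is a finite linearly ordered type 's.
   Points of Y_1 x ... x Y_s are the vectors y :: 'a ^ 's with y $ i in Y i, so that the inner
   product of 'a ^ 's is the product inner product.  Operators and functions on Y i are total
   on 'a, but only their restrictions to Y i are ever used; a linear operator on a subspace
   always extends to a linear operator on 'a. *)

definition prod_space :: "('s \<Rightarrow> 'a::euclidean_space set) \<Rightarrow> ('a ^ 's::finite) set" where
  "prod_space Y = {y. \<forall>i. y $ i \<in> Y i}"

definition first_block :: "'s::{finite,linorder}" where
  "first_block = Min UNIV"

definition first_part :: "('a \<Rightarrow> ereal) \<Rightarrow> 'a ^ 's::{finite,linorder} \<Rightarrow> ereal" where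
  "first_part p y = p (y $ first_block)"

definition sep_sum :: "('s \<Rightarrow> 'a \<Rightarrow> real) \<Rightarrow> 'a ^ 's::finite \<Rightarrow> real" where
  "sep_sum f y = (\<Sum>i\<in>UNIV. f i (y $ i))"

definition stack_op :: "('s \<Rightarrow> 'x \<Rightarrow> 'a) \<Rightarrow> 'x \<Rightarrow> 'a ^ 's::finite" where
  "stack_op A x = (\<chi> i. A i x)"

(* Since A i maps into Y i, the restriction of adjoint (A i) to Y i is the adjoint of
   A i regarded as an operator from X to Y i. *)
definition stack_adj ::
    "('s \<Rightarrow> 'x::euclidean_space \<Rightarrow> 'a::euclidean_space) \<Rightarrow> 'a ^ 's::finite \<Rightarrow> 'x" where
  "stack_adj A y = (\<Sum>i\<in>UNIV. adjoint (A i) (y $ i))"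

definition Diag :: "('s \<Rightarrow> 'a \<Rightarrow> 'a) \<Rightarrow> 'a ^ 's::finite \<Rightarrow> 'a ^ 's" where
  "Diag D y = (\<chi> i. D i (y $ i))"


subsection \<open>Operators and functions on a subspace\<close>

definition sqnorm :: "('v::real_inner \<Rightarrow> 'v) \<Rightarrow> 'v \<Rightarrow> real" where
  "sqnorm G v = v \<bullet> G v"

definition self_adjoint_on :: "'v::euclidean_space set \<Rightarrow> ('v \<Rightarrow> 'v) \<Rightarrow> bool" where
  "self_adjoint_on V G \<longleftrightarrow> linear G \<and> G ` V \<subseteq> V \<and> (\<forall>v\<in>V. \<forall>w\<in>V. G v \<bullet> w = v \<bullet> G w)"

definition psd_on :: "'v::euclidean_space set \<Rightarrow> ('v \<Rightarrow> 'v) \<Rightarrow> bool" where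
  "psd_on V G \<longleftrightarrow> self_adjoint_on V G \<and> (\<forall>v\<in>V. 0 \<le> v \<bullet> G v)"

definition pd_on :: "'v::euclidean_space set \<Rightarrow> ('v \<Rightarrow> 'v) \<Rightarrow> bool" where
  "pd_on V G \<longleftrightarrow> self_adjoint_on V G \<and> (\<forall>v\<in>V. v \<noteq> 0 \<longrightarrow> 0 < v \<bullet> G v)"

definition loewner_ge :: "'v::euclidean_space set \<Rightarrow> ('v \<Rightarrow> 'v) \<Rightarrow> ('v \<Rightarrow> 'v) \<Rightarrow> bool" where
  "loewner_ge V G H \<longleftrightarrow> psd_on V (\<lambda>v. G v - H v)"

(* The gradient relative to the Euclidean space V; requiring it to lie in V makes it unique. *)
definition grad_on :: "'v::euclidean_space set \<Rightarrow> ('v \<Rightarrow> real) \<Rightarrow> 'v \<Rightarrow> 'v" where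
  "grad_on V \<phi> v = (THE d. d \<in> V \<and> (\<phi> has_derivative (\<lambda>h. d \<bullet> h)) (at v within V))"

definition epi_on :: "'v set \<Rightarrow> ('v \<Rightarrow> ereal) \<Rightarrow> ('v \<times> real) set" where
  "epi_on V \<phi> = {(v, r). v \<in> V \<and> \<phi> v \<le> ereal r}"

definition closed_proper_convex_on :: "'v::euclidean_space set \<Rightarrow> ('v \<Rightarrow> ereal) \<Rightarrow> bool" where
  "closed_proper_convex_on V \<phi> \<longleftrightarrow>
     convex (epi_on V \<phi>) \<and> closed (epi_on V \<phi>) \<and>
     (\<exists>v\<in>V. \<phi> v < \<infinity>) \<and> (\<forall>v\<in>V. \<phi> v \<noteq> -\<infinity>)"

definition subdiff_on :: "'v::euclidean_space set \<Rightarrow> ('v \<Rightarrow> ereal) \<Rightarrow> 'v \<Rightarrow> 'v set" where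
  "subdiff_on V \<phi> v = {d \<in> V. \<forall>w\<in>V. \<phi> v + ereal (d \<bullet> (w - v)) \<le> \<phi> w}"

definition prox_on :: "'v::euclidean_space set \<Rightarrow> ('v \<Rightarrow> ereal) \<Rightarrow> 'v \<Rightarrow> 'v" where
  "prox_on V \<theta> v = arg_min (\<lambda>w. \<theta> w + ereal (1/2 * (norm (w - v))\<^sup>2)) (\<lambda>w. w \<in> V)"


subsection \<open>The problem, its dual, and the KKT system\<close>

(* The assumptions of (MP) on the y-part; they are used for the z-part in the same form. *)
definition mp_data ::
    "('s::{finite,linorder} \<Rightarrow> 'a::euclidean_space set) \<Rightarrow> ('s \<Rightarrow> 'a \<Rightarrow> real) \<Rightarrow> ('a \<Rightarrow> ereal) \<Rightarrow>
     ('s \<Rightarrow> 'x::euclidean_space \<Rightarrow> 'a) \<Rightarrow> bool" where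
  "mp_data Y f p A \<longleftrightarrow>
     (\<forall>i. subspace (Y i) \<and> linear (A i) \<and> range (A i) \<subseteq> Y i \<and>
          convex_on (Y i) (f i) \<and> f i differentiable_on Y i \<and>
          (\<exists>L. L-lipschitz_on (Y i) (grad_on (Y i) (f i)))) \<and>
     closed_proper_convex_on (Y first_block) p"

definition majorizing ::
    "('s \<Rightarrow> 'a::euclidean_space set) \<Rightarrow> ('s \<Rightarrow> 'a \<Rightarrow> real) \<Rightarrow> ('s \<Rightarrow> 'a \<Rightarrow> 'a) \<Rightarrow> bool" where
  "majorizing Y f \<Sigma>f \<longleftrightarrow>
     (\<forall>i. psd_on (Y i) (\<Sigma>f i) \<and>
          (\<forall>v\<in>Y i. \<forall>v'\<in>Y i.
             f i v \<le> f i v' + grad_on (Y i) (f i) v' \<bullet> (v - v') + 1/2 * sqnorm (\<Sigma>f i) (v - v')))"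

definition residual ::
    "('s::finite \<Rightarrow> 'x::euclidean_space \<Rightarrow> 'a::euclidean_space) \<Rightarrow>
     ('t::finite \<Rightarrow> 'x \<Rightarrow> 'b::euclidean_space) \<Rightarrow> 'x \<Rightarrow> 'a ^ 's \<Rightarrow> 'b ^ 't \<Rightarrow> 'x" where
  "residual A B c y z = stack_adj A y + stack_adj B z - c"

definition mp_objective where
  "mp_objective f p g q y z =
     first_part p y + ereal (sep_sum f y) + first_part q z + ereal (sep_sum g z)"

definition mp_optimal where
  "mp_optimal Y f p A Z g q B c y z \<longleftrightarrow>
     is_arg_min (\<lambda>(y, z). mp_objective f p g q y z)
       (\<lambda>(y, z). y \<in> prod_space Y \<and> z \<in> prod_space Z \<and> stack_adj A y + stack_adj B z = c) (y, z)"

definition dual_objective where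
  "dual_objective Y f p A Z g q B c x =
     (INF (y, z) \<in> prod_space Y \<times> prod_space Z.
        mp_objective f p g q y z + ereal (x \<bullet> residual A B c y z))"

definition dual_optimal where
  "dual_optimal Y f p A Z g q B c x \<longleftrightarrow>
     is_arg_max (dual_objective Y f p A Z g q B c) (\<lambda>_. True) x"

definition kkt_points where
  "kkt_points Y f p A Z g q B c =
     {(y, z, x). y \<in> prod_space Y \<and> z \<in> prod_space Z \<and>
        0 \<in> {v + grad_on (prod_space Y) (sep_sum f) y + stack_op A x | v.
               v \<in> subdiff_on (prod_space Y) (first_part p) y} \<and>
        0 \<in> {w + grad_on (prod_space Z) (sep_sum g) z + stack_op B x | w.
               w \<in> subdiff_on (prod_space Z) (first_part q) z} \<and>
        stack_adj A y + stack_adj B z = c}"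

definition kkt_map where
  "kkt_map Y f p A Z g q B c =
     (\<lambda>(y, z, x).
        (y - prox_on (prod_space Y) (first_part p)
               (y - (grad_on (prod_space Y) (sep_sum f) y + stack_op A x)),
         z - prox_on (prod_space Z) (first_part q)
               (z - (grad_on (prod_space Z) (sep_sum g) z + stack_op B x)),
         c - stack_adj A y - stack_adj B z))"

definition kkt_metrically_subregular where
  "kkt_metrically_subregular Y f p A Z g q B c u0 \<longleftrightarrow>
     kkt_map Y f p A Z g q B c u0 = 0 \<and>
     (\<exists>\<eta>>0. \<exists>\<rho>>0. \<forall>u \<in> prod_space Y \<times> prod_space Z \<times> UNIV. norm (u - u0) \<le> \<rho> \<longrightarrow>
        infdist u (kkt_points Y f p A Z g q B c) \<le> \<eta> * norm (kkt_map Y f p A Z g q B c u))"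


subsection \<open>The majorized sGS-iPADMM\<close>

definition majorized_fun where
  "majorized_fun Y f \<Sigma>f y y' =
     sep_sum f y' + grad_on (prod_space Y) (sep_sum f) y' \<bullet> (y - y')
       + 1/2 * sqnorm (Diag \<Sigma>f) (y - y')"

definition majorized_lagrangian where
  "majorized_lagrangian Y f p A \<Sigma>f Z g q B \<Sigma>g c \<sigma> y z x y' z' =
     ereal (majorized_fun Y f \<Sigma>f y y') + first_part p y
       + ereal (majorized_fun Z g \<Sigma>g z z') + first_part q z
       + ereal (x \<bullet> residual A B c y z) + ereal (\<sigma>/2 * (norm (residual A B c y z))\<^sup>2)"

(* The vector (a_1, ..., a_(i-1), v, b_(i+1), ..., b_s). *)
definition put_block ::
    "'s::{finite,linorder} \<Rightarrow> ('a, 's) vec \<Rightarrow> 'a \<Rightarrow> ('a, 's) vec \<Rightarrow> ('a, 's) vec" where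
  "put_block i a v b = (\<chi> l. if l < i then a $ l else if l = i then v else b $ l)"

(* In the update of the first block, put_block ignores its argument y k (resp. z k).
   The first components of yb k and zb k are never used. *)
definition sgs_ipadmm where
  "sgs_ipadmm Y f p A \<Sigma>f S Z g q B \<Sigma>g T c \<sigma> \<tau> y z x \<longleftrightarrow>
     (let L = majorized_lagrangian Y f p A \<Sigma>f Z g q B \<Sigma>g c \<sigma> in
      y 0 \<in> prod_space Y \<and> first_part p (y 0) < \<infinity> \<and>
      z 0 \<in> prod_space Z \<and> first_part q (z 0) < \<infinity> \<and>
      (\<exists>yb zb. \<forall>k::nat.
        (\<forall>i. i \<noteq> first_block \<longrightarrow>
          is_arg_min (\<lambda>v. L (put_block i (y k) v (yb k)) (z k) (x k) (y k) (z k)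
                        + ereal (1/2 * sqnorm (S i) (v - y k $ i)))
            (\<lambda>v. v \<in> Y i) (yb k $ i)) \<and>
        is_arg_min (\<lambda>v. L (put_block first_block (y k) v (yb k)) (z k) (x k) (y k) (z k)
                      + ereal (1/2 * sqnorm (S first_block) (v - y k $ first_block)))
          (\<lambda>v. v \<in> Y first_block) (y (Suc k) $ first_block) \<and>
        (\<forall>i. i \<noteq> first_block \<longrightarrow>
          is_arg_min (\<lambda>v. L (put_block i (y (Suc k)) v (yb k)) (z k) (x k) (y k) (z k)
                        + ereal (1/2 * sqnorm (S i) (v - y k $ i)))
            (\<lambda>v. v \<in> Y i) (y (Suc k) $ i)) \<and>
        (\<forall>j. j \<noteq> first_block \<longrightarrow>
          is_arg_min (\<lambda>w. L (y (Suc k)) (put_block j (z k) w (zb k)) (x k) (y k) (z k)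
                        + ereal (1/2 * sqnorm (T j) (w - z k $ j)))
            (\<lambda>w. w \<in> Z j) (zb k $ j)) \<and>
        is_arg_min (\<lambda>w. L (y (Suc k)) (put_block first_block (z k) w (zb k)) (x k) (y k) (z k)
                      + ereal (1/2 * sqnorm (T first_block) (w - z k $ first_block)))
          (\<lambda>w. w \<in> Z first_block) (z (Suc k) $ first_block) \<and>
        (\<forall>j. j \<noteq> first_block \<longrightarrow>
          is_arg_min (\<lambda>w. L (y (Suc k)) (put_block j (z (Suc k)) w (zb k)) (x k) (y k) (z k)
                        + ereal (1/2 * sqnorm (T j) (w - z k $ j)))
            (\<lambda>w. w \<in> Z j) (z (Suc k) $ j)) \<and>
        x (Suc k) = x k + (\<tau> * \<sigma>) *\<^sub>R residual A B c (y (Suc k)) (z (Suc k))))"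


subsection \<open>The symmetric Gauss-Seidel operator\<close>

definition tilde_op ::
    "('s::finite \<Rightarrow> 'x::euclidean_space \<Rightarrow> 'a::euclidean_space) \<Rightarrow> ('s \<Rightarrow> 'a \<Rightarrow> 'a) \<Rightarrow>
     ('s \<Rightarrow> 'a \<Rightarrow> 'a) \<Rightarrow> real \<Rightarrow> 'a ^ 's \<Rightarrow> 'a ^ 's" where
  "tilde_op A \<Sigma>f S \<sigma> y =
     (1/2) *\<^sub>R Diag \<Sigma>f y + \<sigma> *\<^sub>R stack_op A (stack_adj A y) + Diag S y"

(* The (i, l) block of M is the operator mapping v to M (axis l v) $ i. *)
definition upper_part ::
    "(('a::euclidean_space, 's::{finite,linorder}) vec \<Rightarrow> ('a, 's) vec) \<Rightarrow> ('a, 's) vec \<Rightarrow> ('a, 's) vec" where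
  "upper_part M y = (\<chi> i. \<Sum>l\<in>{i<..}. M (axis l (y $ l)) $ i)"

definition diag_part ::
    "('a::euclidean_space ^ 's \<Rightarrow> 'a ^ 's) \<Rightarrow> 'a ^ 's::finite \<Rightarrow> 'a ^ 's" where
  "diag_part M y = (\<chi> i. M (axis i (y $ i)) $ i)"

definition sGS ::
    "('s::{finite,linorder} \<Rightarrow> 'a::euclidean_space set) \<Rightarrow>
     (('a, 's) vec \<Rightarrow> ('a, 's) vec) \<Rightarrow> ('a, 's) vec \<Rightarrow> ('a, 's) vec" where
  "sGS Y M y =
     upper_part M (inv_into (prod_space Y) (diag_part M) (adjoint (upper_part M) y))"


(* Linear convergence is understood in the R-linear (root) sense. *)
definition linearly_convergent_to :: "(nat \<Rightarrow> 'v::real_normed_vector) \<Rightarrow> 'v \<Rightarrow> bool" where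
  "linearly_convergent_to u l \<longleftrightarrow>
     (\<exists>C. \<exists>\<mu>. 0 < \<mu> \<and> \<mu> < 1 \<and> (\<forall>k. norm (u k - l) \<le> C * \<mu> ^ k))"

end

theory Submission
  imports Defs
begin

text \<open>One symmetric Gauss-Seidel sweep over the blocks is the same as one proximal step in all
  blocks simultaneously, with an additional positive semidefinite proximal term, so the algorithm is a
  two-block majorized ADMM with metrics \<open>G\<^sub>y\<close>, \<open>G\<^sub>z\<close> such that \<open>G\<^sub>y - \<Sigma>f/2\<close> is positive semidefinite
  and positive definite on the kernel of the constraint operator. Convexity and majorization give
  \<open>(F a - F b) \<bullet> h \<ge> - |h - (a - b)|\<^sup>2 / 4\<close> in the norm of the majorizing operator, which is exactly
  what the half of that operator pays for. Monotonicity of the subdifferentials then yields a Lyapunov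
  function, decreasing by at least a multiple of the squared step: the weighted squared distance to a
  KKT point plus the last \<open>z\<close>-step and the last residual, the latter weighted according to \<open>\<tau>\<close>, where
  \<open>\<tau> < (1 + sqrt 5) / 2\<close> enters. Cluster points are KKT points, and convergence follows by measuring
  the distance to one of them. Under metric subregularity the distance to the KKT set is bounded by
  the step, so the infimum of the Lyapunov functions over the KKT set decays geometrically, and with it
  the steps.\<close>

section \<open>Two-block majorized ADMM\<close>

text \<open>The obstacle is the product of the \<open>z\<close>-step with the new residual, which
  has no sign within one iteration. Comparing the optimality conditions of two consecutive
  \<open>z\<close>-steps trades it for a telescoping term and a product with the previous residual
  carrying the factor \<open>1 - \<tau>\<close>. A Young split of the latter must leave weights with
  \<open>m + \<kappa> \<le> 2 - \<tau>\<close>; for \<open>\<tau> > 1\<close>, splitting in the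
  ratio \<open>\<tau>\<close> gives
  \<open>\<kappa> = (1 + \<tau> - \<tau>\<^sup>2) / \<tau>\<close>, which is positive exactly below
  the golden ratio. The other obstacle is that the metrics may be degenerate: they control a vector
  only together with its image under the constraint operator, so estimates in \<open>y\<close> pass
  through the residuals, and the residual needs a strictly positive weight in the Lyapunov function.
  Of the subdifferential the locale keeps only monotonicity and a closed graph; \<open>F\<close>,
  \<open>E\<close>, \<open>G\<close> stand for the gradient, the majorizing operator and the metric
  of a whole group of blocks.\<close>

locale prox_block =
  fixes V :: "'v::euclidean_space set" and F E G :: "'v \<Rightarrow> 'v" and P :: "'v \<Rightarrow> 'v set"
    and A :: "'x::euclidean_space \<Rightarrow> 'v" and At :: "'v \<Rightarrow> 'x" and L \<gamma> :: real
  assumes subspace_V: "subspace V"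
    and linear_A: "linear A" and linear_At: "linear At"
    and A_adj: "A u \<bullet> v = u \<bullet> At v"
    and F_lipschitz: "\<lbrakk>a \<in> V; b \<in> V\<rbrakk> \<Longrightarrow> norm (F a - F b) \<le> L * norm (a - b)"
    and F_cocoercive: "\<lbrakk>a \<in> V; b \<in> V; h \<in> V\<rbrakk>
      \<Longrightarrow> (F a - F b) \<bullet> h \<ge> - (1/4) * sqnorm E (h - (a - b))"
    and linear_G: "linear G"
    and G_sym: "\<lbrakk>a \<in> V; b \<in> V\<rbrakk> \<Longrightarrow> G a \<bullet> b = a \<bullet> G b"
    and E_nonneg: "v \<in> V \<Longrightarrow> 0 \<le> sqnorm E v"
    and G_ge: "v \<in> V \<Longrightarrow> 1/2 * sqnorm E v \<le> sqnorm G v"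
    and \<gamma>_pos: "0 < \<gamma>"
    and coercive: "v \<in> V \<Longrightarrow> \<gamma> * (norm v)\<^sup>2 \<le> sqnorm G v - 1/2 * sqnorm E v + (norm (At v))\<^sup>2"
    and P_monotone: "\<lbrakk>a \<in> V; b \<in> V; d \<in> P a; e \<in> P b\<rbrakk> \<Longrightarrow> 0 \<le> (d - e) \<bullet> (a - b)"
    and P_closed: "\<lbrakk>\<And>n::nat. vs n \<in> V; \<And>n. ds n \<in> P (vs n); vs \<longlonglongrightarrow> a; ds \<longlonglongrightarrow> b\<rbrakk> \<Longrightarrow> b \<in> P a"
begin

lemma G_nonneg: "v \<in> V \<Longrightarrow> 0 \<le> sqnorm G v"
  using G_ge[of v] E_nonneg[of v] by linarith

lemma G_polar:
  assumes "a \<in> V" "b \<in> V"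
  shows "2 * (G (a - b) \<bullet> a) = sqnorm G a + sqnorm G (a - b) - sqnorm G b"
  using G_sym[OF assms]
  by (simp add: sqnorm_def linear_diff[OF linear_G] inner_simps inner_commute algebra_simps)

text \<open>Monotonicity is applied between the new iterate and the solution, cocoercivity between
  the old iterate and the solution with \<open>h = yn - ys\<close>, so that the shift
  \<open>h - (a - b)\<close> is exactly the step. The defect, a quarter of the squared
  \<open>E\<close>-norm, doubles to the half subtracted here.\<close>

lemma step_bound:
  assumes V: "yn \<in> V" "y0 \<in> V" "ys \<in> V"
    and n: "- F y0 - G (yn - y0) - A w \<in> P yn" and s: "- F ys - A ws \<in> P ys"
  shows "sqnorm G (yn - ys) - sqnorm G (y0 - ys) + (sqnorm G (yn - y0) - 1/2 * sqnorm E (yn - y0))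
     + 2 * ((w - ws) \<bullet> At (yn - ys)) \<le> 0"
proof -
  have V': "yn - ys \<in> V" "y0 - ys \<in> V"
    using V subspace_V subspace_diff by blast+
  have eq: "(yn - ys) - (y0 - ys) = yn - y0" by simp
  have "0 \<le> ((- F y0 - G (yn - y0) - A w) - (- F ys - A ws)) \<bullet> (yn - ys)"
    using P_monotone[OF V(1,3) n s] .
  also have "\<dots> = - ((F y0 - F ys) \<bullet> (yn - ys)) - G (yn - y0) \<bullet> (yn - ys) - A (w - ws) \<bullet> (yn - ys)"
    by (simp add: linear_diff[OF linear_A] inner_simps)
  finally have "(F y0 - F ys) \<bullet> (yn - ys) + G (yn - y0) \<bullet> (yn - ys) + (w - ws) \<bullet> At (yn - ys) \<le> 0"
    by (simp add: A_adj)
  moreover have "(F y0 - F ys) \<bullet> (yn - ys) \<ge> - (1/4) * sqnorm E (yn - y0)"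
    using F_cocoercive[OF V(2,3) V'(1)] by simp
  ultimately show ?thesis using G_polar[OF V'] unfolding eq by linarith
qed

text \<open>With two consecutive steps in place of a step and a solution, the shift in cocoercivity
  is the change of step \<open>?d - ?e\<close>. Polarization produces the squared
  \<open>G\<close>-norm of the same vector, which absorbs the defect entirely.\<close>

lemma successive_step_bound:
  assumes V: "z2 \<in> V" "z1 \<in> V" "z0 \<in> V"
    and 2: "- F z1 - G (z2 - z1) - A w2 \<in> P z2" and 1: "- F z0 - G (z1 - z0) - A w1 \<in> P z1"
  shows "sqnorm G (z2 - z1) - sqnorm G (z1 - z0) + 2 * ((w2 - w1) \<bullet> At (z2 - z1)) \<le> 0"
proof -
  let ?d = "z2 - z1" and ?e = "z1 - z0"
  have V': "?d \<in> V" "?e \<in> V"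
    using V subspace_V subspace_diff by blast+
  then have V'': "?d - ?e \<in> V" using subspace_V subspace_diff by blast
  have "0 \<le> ((- F z1 - G ?d - A w2) - (- F z0 - G ?e - A w1)) \<bullet> ?d"
    using P_monotone[OF V(1,2) 2 1] .
  also have "\<dots> = - ((F z1 - F z0) \<bullet> ?d) - G (?d - ?e) \<bullet> ?d - A (w2 - w1) \<bullet> ?d"
    by (simp add: linear_diff[OF linear_A] linear_diff[OF linear_G] inner_simps)
  finally have "(F z1 - F z0) \<bullet> ?d + G (?d - ?e) \<bullet> ?d + (w2 - w1) \<bullet> At ?d \<le> 0"
    unfolding A_adj by linarith
  moreover have "(F z1 - F z0) \<bullet> ?d \<ge> - (1/4) * sqnorm E (?d - ?e)"
    using F_cocoercive[OF V(2,3) V'(1)] .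
  ultimately show ?thesis using G_polar[OF V'] G_ge[OF V''] by linarith
qed

lemma F_tendsto:
  assumes "\<And>n::nat. v n \<in> V" "a \<in> V" "v \<longlonglongrightarrow> a"
  shows "(\<lambda>n. F (v n)) \<longlonglongrightarrow> F a"
proof -
  have "(\<lambda>n. L * norm (v n - a)) \<longlonglongrightarrow> L * norm (a - a)"
    by (intro tendsto_intros assms)
  then have "(\<lambda>n. L * norm (v n - a)) \<longlonglongrightarrow> 0" by simp
  then have "(\<lambda>n. F (v n) - F a) \<longlonglongrightarrow> 0"
    by (rule Lim_null_comparison[OF always_eventually, rotated]) (use F_lipschitz assms(1,2) in blast)
  then show ?thesis by (simp add: LIM_zero_iff)
qed

lemma closed_V: "closed V" by (rule closed_subspace[OF subspace_V])

text \<open>Nonexpansiveness of the proximal map, with \<open>w\<close> the proximal point of \<open>yn - (F yn + A xn)\<close>.\<close>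

lemma prox_residual_bound:
  assumes V: "yn \<in> V" "y0 \<in> V" "w \<in> V"
    and n: "- F y0 - G (yn - y0) - A xt \<in> P yn"
    and w: "(yn - (F yn + A xn)) - w \<in> P w"
    and s: "norm (yn - y0) \<le> s" "norm (xt - xn) \<le> e * s"
  shows "norm (yn - w) \<le> (\<bar>L\<bar> + onorm G + onorm A * e) * s"
proof -
  let ?e = "F yn - F y0 - G (yn - y0) - A (xt - xn)"
  have "0 \<le> ((- F y0 - G (yn - y0) - A xt) - ((yn - (F yn + A xn)) - w)) \<bullet> (yn - w)"
    by (rule P_monotone[OF V(1,3) n w])
  also have "\<dots> = ?e \<bullet> (yn - w) - (norm (yn - w))\<^sup>2"
    by (simp add: linear_diff[OF linear_A] inner_simps power2_norm_eq_inner)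
  finally have "(norm (yn - w))\<^sup>2 \<le> ?e \<bullet> (yn - w)" by simp
  also have "\<dots> \<le> norm ?e * norm (yn - w)" by (rule norm_cauchy_schwarz)
  finally have "norm (yn - w) \<le> norm ?e"
    by (cases "yn = w") (auto simp: power2_eq_square)
  also have "\<dots> \<le> norm (F yn - F y0) + norm (G (yn - y0)) + norm (A (xt - xn))"
    by (intro norm_triangle_le_diff add_mono order_refl)
  also have "\<dots> \<le> \<bar>L\<bar> * s + onorm G * s + onorm A * (e * s)"
  proof (intro add_mono)
    have bl: "bounded_linear G" "bounded_linear A"
      using linear_G linear_A by (simp_all add: linear_conv_bounded_linear)
    have "L * norm (yn - y0) \<le> \<bar>L\<bar> * s" using s(1) by (intro mult_mono) auto
    then show "norm (F yn - F y0) \<le> \<bar>L\<bar> * s" using F_lipschitz[OF V(1,2)] by linarith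
    show "norm (G (yn - y0)) \<le> onorm G * s"
      using order_trans[OF onorm[OF bl(1)] mult_left_mono[OF s(1) onorm_pos_le[OF bl(1)]]] .
    show "norm (A (xt - xn)) \<le> onorm A * (e * s)"
      using order_trans[OF onorm[OF bl(2)] mult_left_mono[OF s(2) onorm_pos_le[OF bl(2)]]] .
  qed
  finally show ?thesis by (simp add: algebra_simps)
qed

end

text \<open>Young's inequality tuned to the step length: \<open>m\<close> is the share charged to
  the previous residual, \<open>\<kappa>\<close> the surplus left for the new residual and for the
  constraint image of the \<open>z\<close>-step.\<close>

lemma golden_ratio_weights:
  fixes \<tau> :: real
  assumes "0 < \<tau>" "\<tau> < (1 + sqrt 5) / 2"
  obtains m \<kappa> where "0 \<le> m" "0 < \<kappa>" "\<kappa> \<le> 2 - \<tau> - m"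
    "\<And>r b :: 'x::real_inner. - 2 * (1 - \<tau>) * (r \<bullet> b) \<ge> - m * (norm r)\<^sup>2 - (1 - \<kappa>) * (norm b)\<^sup>2"
proof (cases "\<tau> \<le> 1")
  case True
  show ?thesis
  proof (rule that[of "1 - \<tau>" \<tau>])
    fix r b :: 'x
    have "0 \<le> (norm (r - b))\<^sup>2" by simp
    then have "2 * (r \<bullet> b) \<le> (norm r)\<^sup>2 + (norm b)\<^sup>2"
      by (simp add: power2_norm_eq_inner inner_simps inner_commute)
    from mult_left_mono[OF this, of "1 - \<tau>"] True
    show "- 2 * (1 - \<tau>) * (r \<bullet> b) \<ge> - (1 - \<tau>) * (norm r)\<^sup>2 - (1 - \<tau>) * (norm b)\<^sup>2"
      by (simp add: algebra_simps)
  qed (use assms True in auto)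
next
  case False
  \<comment> \<open>This is the golden ratio bound in disguise, because \<open>4 * (1 + \<tau> -
    \<tau>\<^sup>2) = 5 - (2 * \<tau> - 1)\<^sup>2\<close>.\<close>
  have "(2 * \<tau> - 1)\<^sup>2 < (sqrt 5)\<^sup>2"
    using False assms by (intro power_strict_mono) auto
  then have g: "0 < 1 + \<tau> - \<tau>\<^sup>2" by (simp add: power2_eq_square algebra_simps)
  have kle: "(1 + \<tau> - \<tau>\<^sup>2) / \<tau> \<le> 1 + \<tau> - \<tau>\<^sup>2"
    using g False by (simp add: divide_le_eq)
  show ?thesis
  \<comment> \<open>The square of \<open>r + \<tau> *\<^sub>R b\<close> splits the product with
    weights \<open>1 / \<tau>\<close> and \<open>\<tau>\<close>; with the resulting
    \<open>m\<close>, the chosen \<open>\<kappa>\<close> attains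
    \<open>2 - \<tau> - m\<close>.\<close>
  proof (rule that[of "(\<tau> - 1) / \<tau>" "(1 + \<tau> - \<tau>\<^sup>2) / \<tau>"])
    show "0 < (1 + \<tau> - \<tau>\<^sup>2) / \<tau>" using g assms by simp
    show "(1 + \<tau> - \<tau>\<^sup>2) / \<tau> \<le> 2 - \<tau> - (\<tau> - 1) / \<tau>" using assms
      by (simp add: field_simps power2_eq_square)
    fix r b :: 'x
    have "(norm (r + \<tau> *\<^sub>R b))\<^sup>2 = (norm r)\<^sup>2 + \<tau> * (2 * (r \<bullet> b) + \<tau> * (norm b)\<^sup>2)"
      unfolding power2_norm_eq_inner by (simp add: inner_simps inner_commute algebra_simps)
    then have "0 \<le> (norm r)\<^sup>2 / \<tau> + (2 * (r \<bullet> b) + \<tau> * (norm b)\<^sup>2)"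
      using assms zero_le_power2[of "norm (r + \<tau> *\<^sub>R b)"]
      by (metis add_divide_distrib divide_nonneg_pos nonzero_mult_div_cancel_left order_less_irrefl)
    then have "- 2 * (r \<bullet> b) \<le> (norm r)\<^sup>2 / \<tau> + \<tau> * (norm b)\<^sup>2" by simp
    from mult_left_mono[OF this, of "\<tau> - 1"] False
    have "2 * (1 - \<tau>) * (r \<bullet> b) \<le> (\<tau> - 1) / \<tau> * (norm r)\<^sup>2 + (\<tau>\<^sup>2 - \<tau>) * (norm b)\<^sup>2"
      by (simp add: algebra_simps power2_eq_square)
    also have "\<dots> \<le> (\<tau> - 1) / \<tau> * (norm r)\<^sup>2 + (1 - (1 + \<tau> - \<tau>\<^sup>2) / \<tau>) * (norm b)\<^sup>2"
      using kle by (intro add_left_mono mult_right_mono) auto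
    finally show "- 2 * (1 - \<tau>) * (r \<bullet> b) \<ge> - ((\<tau> - 1) / \<tau>) * (norm r)\<^sup>2
        - (1 - (1 + \<tau> - \<tau>\<^sup>2) / \<tau>) * (norm b)\<^sup>2"
      unfolding mult_minus_left by linarith
  qed (use False in auto)
qed

text \<open>The induction carries the exact partial geometric sum, so that it closes without slack;
  the bound uniform in \<open>n\<close> then passes to the limit in the norm.\<close>

lemma geometric_steps_limit:
  fixes v :: "nat \<Rightarrow> 'v::real_normed_vector"
  assumes \<mu>: "0 < \<mu>" "\<mu> < 1" and step: "\<And>j. norm (v (Suc j) - v j) \<le> M * \<mu> ^ j" and lim: "v \<longlonglongrightarrow> l"
  shows "\<exists>C. \<forall>j. norm (v j - l) \<le> C * \<mu> ^ j"
proof (intro exI allI)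
  fix j
  have M: "0 \<le> M" using order_trans[OF norm_ge_zero step[of 0]] by simp
  have "norm (v j - v (j + n)) \<le> M / (1 - \<mu>) * (\<mu> ^ j - \<mu> ^ (j + n))" for n
  proof (induction n)
    case (Suc n)
    have "norm (v j - v (j + Suc n)) \<le> norm (v j - v (j + n)) + norm (v (Suc (j + n)) - v (j + n))"
      using norm_triangle_ineq4[of "v j - v (j + n)" "v (Suc (j + n)) - v (j + n)"] by simp
    also have "\<dots> \<le> M / (1 - \<mu>) * (\<mu> ^ j - \<mu> ^ (j + n)) + M * \<mu> ^ (j + n)"
      using Suc step by (intro add_mono) auto
    also have "M * \<mu> ^ (j + n) = M / (1 - \<mu>) * ((1 - \<mu>) * \<mu> ^ (j + n))" using \<mu> by simp
    finally show ?case by (simp add: algebra_simps)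
  qed simp
  also have "M / (1 - \<mu>) * (\<mu> ^ j - \<mu> ^ (j + n)) \<le> M / (1 - \<mu>) * \<mu> ^ j" for n
    using M \<mu> by (intro mult_left_mono) auto
  finally have "norm (v j - v (j + n)) \<le> M / (1 - \<mu>) * \<mu> ^ j" for n .
  moreover have "(\<lambda>n. norm (v j - v (j + n))) \<longlonglongrightarrow> norm (v j - l)"
    using LIMSEQ_ignore_initial_segment[OF lim, of j] by (intro tendsto_intros) (simp add: add.commute)
  ultimately show "norm (v j - l) \<le> M / (1 - \<mu>) * \<mu> ^ j"
    using LIMSEQ_le_const2 by blast
qed

text \<open>The constant may absorb finitely many terms: \<open>?S\<close> dominates each of the
  first \<open>N\<close> ratios, and dividing \<open>C\<close> by \<open>\<mu> ^ N\<close> undoes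
  the shift.\<close>

lemma linearly_convergent_to_shift:
  assumes \<mu>: "0 < \<mu>" "\<mu> < 1" and bound: "\<And>j. norm (u (j + N) - l) \<le> C * \<mu> ^ j"
  shows "linearly_convergent_to u l"
  unfolding linearly_convergent_to_def
proof (intro exI conjI allI)
  let ?S = "\<Sum>i<N. norm (u i - l) / \<mu> ^ i"
  fix k
  have C: "0 \<le> C" using order_trans[OF norm_ge_zero bound[of 0]] by simp
  have S: "0 \<le> ?S" using \<mu> by (intro sum_nonneg) auto
  show "norm (u k - l) \<le> (C / \<mu> ^ N + ?S) * \<mu> ^ k"
  proof (cases "k < N")
    case True
    then have "norm (u k - l) / \<mu> ^ k \<le> ?S" using \<mu> by (intro member_le_sum) auto
    then have "norm (u k - l) \<le> ?S * \<mu> ^ k" using \<mu> by (simp add: divide_le_eq)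
    also have "\<dots> \<le> (C / \<mu> ^ N + ?S) * \<mu> ^ k" using C \<mu> by (intro mult_right_mono) auto
    finally show ?thesis .
  next
    case False
    then have "norm (u k - l) \<le> C * \<mu> ^ (k - N)" using bound[of "k - N"] by simp
    also have "\<dots> = C / \<mu> ^ N * \<mu> ^ k" using False \<mu> by (simp add: power_diff)
    also have "\<dots> \<le> (C / \<mu> ^ N + ?S) * \<mu> ^ k" using S \<mu> by (intro mult_right_mono) auto
    finally show ?thesis .
  qed
qed (use \<mu> in auto)

section \<open>Descent of the two-block iteration\<close>

locale two_block =
  y_block: prox_block V F\<^sub>y E\<^sub>y G\<^sub>y P A At L\<^sub>y \<gamma>\<^sub>y + z_block: prox_block W F\<^sub>z E\<^sub>z G\<^sub>z Q B Bt L\<^sub>z \<gamma>\<^sub>z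
  for V :: "'v::euclidean_space set" and F\<^sub>y E\<^sub>y G\<^sub>y P and A :: "'x::euclidean_space \<Rightarrow> 'v" and At L\<^sub>y \<gamma>\<^sub>y
    and W :: "'w::euclidean_space set" and F\<^sub>z E\<^sub>z G\<^sub>z Q and B :: "'x \<Rightarrow> 'w" and Bt L\<^sub>z \<gamma>\<^sub>z +
  fixes c :: 'x and \<sigma> \<tau> :: real and y z x
  assumes \<sigma>_pos: "0 < \<sigma>" and \<tau>_pos: "0 < \<tau>" and \<tau>_golden: "\<tau> < (1 + sqrt 5) / 2"
    and y_in: "y k \<in> V" and z_in: "z k \<in> W"
    and y_step: "- F\<^sub>y (y k) - G\<^sub>y (y (Suc k) - y k) - A (x k + \<sigma> *\<^sub>R (At (y (Suc k)) + Bt (z k) - c))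
       \<in> P (y (Suc k))"
    and z_step: "- F\<^sub>z (z k) - G\<^sub>z (z (Suc k) - z k) - B (x k + \<sigma> *\<^sub>R (At (y (Suc k)) + Bt (z (Suc k)) - c))
       \<in> Q (z (Suc k))"
    and x_step: "x (Suc k) = x k + (\<tau> * \<sigma>) *\<^sub>R (At (y (Suc k)) + Bt (z (Suc k)) - c)"
begin

definition KKT where
  "KKT = {(y, z, x). y \<in> V \<and> z \<in> W \<and> - F\<^sub>y y - A x \<in> P y \<and> - F\<^sub>z z - B x \<in> Q z \<and> At y + Bt z = c}"

definition res where "res k = At (y k) + Bt (z k) - c"

text \<open>Everything is read off after iteration \<open>k\<close>, so that a preceding
  \<open>z\<close>-step exists; this is why the descent at \<open>k\<close> is paid by
  \<open>progress (Suc k)\<close>.\<close>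

definition lyap where
  "lyap m us k = (case us of (ys, zs, xs) \<Rightarrow>
     sqnorm G\<^sub>y (y (Suc k) - ys) + sqnorm G\<^sub>z (z (Suc k) - zs) + \<sigma> * (norm (Bt (z (Suc k) - zs)))\<^sup>2
     + (norm (x (Suc k) - xs))\<^sup>2 / (\<tau> * \<sigma>) + sqnorm G\<^sub>z (z (Suc k) - z k) + m * \<sigma> * (norm (res (Suc k)))\<^sup>2)"

definition progress where
  "progress k = (norm (y (Suc k) - y k))\<^sup>2 + (norm (z (Suc k) - z k))\<^sup>2 + (norm (res (Suc k)))\<^sup>2"

lemma y_diff_in: "ys \<in> V \<Longrightarrow> y k - ys \<in> V"
  using y_in y_block.subspace_V subspace_diff by blast

lemma z_diff_in: "zs \<in> W \<Longrightarrow> z k - zs \<in> W"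
  using z_in z_block.subspace_V subspace_diff by blast

lemma res_split:
  "At ys + Bt zs = c \<Longrightarrow> res k = At (y k - ys) + Bt (z k - zs)"
  by (auto simp: res_def linear_diff[OF y_block.linear_At] linear_diff[OF z_block.linear_At])

text \<open>Sum of the two one-block estimates. The multiplier seen by the \<open>y\<close>-step
  still contains the old \<open>z\<close>; this asymmetry creates both the weighted distance
  \<open>norm (Bt (z k - zs))\<close> and the product of the \<open>z\<close>-step with the
  residual.\<close>

lemma basic_inequality:
  assumes "(ys, zs, xs) \<in> KKT"
  shows "sqnorm G\<^sub>y (y (Suc k) - ys) + sqnorm G\<^sub>z (z (Suc k) - zs) + \<sigma> * (norm (Bt (z (Suc k) - zs)))\<^sup>2
       + (norm (x (Suc k) - xs))\<^sup>2 / (\<tau> * \<sigma>)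
       + (sqnorm G\<^sub>y (y (Suc k) - y k) - 1/2 * sqnorm E\<^sub>y (y (Suc k) - y k))
       + (sqnorm G\<^sub>z (z (Suc k) - z k) - 1/2 * sqnorm E\<^sub>z (z (Suc k) - z k))
       + \<sigma> * (norm (Bt (z (Suc k) - z k)))\<^sup>2 + (2 - \<tau>) * \<sigma> * (norm (res (Suc k)))\<^sup>2
       - 2 * \<sigma> * (Bt (z (Suc k) - z k) \<bullet> res (Suc k))
     \<le> sqnorm G\<^sub>y (y k - ys) + sqnorm G\<^sub>z (z k - zs) + \<sigma> * (norm (Bt (z k - zs)))\<^sup>2
       + (norm (x k - xs))\<^sup>2 / (\<tau> * \<sigma>)"
proof -
  have K: "ys \<in> V" "zs \<in> W" "- F\<^sub>y ys - A xs \<in> P ys" "- F\<^sub>z zs - B xs \<in> Q zs" "At ys + Bt zs = c"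
    using assms by (auto simp: KKT_def)
  define a b b0 r xe where "a = At (y (Suc k) - ys)" and "b = Bt (z (Suc k) - zs)"
    and "b0 = Bt (z k - zs)" and "r = res (Suc k)" and "xe = x k - xs"
  have r: "r = a + b" using res_split[OF K(5)] by (simp add: r_def a_def b_def)
  have beta: "Bt (z (Suc k) - z k) = b - b0"
    by (simp add: b_def b0_def linear_diff[OF z_block.linear_At])
  have w1: "x k + \<sigma> *\<^sub>R (At (y (Suc k)) + Bt (z k) - c) - xs = xe + \<sigma> *\<^sub>R (r - (b - b0))"
    by (simp add: beta[symmetric] xe_def r_def res_def linear_diff[OF z_block.linear_At] algebra_simps)
  have w2: "x k + \<sigma> *\<^sub>R (At (y (Suc k)) + Bt (z (Suc k)) - c) - xs = xe + \<sigma> *\<^sub>R r"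
    by (simp add: xe_def r_def res_def)
  have xp: "x (Suc k) - xs = xe + (\<tau> * \<sigma>) *\<^sub>R r"
    by (simp add: xe_def r_def res_def x_step)
  \<comment> \<open>The multiplier moves along \<open>r\<close>, so
    \<open>2 * (xe \<bullet> r)\<close> becomes a telescoping difference at the price of
    \<open>\<tau> * \<sigma> * (norm r)\<^sup>2\<close>; this turns the coefficient 2 of the
    residual into \<open>2 - \<tau>\<close>.\<close>
  have "(norm (x (Suc k) - xs))\<^sup>2 = (norm xe)\<^sup>2 + (\<tau> * \<sigma>) * (2 * (xe \<bullet> r) + \<tau> * \<sigma> * (norm r)\<^sup>2)"
    unfolding xp power2_norm_eq_inner by (simp add: inner_simps inner_commute algebra_simps)
  then have x2: "(norm (x (Suc k) - xs))\<^sup>2 / (\<tau> * \<sigma>) - (norm xe)\<^sup>2 / (\<tau> * \<sigma>) = 2 * (xe \<bullet> r) + \<tau> * \<sigma> * (norm r)\<^sup>2"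
    using \<tau>_pos \<sigma>_pos by (simp add: add_divide_distrib)
  note Y = y_block.step_bound[OF y_in y_in K(1) y_step K(3), of k, unfolded w1, folded a_def]
  note Z = z_block.step_bound[OF z_in z_in K(2) z_step K(4), of k, unfolded w2, folded b_def]
  \<comment> \<open>Substituting \<open>a = r - b\<close> leaves
    \<open>(b - b0) \<bullet> b\<close>, which polarization turns into the telescoping
    \<open>Bt\<close>-terms.\<close>
  have "2 * ((xe + \<sigma> *\<^sub>R (r - (b - b0))) \<bullet> a) + 2 * ((xe + \<sigma> *\<^sub>R r) \<bullet> b)
    = 2 * (xe \<bullet> r) + 2 * \<sigma> * (norm r)\<^sup>2 - 2 * \<sigma> * ((b - b0) \<bullet> r)
       + \<sigma> * ((norm b)\<^sup>2 + (norm (b - b0))\<^sup>2 - (norm b0)\<^sup>2)"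
    unfolding r power2_norm_eq_inner by (simp add: inner_simps inner_commute algebra_simps)
  with Y Z x2 show ?thesis
    unfolding beta b_def[symmetric] b0_def[symmetric] r_def[symmetric] xe_def[symmetric]
    by (simp add: algebra_simps)
qed

lemma descent:
  obtains m d where "0 < m" "0 < d"
    "\<And>us k. us \<in> KKT \<Longrightarrow> lyap m us (Suc k) + d * progress (Suc k) \<le> lyap m us k"
proof -
  obtain m \<kappa> where m: "0 \<le> m" and \<kappa>: "0 < \<kappa>" "\<kappa> \<le> 2 - \<tau> - m"
    and young: "\<And>r b :: 'x. - 2 * (1 - \<tau>) * (r \<bullet> b) \<ge> - m * (norm r)\<^sup>2 - (1 - \<kappa>) * (norm b)\<^sup>2"
    using golden_ratio_weights[OF \<tau>_pos \<tau>_golden] by metis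
  \<comment> \<open>Bounding \<open>progress\<close> below costs \<open>4 * s\<close>,
    \<open>3 * s\<close> and \<open>4 * s\<close> times the squares of \<open>r\<close>,
    \<open>r0\<close> and \<open>Bt dz\<close>, while \<open>\<kappa> * \<sigma> / 2\<close>,
    \<open>\<kappa> * \<sigma> / 2\<close> and \<open>\<kappa> * \<sigma>\<close> are available;
    \<open>s \<le> 1\<close> lets \<open>Dy\<close> and \<open>Dz\<close> cover their own
    shares.\<close>
  define s where "s = min 1 (\<kappa> * \<sigma> / 8)"
  have s: "0 < s" "s \<le> 1" "8 * s \<le> \<kappa> * \<sigma>" using \<kappa> \<sigma>_pos by (auto simp: s_def)
  define d where "d = s * min 1 (min \<gamma>\<^sub>y \<gamma>\<^sub>z)"
  have d: "0 < d" "d \<le> s" "d \<le> s * \<gamma>\<^sub>y" "d \<le> s * \<gamma>\<^sub>z"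
    using s y_block.\<gamma>_pos z_block.\<gamma>_pos by (auto simp: d_def mult_le_cancel_left2)
  show thesis
  \<comment> \<open>The surplus \<open>\<kappa>\<close> of the new residual is halved: raising the
    weight by \<open>\<kappa> / 2\<close> frees one half for the old residual, which occurs in
    \<open>At dy\<close>. It also keeps the weight positive when \<open>m = 0\<close>.\<close>
  proof (rule that[of "m + \<kappa> / 2" d])
    show "0 < m + \<kappa> / 2" using m \<kappa> by simp
    show "0 < d" by fact
    fix us k assume "us \<in> KKT"
    then obtain ys zs xs where us: "us = (ys, zs, xs)" and K: "(ys, zs, xs) \<in> KKT"
      by (cases us) auto
    define dy dz r r0 where "dy = y (Suc (Suc k)) - y (Suc k)" and "dz = z (Suc (Suc k)) - z (Suc k)"
      and "r = res (Suc (Suc k))" and "r0 = res (Suc k)"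
    have in_V: "dy \<in> V" "dz \<in> W"
      by (simp_all add: dy_def dz_def y_diff_in z_diff_in y_in z_in)
    \<comment> \<open>The effective multiplier of a \<open>z\<close>-step advances by
      \<open>\<sigma>\<close> times the residual, but \<open>x\<close> by only the fraction
      \<open>\<tau>\<close> of that; the mismatch is the factor \<open>1 - \<tau>\<close>.\<close>
    have w: "x (Suc k) + \<sigma> *\<^sub>R (At (y (Suc (Suc k))) + Bt (z (Suc (Suc k))) - c)
        - (x k + \<sigma> *\<^sub>R (At (y (Suc k)) + Bt (z (Suc k)) - c)) = \<sigma> *\<^sub>R (r - (1 - \<tau>) *\<^sub>R r0)"
      by (simp add: x_step[of k] r_def r0_def res_def algebra_simps)
    have S: "sqnorm G\<^sub>z dz - sqnorm G\<^sub>z (z (Suc k) - z k) + 2 * (\<sigma> *\<^sub>R (r - (1 - \<tau>) *\<^sub>R r0) \<bullet> Bt dz) \<le> 0"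
      using z_block.successive_step_bound[OF z_in z_in z_in z_step z_step, of k] unfolding w dz_def .
    have "\<sigma> * (- 2 * (1 - \<tau>) * (r0 \<bullet> Bt dz)) \<ge> \<sigma> * (- m * (norm r0)\<^sup>2 - (1 - \<kappa>) * (norm (Bt dz))\<^sup>2)"
      using young \<sigma>_pos by (intro mult_left_mono) auto
    then have S': "- 2 * \<sigma> * (Bt dz \<bullet> r) \<ge> sqnorm G\<^sub>z dz - sqnorm G\<^sub>z (z (Suc k) - z k)
        - m * \<sigma> * (norm r0)\<^sup>2 - (1 - \<kappa>) * \<sigma> * (norm (Bt dz))\<^sup>2"
      using S by (simp add: inner_simps inner_commute algebra_simps)
    have R: "\<kappa> * (\<sigma> * (norm r)\<^sup>2) \<le> (2 - \<tau> - m) * (\<sigma> * (norm r)\<^sup>2)"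
      using \<kappa> \<sigma>_pos by (intro mult_right_mono) auto
    have At: "At dy = r - r0 - Bt dz"
      by (simp add: r_def r0_def dy_def dz_def res_def linear_diff[OF y_block.linear_At]
          linear_diff[OF z_block.linear_At])
    \<comment> \<open>The three added squares are chosen to cancel all mixed products.\<close>
    have "(norm (At dy))\<^sup>2 + (norm (r + r0))\<^sup>2 + (norm (r + Bt dz))\<^sup>2 + (norm (r0 - Bt dz))\<^sup>2
       = 3 * (norm r)\<^sup>2 + 3 * (norm r0)\<^sup>2 + 3 * (norm (Bt dz))\<^sup>2"
      unfolding At power2_norm_eq_inner by (simp add: inner_simps inner_commute)
    then have At3: "(norm (At dy))\<^sup>2 \<le> 3 * (norm r)\<^sup>2 + 3 * (norm r0)\<^sup>2 + 3 * (norm (Bt dz))\<^sup>2"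
      using zero_le_power2[of "norm (r + r0)"] zero_le_power2[of "norm (r + Bt dz)"]
        zero_le_power2[of "norm (r0 - Bt dz)"] by linarith
    define Dy Dz where "Dy = sqnorm G\<^sub>y dy - 1/2 * sqnorm E\<^sub>y dy" and "Dz = sqnorm G\<^sub>z dz - 1/2 * sqnorm E\<^sub>z dz"
    have D: "0 \<le> Dy" "0 \<le> Dz" "\<gamma>\<^sub>y * (norm dy)\<^sup>2 \<le> Dy + (norm (At dy))\<^sup>2"
      "\<gamma>\<^sub>z * (norm dz)\<^sup>2 \<le> Dz + (norm (Bt dz))\<^sup>2"
      using y_block.G_ge z_block.G_ge y_block.coercive z_block.coercive in_V by (auto simp: Dy_def Dz_def)
    have D': "s * Dy \<le> Dy" "s * Dz \<le> Dz" using s D by (auto intro: mult_left_le_one_le)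
    have "d * progress (Suc k) = d * (norm dy)\<^sup>2 + d * (norm dz)\<^sup>2 + d * (norm r)\<^sup>2"
      by (simp add: progress_def dy_def dz_def r_def algebra_simps)
    also have "\<dots> \<le> s * \<gamma>\<^sub>y * (norm dy)\<^sup>2 + s * \<gamma>\<^sub>z * (norm dz)\<^sup>2 + s * (norm r)\<^sup>2"
      using d by (intro add_mono mult_right_mono) auto
    also have "\<dots> \<le> s * (Dy + (norm (At dy))\<^sup>2) + s * (Dz + (norm (Bt dz))\<^sup>2) + s * (norm r)\<^sup>2"
      unfolding mult.assoc using D s by (intro add_mono mult_left_mono) auto
    also have "\<dots> \<le> s * (Dy + (3 * (norm r)\<^sup>2 + 3 * (norm r0)\<^sup>2 + 3 * (norm (Bt dz))\<^sup>2))
        + s * (Dz + (norm (Bt dz))\<^sup>2) + s * (norm r)\<^sup>2"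
      using At3 s by (intro add_mono mult_left_mono) auto
    also have "\<dots> = s * Dy + s * Dz + 1/2 * ((8 * s) * (norm r)\<^sup>2) + 3/8 * ((8 * s) * (norm r0)\<^sup>2)
        + 1/2 * ((8 * s) * (norm (Bt dz))\<^sup>2)"
      by (simp add: algebra_simps)
    also have "\<dots> \<le> Dy + Dz + 1/2 * ((\<kappa> * \<sigma>) * (norm r)\<^sup>2) + 1/2 * ((\<kappa> * \<sigma>) * (norm r0)\<^sup>2)
        + 1 * ((\<kappa> * \<sigma>) * (norm (Bt dz))\<^sup>2)"
    proof -
      have "(8 * s) * (norm v)\<^sup>2 \<le> (\<kappa> * \<sigma>) * (norm v)\<^sup>2" "0 \<le> (8 * s) * (norm v)\<^sup>2" for v :: 'x
        using s by (auto intro!: mult_right_mono)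
      from this[of r] this[of r0] this[of "Bt dz"] D' show ?thesis by linarith
    qed
    finally have P: "d * progress (Suc k) \<le> \<dots>" .
    show "lyap (m + \<kappa> / 2) us (Suc k) + d * progress (Suc k) \<le> lyap (m + \<kappa> / 2) us k"
      using basic_inequality[OF K, of "Suc k"] S' R P
      unfolding us lyap_def dy_def[symmetric] dz_def[symmetric] r_def[symmetric] r0_def[symmetric]
        Dy_def[symmetric] Dz_def[symmetric]
      by (simp add: algebra_simps)
  qed
qed


section \<open>The Lyapunov function compared with the distance\<close>

definition u where "u k = (y k, z k, x k)"

lemma progress_nonneg: "0 \<le> progress k"
  by (simp add: progress_def)

lemma lyap_ge:
  assumes "0 < m" "(ys, zs, xs) \<in> KKT"
  shows "0 \<le> lyap m (ys, zs, xs) k"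
    "sqnorm G\<^sub>y (y (Suc k) - ys) \<le> lyap m (ys, zs, xs) k"
    "sqnorm G\<^sub>z (z (Suc k) - zs) \<le> lyap m (ys, zs, xs) k"
    "\<sigma> * (norm (Bt (z (Suc k) - zs)))\<^sup>2 \<le> lyap m (ys, zs, xs) k"
    "(norm (x (Suc k) - xs))\<^sup>2 / (\<tau> * \<sigma>) \<le> lyap m (ys, zs, xs) k"
    "m * \<sigma> * (norm (res (Suc k)))\<^sup>2 \<le> lyap m (ys, zs, xs) k"
proof -
  have K: "ys \<in> V" "zs \<in> W" using assms by (auto simp: KKT_def)
  have "0 \<le> sqnorm G\<^sub>y (y (Suc k) - ys)" "0 \<le> sqnorm G\<^sub>z (z (Suc k) - zs)"
    "0 \<le> sqnorm G\<^sub>z (z (Suc k) - z k)" "0 \<le> \<sigma> * (norm (Bt (z (Suc k) - zs)))\<^sup>2"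
    "0 \<le> (norm (x (Suc k) - xs))\<^sup>2 / (\<tau> * \<sigma>)" "0 \<le> m * \<sigma> * (norm (res (Suc k)))\<^sup>2"
    using y_block.G_nonneg z_block.G_nonneg y_diff_in z_diff_in K z_in assms(1) \<sigma>_pos \<tau>_pos
    by auto
  then show "0 \<le> lyap m (ys, zs, xs) k"
    "sqnorm G\<^sub>y (y (Suc k) - ys) \<le> lyap m (ys, zs, xs) k"
    "sqnorm G\<^sub>z (z (Suc k) - zs) \<le> lyap m (ys, zs, xs) k"
    "\<sigma> * (norm (Bt (z (Suc k) - zs)))\<^sup>2 \<le> lyap m (ys, zs, xs) k"
    "(norm (x (Suc k) - xs))\<^sup>2 / (\<tau> * \<sigma>) \<le> lyap m (ys, zs, xs) k"
    "m * \<sigma> * (norm (res (Suc k)))\<^sup>2 \<le> lyap m (ys, zs, xs) k"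
    by (auto simp: lyap_def)
qed

lemma dist_u: "(dist (u k) (ys, zs, xs))\<^sup>2
    = (norm (y k - ys))\<^sup>2 + (norm (z k - zs))\<^sup>2 + (norm (x k - xs))\<^sup>2"
  by (simp add: u_def dist_norm norm_Pair)

text \<open>Coercivity needs the constraint images. For \<open>z\<close> the image is a summand of
  \<open>lyap\<close>; for \<open>y\<close> it equals the residual minus the image of
  \<open>z\<close>, so the weight \<open>m\<close> enters the constant through its inverse.\<close>

lemma dist_le_lyap:
  assumes m: "0 < m"
  obtains C where "0 < C" "\<And>us k. us \<in> KKT \<Longrightarrow> (dist (u (Suc k)) us)\<^sup>2 \<le> C * lyap m us k"
proof
  let ?C = "(1 + 2 / (m * \<sigma>) + 2 / \<sigma>) / \<gamma>\<^sub>y + (1 + 1 / \<sigma>) / \<gamma>\<^sub>z + \<tau> * \<sigma>"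
  have pos: "0 < \<gamma>\<^sub>y" "0 < \<gamma>\<^sub>z" using y_block.\<gamma>_pos z_block.\<gamma>_pos .
  then show "0 < ?C" using m \<sigma>_pos \<tau>_pos by (intro add_nonneg_pos add_nonneg_nonneg) auto
  fix us k assume "us \<in> KKT"
  then obtain ys zs xs where us: "us = (ys, zs, xs)" and K: "(ys, zs, xs) \<in> KKT"
    by (cases us) auto
  have K': "ys \<in> V" "zs \<in> W" "At ys + Bt zs = c" using K by (auto simp: KKT_def)
  define l where "l = lyap m (ys, zs, xs) k"
  note ge = lyap_ge[OF m K, of k, folded l_def]
  have b: "(norm (Bt (z (Suc k) - zs)))\<^sup>2 \<le> l / \<sigma>"
    using ge(4) \<sigma>_pos by (simp add: field_simps)
  have r: "(norm (res (Suc k)))\<^sup>2 \<le> l / (m * \<sigma>)"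
    using ge(6) \<sigma>_pos m by (simp add: field_simps)
  have "\<gamma>\<^sub>z * (norm (z (Suc k) - zs))\<^sup>2 \<le> l + l / \<sigma>"
    using z_block.coercive[OF z_diff_in[OF K'(2), of "Suc k"]] z_block.E_nonneg[OF z_diff_in[OF K'(2), of "Suc k"]] ge(3) b
    by linarith
  then have Z: "(norm (z (Suc k) - zs))\<^sup>2 \<le> (l + l / \<sigma>) / \<gamma>\<^sub>z"
    using pos by (simp add: pos_le_divide_eq mult.commute)
  have At: "At (y (Suc k) - ys) = res (Suc k) - Bt (z (Suc k) - zs)"
    using res_split[OF K'(3)] by simp
  have "(norm (At (y (Suc k) - ys)))\<^sup>2 + (norm (res (Suc k) + Bt (z (Suc k) - zs)))\<^sup>2
      = 2 * (norm (res (Suc k)))\<^sup>2 + 2 * (norm (Bt (z (Suc k) - zs)))\<^sup>2"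
    unfolding At power2_norm_eq_inner by (simp add: inner_simps inner_commute)
  then have "(norm (At (y (Suc k) - ys)))\<^sup>2 \<le> 2 * (norm (res (Suc k)))\<^sup>2 + 2 * (norm (Bt (z (Suc k) - zs)))\<^sup>2"
    using zero_le_power2[of "norm (res (Suc k) + Bt (z (Suc k) - zs))"] by linarith
  then have "\<gamma>\<^sub>y * (norm (y (Suc k) - ys))\<^sup>2 \<le> l + 2 * (l / (m * \<sigma>)) + 2 * (l / \<sigma>)"
    using y_block.coercive[OF y_diff_in[OF K'(1), of "Suc k"]] y_block.E_nonneg[OF y_diff_in[OF K'(1), of "Suc k"]] ge(2) b r \<open>(norm (At (y (Suc k) - ys)))\<^sup>2 \<le> _\<close>
    by linarith
  then have Y: "(norm (y (Suc k) - ys))\<^sup>2 \<le> (l + 2 * (l / (m * \<sigma>)) + 2 * (l / \<sigma>)) / \<gamma>\<^sub>y"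
    using pos by (simp add: pos_le_divide_eq mult.commute)
  have X: "(norm (x (Suc k) - xs))\<^sup>2 \<le> \<tau> * \<sigma> * l"
    using ge(5) \<sigma>_pos \<tau>_pos by (simp add: divide_le_eq mult.commute)
  have "?C * l = (l + 2 * (l / (m * \<sigma>)) + 2 * (l / \<sigma>)) / \<gamma>\<^sub>y + (l + l / \<sigma>) / \<gamma>\<^sub>z + \<tau> * \<sigma> * l"
    by (simp add: distrib_right add_divide_distrib)
  then show "(dist (u (Suc k)) us)\<^sup>2 \<le> ?C * lyap m us k"
    using X Y Z unfolding us dist_u l_def[symmetric] by linarith
qed

text \<open>Continuity of the operators gives this at every point \<open>us\<close>;
  \<open>progress\<close> pays for the two summands that do not involve \<open>us\<close>.\<close>

lemma lyap_le_dist: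
  assumes m: "0 < m"
  obtains C where "0 < C" "\<And>us k. lyap m us k \<le> C * ((dist (u (Suc k)) us)\<^sup>2 + progress k)"
proof
  have q: "sqnorm H v \<le> onorm H * (norm v)\<^sup>2" if "linear H" for H :: "'e::euclidean_space \<Rightarrow> 'e" and v
  proof -
    have "sqnorm H v \<le> norm v * norm (H v)" unfolding sqnorm_def by (rule norm_cauchy_schwarz)
    also have "\<dots> \<le> norm v * (onorm H * norm v)"
      using onorm[OF linear_conv_bounded_linear[THEN iffD1, OF that]] by (intro mult_left_mono) auto
    finally show ?thesis by (simp add: power2_eq_square algebra_simps)
  qed
  have bl: "bounded_linear G\<^sub>y" "bounded_linear G\<^sub>z" "bounded_linear Bt"
    using y_block.linear_G z_block.linear_G z_block.linear_At by (auto simp: linear_conv_bounded_linear)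
  note o = onorm_pos_le[OF bl(1)] onorm_pos_le[OF bl(2)] onorm_pos_le[OF bl(3)]
  let ?C = "onorm G\<^sub>y + onorm G\<^sub>z + \<sigma> * (onorm Bt)\<^sup>2 + 1 / (\<tau> * \<sigma>) + onorm G\<^sub>z + m * \<sigma>"
  show "0 < ?C" using m \<sigma>_pos \<tau>_pos o by (intro add_nonneg_pos add_nonneg_nonneg) auto
  fix us :: "'v \<times> 'w \<times> 'x" and k
  obtain ys zs xs where us: "us = (ys, zs, xs)" by (cases us) auto
  define N where "N = (dist (u (Suc k)) us)\<^sup>2 + progress k"
  have N: "(norm (y (Suc k) - ys))\<^sup>2 \<le> N" "(norm (z (Suc k) - zs))\<^sup>2 \<le> N" "(norm (x (Suc k) - xs))\<^sup>2 \<le> N"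
    "(norm (z (Suc k) - z k))\<^sup>2 \<le> N" "(norm (res (Suc k)))\<^sup>2 \<le> N"
    by (auto simp: N_def us dist_u progress_def)
  have "sqnorm G\<^sub>y (y (Suc k) - ys) \<le> onorm G\<^sub>y * N" "sqnorm G\<^sub>z (z (Suc k) - zs) \<le> onorm G\<^sub>z * N"
    "sqnorm G\<^sub>z (z (Suc k) - z k) \<le> onorm G\<^sub>z * N"
    using order_trans[OF q mult_left_mono] y_block.linear_G z_block.linear_G N o by blast+
  moreover have "(norm (Bt (z (Suc k) - zs)))\<^sup>2 \<le> (onorm Bt * norm (z (Suc k) - zs))\<^sup>2"
    by (intro power_mono onorm bl) auto
  then have "\<sigma> * (norm (Bt (z (Suc k) - zs)))\<^sup>2 \<le> \<sigma> * ((onorm Bt)\<^sup>2 * N)"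
    using N(2) \<sigma>_pos unfolding power_mult_distrib
    by (intro mult_left_mono order_trans[OF _ mult_left_mono[OF N(2)]]) auto
  moreover have "(norm (x (Suc k) - xs))\<^sup>2 / (\<tau> * \<sigma>) \<le> N / (\<tau> * \<sigma>)"
    using N \<sigma>_pos \<tau>_pos by (intro divide_right_mono) auto
  moreover have "m * \<sigma> * (norm (res (Suc k)))\<^sup>2 \<le> m * \<sigma> * N"
    using N \<sigma>_pos m by (intro mult_left_mono) auto
  ultimately show "lyap m us k \<le> ?C * N"
    by (simp add: lyap_def us distrib_right)
qed


section \<open>Vanishing steps and convergence to a KKT point\<close>

lemma progress_tendsto_0:
  assumes "KKT \<noteq> {}"
  shows "progress \<longlonglongrightarrow> 0"
proof -
  obtain m d where m: "0 < m" and d: "0 < d" and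
    desc: "\<And>us k. us \<in> KKT \<Longrightarrow> lyap m us (Suc k) + d * progress (Suc k) \<le> lyap m us k"
    using descent by metis
  obtain us where us: "us \<in> KKT" using assms by auto
  have nn: "0 \<le> lyap m us k" for k using lyap_ge(1)[OF m] us by (cases us) auto
  have "(\<Sum>k<n. d * progress (Suc k)) + lyap m us n \<le> lyap m us 0" for n
  proof (induction n)
    case (Suc n) then show ?case using desc[OF us, of n] by simp
  qed simp
  then have "(\<Sum>k<n. d * progress (Suc k)) \<le> lyap m us 0" for n
    using nn[of n] by (smt (verit))
  then have "summable (\<lambda>k. d * progress (Suc k))"
    using d progress_nonneg by (intro summableI_nonneg_bounded) auto
  then have "(\<lambda>k. inverse d * (d * progress (Suc k))) \<longlonglongrightarrow> inverse d * 0"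
    by (intro tendsto_mult_left summable_LIMSEQ_zero)
  then show ?thesis using d LIMSEQ_imp_Suc[of progress] by simp
qed

lemma differences_tendsto_0:
  assumes "KKT \<noteq> {}"
  shows "(\<lambda>k. y (Suc k) - y k) \<longlonglongrightarrow> 0" "(\<lambda>k. z (Suc k) - z k) \<longlonglongrightarrow> 0" "(\<lambda>k. res (Suc k)) \<longlonglongrightarrow> 0"
proof -
  have s: "(\<lambda>k. sqrt (progress k)) \<longlonglongrightarrow> 0"
    using tendsto_real_sqrt[OF progress_tendsto_0[OF assms]] by simp
  have *: "a \<longlonglongrightarrow> 0" if "\<And>k. (norm (a k))\<^sup>2 \<le> progress k" for a :: "nat \<Rightarrow> 'q::real_normed_vector"
    using that by (intro Lim_null_comparison[OF always_eventually s]) (auto intro: real_le_rsqrt)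
  show "(\<lambda>k. y (Suc k) - y k) \<longlonglongrightarrow> 0" "(\<lambda>k. z (Suc k) - z k) \<longlonglongrightarrow> 0" "(\<lambda>k. res (Suc k)) \<longlonglongrightarrow> 0"
    by (rule *, simp add: progress_def)+
qed

text \<open>Since the steps vanish, the blocks at the following index have the same limits, and the
  closed graphs pass the step conditions to the limit. The penalty term disappears there because the
  residual tends to zero.\<close>

lemma cluster_point_KKT:
  assumes ne: "KKT \<noteq> {}" and r: "strict_mono r" and l: "(\<lambda>k. u (Suc (r k))) \<longlonglongrightarrow> l"
  shows "l \<in> KKT"
proof -
  obtain ly lz lx where l_eq: "l = (ly, lz, lx)" by (cases l) auto
  have lim: "(\<lambda>k. y (Suc (r k))) \<longlonglongrightarrow> ly" "(\<lambda>k. z (Suc (r k))) \<longlonglongrightarrow> lz" "(\<lambda>k. x (Suc (r k))) \<longlonglongrightarrow> lx"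
    using tendsto_fst[OF l] tendsto_fst[OF tendsto_snd[OF l]] tendsto_snd[OF tendsto_snd[OF l]]
    by (simp_all add: u_def l_eq)
  have dlim: "(\<lambda>k. y (Suc (Suc (r k))) - y (Suc (r k))) \<longlonglongrightarrow> 0"
    "(\<lambda>k. z (Suc (Suc (r k))) - z (Suc (r k))) \<longlonglongrightarrow> 0" "(\<lambda>k. res (Suc (r k))) \<longlonglongrightarrow> 0"
    using LIMSEQ_subseq_LIMSEQ[OF LIMSEQ_Suc[OF differences_tendsto_0(1)[OF ne]] r]
      LIMSEQ_subseq_LIMSEQ[OF LIMSEQ_Suc[OF differences_tendsto_0(2)[OF ne]] r]
      LIMSEQ_subseq_LIMSEQ[OF differences_tendsto_0(3)[OF ne] r]
    by (simp_all add: o_def)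
  have lim': "(\<lambda>k. y (Suc (Suc (r k)))) \<longlonglongrightarrow> ly" "(\<lambda>k. z (Suc (Suc (r k)))) \<longlonglongrightarrow> lz"
    using tendsto_add[OF lim(1) dlim(1)] tendsto_add[OF lim(2) dlim(2)] by simp_all
  have "ly \<in> V" "lz \<in> W"
    using closed_sequentially[OF y_block.closed_V _ lim(1)] closed_sequentially[OF z_block.closed_V _ lim(2)]
      y_in z_in by auto
  note bl = y_block.linear_G z_block.linear_G y_block.linear_At z_block.linear_At y_block.linear_A z_block.linear_A
  note T = bl[unfolded linear_conv_bounded_linear, THEN bounded_linear.tendsto]
  have "(\<lambda>k. res (Suc (r k))) \<longlonglongrightarrow> At ly + Bt lz - c"
    unfolding res_def by (intro tendsto_intros T lim)
  then have feas: "At ly + Bt lz = c" using dlim(3) LIMSEQ_unique by fastforce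
  have "(\<lambda>k. - F\<^sub>y (y (Suc (r k))) - G\<^sub>y (y (Suc (Suc (r k))) - y (Suc (r k)))
      - A (x (Suc (r k)) + \<sigma> *\<^sub>R (At (y (Suc (Suc (r k)))) + Bt (z (Suc (r k))) - c)))
     \<longlonglongrightarrow> - F\<^sub>y ly - G\<^sub>y 0 - A (lx + \<sigma> *\<^sub>R (At ly + Bt lz - c))"
    by (intro tendsto_intros T lim lim' dlim y_block.F_tendsto y_in \<open>ly \<in> V\<close>)
  from y_block.P_closed[OF _ _ lim'(1) this] y_in y_step
  have "- F\<^sub>y ly - A lx \<in> P ly" by (simp add: feas linear_0[OF y_block.linear_G])
  moreover have "(\<lambda>k. - F\<^sub>z (z (Suc (r k))) - G\<^sub>z (z (Suc (Suc (r k))) - z (Suc (r k)))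
      - B (x (Suc (r k)) + \<sigma> *\<^sub>R (At (y (Suc (Suc (r k)))) + Bt (z (Suc (Suc (r k)))) - c)))
     \<longlonglongrightarrow> - F\<^sub>z lz - G\<^sub>z 0 - B (lx + \<sigma> *\<^sub>R (At ly + Bt lz - c))"
    by (intro tendsto_intros T lim lim' dlim z_block.F_tendsto z_in \<open>lz \<in> W\<close>)
  from z_block.P_closed[OF _ _ lim'(2) this] z_in z_step
  have "- F\<^sub>z lz - B lx \<in> Q lz" by (simp add: feas linear_0[OF z_block.linear_G])
  ultimately show ?thesis using \<open>ly \<in> V\<close> \<open>lz \<in> W\<close> feas by (simp add: KKT_def l_eq)
qed

theorem converges_to_KKT:
  assumes ne: "KKT \<noteq> {}"
  obtains l where "l \<in> KKT" "u \<longlonglongrightarrow> l"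
proof -
  obtain m d where m: "0 < m" and d: "0 < d" and
    desc: "\<And>us k. us \<in> KKT \<Longrightarrow> lyap m us (Suc k) + d * progress (Suc k) \<le> lyap m us k"
    using descent by metis
  obtain C where C: "0 < C" "\<And>us k. us \<in> KKT \<Longrightarrow> (dist (u (Suc k)) us)\<^sup>2 \<le> C * lyap m us k"
    using dist_le_lyap[OF m] by metis
  obtain C' where C': "0 < C'" "\<And>us k. lyap m us k \<le> C' * ((dist (u (Suc k)) us)\<^sup>2 + progress k)"
    using lyap_le_dist[OF m] by metis
  have dec: "decseq (lyap m us)" if "us \<in> KKT" for us
    using desc[OF that] d progress_nonneg by (intro decseq_SucI) (smt (verit) mult_nonneg_nonneg)
  obtain us where us: "us \<in> KKT" using ne by auto
  have "dist us (u (Suc k)) \<le> sqrt (C * lyap m us 0)" for k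
    using C(2)[OF us, of k] decseqD[OF dec[OF us], of 0 k] C(1)
    by (intro real_le_rsqrt) (auto simp: dist_commute intro: order_trans mult_left_mono)
  then have "range (\<lambda>k. u (Suc k)) \<subseteq> cball us (sqrt (C * lyap m us 0))"
    unfolding image_subset_iff mem_cball by blast
  then have "bounded (range (\<lambda>k. u (Suc k)))" by (rule bounded_subset[OF bounded_cball])
  then obtain l r where r: "strict_mono r" and l: "(\<lambda>k. u (Suc (r k))) \<longlonglongrightarrow> l"
    using bounded_imp_convergent_subsequence[of "\<lambda>k. u (Suc k)"] by (auto simp: o_def)
  have lK: "l \<in> KKT" by (rule cluster_point_KKT[OF ne r l])
  have nn: "0 \<le> lyap m l k" for k using lyap_ge(1)[OF m] lK by (cases l) auto
  have "(\<lambda>k. C' * ((dist (u (Suc (r k))) l)\<^sup>2 + progress (r k))) \<longlonglongrightarrow> C' * ((dist l l)\<^sup>2 + 0)"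
    using LIMSEQ_subseq_LIMSEQ[OF progress_tendsto_0[OF ne] r]
    by (intro tendsto_intros l) (simp add: o_def)
  then have lim_bd: "(\<lambda>k. C' * ((dist (u (Suc (r k))) l)\<^sup>2 + progress (r k))) \<longlonglongrightarrow> 0" by simp
  have bd: "\<forall>k. 0 \<le> lyap m l (r k)" "\<forall>k. lyap m l (r k) \<le> C' * ((dist (u (Suc (r k))) l)\<^sup>2 + progress (r k))"
    using nn C'(2) by blast+
  have lim_r: "(\<lambda>k. lyap m l (r k)) \<longlonglongrightarrow> 0"
    by (rule tendsto_sandwich[OF always_eventually[OF bd(1)] always_eventually[OF bd(2)] tendsto_const lim_bd])
  \<comment> \<open>Monotonicity upgrades convergence along the subsequence to the full sequence; it
    is available because the cluster point \<open>l\<close> is itself a KKT point.\<close>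
  have lim: "lyap m l \<longlonglongrightarrow> 0"
  proof (rule LIMSEQ_I)
    fix e :: real assume "0 < e"
    from LIMSEQ_D[OF lim_r this] obtain k where "norm (lyap m l (r k) - 0) < e" by blast
    then have k: "lyap m l (r k) < e" by simp
    have "norm (lyap m l n - 0) < e" if "n \<ge> r k" for n
      using decseqD[OF dec[OF lK] that] k nn[of n] by simp
    then show "\<exists>no. \<forall>n\<ge>no. norm (lyap m l n - 0) < e" by blast
  qed
  have sq: "(\<lambda>k. sqrt (C * lyap m l k)) \<longlonglongrightarrow> 0"
    using tendsto_real_sqrt[OF tendsto_mult_left[OF lim, of C]] by simp
  have b: "\<forall>k. 0 \<le> dist (u (Suc k)) l" "\<forall>k. dist (u (Suc k)) l \<le> sqrt (C * lyap m l k)"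
    using C(2)[OF lK] by (auto intro: real_le_rsqrt)
  have "(\<lambda>k. dist (u (Suc k)) l) \<longlonglongrightarrow> 0"
    by (rule tendsto_sandwich[OF always_eventually[OF b(1)] always_eventually[OF b(2)] tendsto_const sq])
  then have "u \<longlonglongrightarrow> l" using LIMSEQ_imp_Suc tendsto_dist_iff by blast
  with lK show thesis by (rule that)
qed

text \<open>The error bound \<open>eb\<close> makes \<open>\<Psi>\<close> at most a multiple of the
  last decrease. As \<open>\<Psi>\<close> only sees the distance to the set \<open>KKT\<close>, the
  rate towards \<open>l\<close> itself is obtained by summing the geometrically small steps.\<close>

theorem linear_rate:
  assumes ne: "KKT \<noteq> {}" and lim: "u \<longlonglongrightarrow> l"
    and eb: "eventually (\<lambda>k. infdist (u (Suc k)) KKT \<le> \<beta> * sqrt (progress k)) sequentially"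
  shows "linearly_convergent_to u l"
proof -
  obtain m d where m: "0 < m" and d: "0 < d" and
    desc: "\<And>us k. us \<in> KKT \<Longrightarrow> lyap m us (Suc k) + d * progress (Suc k) \<le> lyap m us k"
    using descent by metis
  obtain C where C: "0 < C" "\<And>us k. lyap m us k \<le> C * ((dist (u (Suc k)) us)\<^sup>2 + progress k)"
    using lyap_le_dist[OF m] by metis
  obtain N where N: "\<And>k. k \<ge> N \<Longrightarrow> infdist (u (Suc k)) KKT \<le> \<beta> * sqrt (progress k)"
    using eb by (auto simp: eventually_sequentially)
  define \<Psi> where "\<Psi> k = (INF us\<in>KKT. lyap m us k)" for k
  have nn: "0 \<le> lyap m us k" if "us \<in> KKT" for us k using lyap_ge(1)[OF m] that by (cases us) auto
  have \<Psi>_le: "\<Psi> k \<le> lyap m us k" if "us \<in> KKT" for us k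
    unfolding \<Psi>_def using that nn by (intro cINF_lower bdd_belowI2) auto
  have \<Psi>_nn: "0 \<le> \<Psi> k" for k unfolding \<Psi>_def using ne nn by (intro cINF_greatest) auto
  have \<Psi>_desc: "\<Psi> (Suc k) + d * progress (Suc k) \<le> \<Psi> k" for k
  proof -
    have "\<Psi> (Suc k) + d * progress (Suc k) \<le> lyap m us k" if "us \<in> KKT" for us
      using \<Psi>_le[OF that] desc[OF that] by (smt (verit))
    then show ?thesis unfolding \<Psi>_def[of k] using ne by (intro cINF_greatest) auto
  qed
  define K where "K = C * (\<beta>\<^sup>2 + 1)"
  have K: "0 < K" using C by (simp add: K_def add_nonneg_pos)
  have \<Psi>_prog: "\<Psi> k \<le> K * progress k" if "k \<ge> N" for k
  proof -
    define D where "D = infdist (u (Suc k)) KKT"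
    \<comment> \<open>The distance is approached up to \<open>inverse (real (Suc n))\<close> instead
      of being attained at a nearest KKT point.\<close>
    have "\<Psi> k \<le> C * ((D + inverse (real (Suc n)))\<^sup>2 + progress k)" for n
    proof -
      have "D < D + inverse (real (Suc n))" by simp
      then obtain us where us: "us \<in> KKT" "dist (u (Suc k)) us < D + inverse (real (Suc n))"
        unfolding D_def infdist_notempty[OF ne] using cINF_less_iff[OF ne bdd_below_image_dist] by blast
      have "\<Psi> k \<le> C * ((dist (u (Suc k)) us)\<^sup>2 + progress k)"
        using \<Psi>_le[OF us(1)] C(2) order_trans by blast
      also have "\<dots> \<le> C * ((D + inverse (real (Suc n)))\<^sup>2 + progress k)"
        using us(2) C(1) by (intro mult_left_mono add_right_mono power_mono) auto
      finally show ?thesis .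
    qed
    moreover have "(\<lambda>n. C * ((D + inverse (real (Suc n)))\<^sup>2 + progress k)) \<longlonglongrightarrow> C * ((D + 0)\<^sup>2 + progress k)"
      by (intro tendsto_intros LIMSEQ_inverse_real_of_nat)
    ultimately have "\<Psi> k \<le> C * ((D + 0)\<^sup>2 + progress k)" using LIMSEQ_le_const by blast
    also have "(D + 0)\<^sup>2 \<le> (\<beta> * sqrt (progress k))\<^sup>2"
      using N[OF that] infdist_nonneg unfolding D_def by (intro power_mono) auto
    finally show ?thesis using C(1) progress_nonneg by (simp add: K_def power_mult_distrib algebra_simps)
  qed
  \<comment> \<open>Inserting \<open>\<Psi> (Suc k) \<le> K * progress (Suc k)\<close> into the
    descent gives \<open>(1 + d / K) * \<Psi> (Suc k) \<le> \<Psi> k\<close>.\<close>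
  define \<theta> where "\<theta> = K / (K + d)"
  have \<theta>: "0 < \<theta>" "\<theta> < 1" using K d by (auto simp: \<theta>_def)
  have \<Psi>_geo: "\<Psi> (N + j) \<le> \<theta> ^ j * \<Psi> N" for j
  proof (induction j)
    case (Suc j)
    have "K * \<Psi> (Suc (N + j)) + d * \<Psi> (Suc (N + j)) \<le> K * \<Psi> (Suc (N + j)) + d * (K * progress (Suc (N + j)))"
      using \<Psi>_prog[of "Suc (N + j)"] d by (intro add_left_mono mult_left_mono) auto
    also have "\<dots> = K * (\<Psi> (Suc (N + j)) + d * progress (Suc (N + j)))" by (simp add: algebra_simps)
    also have "\<dots> \<le> K * \<Psi> (N + j)" using \<Psi>_desc K by (intro mult_left_mono) auto
    finally have "(K + d) * \<Psi> (Suc (N + j)) \<le> K * \<Psi> (N + j)" by (simp add: algebra_simps)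
    then have "\<Psi> (Suc (N + j)) \<le> \<theta> * \<Psi> (N + j)" using K d by (simp add: \<theta>_def field_simps)
    also have "\<dots> \<le> \<theta> * (\<theta> ^ j * \<Psi> N)" using Suc.IH \<theta> by (intro mult_left_mono) auto
    finally show ?case by (simp add: mult.assoc)
  qed simp
  \<comment> \<open>The summands \<open>1\<close>, \<open>1\<close> and
    \<open>\<tau> * \<sigma>\<close> account for the \<open>y\<close>-, \<open>z\<close>- and
    \<open>x\<close>-increments. \<open>progress\<close> is a squared quantity, so the steps decay
    at the rate \<open>sqrt \<theta>\<close>.\<close>
  define M where "M = (1 + 1 + \<tau> * \<sigma>) * sqrt (\<Psi> N / d)"
  define v where "v j = u (Suc (N + j))" for j
  have "norm (v (Suc j) - v j) \<le> M * sqrt \<theta> ^ j" for j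
  proof -
    let ?k = "Suc (N + j)"
    have "progress ?k \<le> \<Psi> (N + j) / d"
      using \<Psi>_desc[of "N + j"] \<Psi>_nn[of ?k] d by (simp add: pos_le_divide_eq mult.commute)
    also have "\<dots> \<le> \<theta> ^ j * \<Psi> N / d" using \<Psi>_geo d by (intro divide_right_mono) auto
    finally have "sqrt (progress ?k) \<le> sqrt (\<theta> ^ j * (\<Psi> N / d))" by simp
    then have P: "sqrt (progress ?k) \<le> sqrt (\<Psi> N / d) * sqrt \<theta> ^ j"
      unfolding real_sqrt_mult real_sqrt_power by (simp add: mult.commute)
    have n: "norm (y (Suc ?k) - y ?k) \<le> sqrt (progress ?k)" "norm (z (Suc ?k) - z ?k) \<le> sqrt (progress ?k)"
      "norm (res (Suc ?k)) \<le> sqrt (progress ?k)"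
      by (rule real_le_rsqrt, simp add: progress_def)+
    have "norm (x (Suc ?k) - x ?k) \<le> (\<tau> * \<sigma>) * sqrt (progress ?k)"
      using n(3) \<sigma>_pos \<tau>_pos by (simp add: x_step[of ?k] res_def)
    moreover have eq: "v (Suc j) - v j = (y (Suc ?k) - y ?k, z (Suc ?k) - z ?k, x (Suc ?k) - x ?k)"
      by (simp add: v_def u_def)
    have "norm (v (Suc j) - v j) \<le> norm (y (Suc ?k) - y ?k) + (norm (z (Suc ?k) - z ?k) + norm (x (Suc ?k) - x ?k))"
      unfolding eq by (rule order_trans[OF norm_Pair_le add_left_mono[OF norm_Pair_le]])
    ultimately have "norm (v (Suc j) - v j) \<le> (1 + 1 + \<tau> * \<sigma>) * sqrt (progress ?k)"
      using n(1,2) by (simp add: algebra_simps)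
    also have "\<dots> \<le> M * sqrt \<theta> ^ j"
      unfolding M_def mult.assoc using P \<sigma>_pos \<tau>_pos by (intro mult_left_mono) auto
    finally show ?thesis .
  qed
  moreover have "v \<longlonglongrightarrow> l" unfolding v_def
    using LIMSEQ_ignore_initial_segment[OF lim, of "Suc N"] by (simp add: add.commute)
  ultimately have "\<exists>C. \<forall>j. norm (v j - l) \<le> C * sqrt \<theta> ^ j"
    using \<theta> by (intro geometric_steps_limit[of "sqrt \<theta>" v M l]) auto
  then obtain C2 where "\<And>j. norm (u (j + Suc N) - l) \<le> C2 * sqrt \<theta> ^ j"
    unfolding v_def by (auto simp: add.commute)
  with \<theta> show ?thesis by (intro linearly_convergent_to_shift[of "sqrt \<theta>" u "Suc N" l C2]) simp_all
qed

end

section \<open>Gradients, subdifferentials and proximal maps on a subspace\<close>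

lemma subspace_inner_eqI:
  assumes "subspace V" "d \<in> V" "e \<in> V" "\<And>h. h \<in> V \<Longrightarrow> d \<bullet> h = e \<bullet> h"
  shows "d = e"
proof -
  have "d - e \<in> V" using assms subspace_diff by blast
  then have "(d - e) \<bullet> (d - e) = 0" using assms(4) by (simp add: inner_diff_left)
  then show ?thesis by simp
qed

lemma has_derivative_line:
  assumes V: "subspace V" "v \<in> V" "h \<in> V" and d: "(\<phi> has_derivative (\<lambda>h. d \<bullet> h)) (at v within V)"
  shows "((\<lambda>t. \<phi> (v + t *\<^sub>R h)) has_real_derivative d \<bullet> h) (at 0)"
proof -
  have sub: "range (\<lambda>t. v + t *\<^sub>R h) \<subseteq> V"
    using V by (auto intro: subspace_add subspace_mul)
  have 1: "((\<lambda>t. v + t *\<^sub>R h) has_derivative (\<lambda>t. t *\<^sub>R h)) (at 0 within UNIV)"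
    by (auto intro!: derivative_eq_intros)
  have 2: "(\<phi> has_derivative (\<lambda>h. d \<bullet> h)) (at (v + 0 *\<^sub>R h) within range (\<lambda>t. v + t *\<^sub>R h))"
    using has_derivative_subset[OF d sub] by simp
  have "((\<lambda>t. \<phi> (v + t *\<^sub>R h)) has_derivative (\<lambda>t. d \<bullet> (t *\<^sub>R h))) (at 0)"
    using diff_chain_within[OF 1 2] by (simp add: o_def)
  then show ?thesis
    by (simp add: has_field_derivative_def mult_commute_abs)
qed

lemma grad_on_eqI:
  assumes V: "subspace V" "v \<in> V" and d: "d \<in> V" "(\<phi> has_derivative (\<lambda>h. d \<bullet> h)) (at v within V)"
  shows "grad_on V \<phi> v = d"
  unfolding grad_on_def
proof (rule the_equality)
  fix e assume "e \<in> V \<and> (\<phi> has_derivative (\<lambda>h. e \<bullet> h)) (at v within V)"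
  then show "e = d"
    using has_derivative_line[OF V] d DERIV_unique by (blast intro: subspace_inner_eqI[OF V(1)])
qed (use d in auto)

text \<open>The vector \<open>adjoint D 1\<close> represents the derivative on the ambient space;
  its orthogonal projection \<open>d\<close> to \<open>V\<close> represents it along
  \<open>V\<close>, which is all that the limit within \<open>V\<close> sees.\<close>

lemma grad_on_derivative:
  assumes V: "subspace V" "v \<in> V" and diff: "\<phi> differentiable (at v within V)"
  shows "grad_on V \<phi> v \<in> V" "(\<phi> has_derivative (\<lambda>h. grad_on V \<phi> v \<bullet> h)) (at v within V)"
proof -
  obtain D where D: "(\<phi> has_derivative D) (at v within V)" using diff by (auto simp: differentiable_def)
  have lin: "linear D" using has_derivative_linear[OF D] .
  obtain d e where de: "d \<in> span V" "\<And>w. w \<in> span V \<Longrightarrow> orthogonal e w" "adjoint D 1 = d + e"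
    using orthogonal_subspace_decomp_exists by metis
  have dV: "d \<in> V" using de(1) V(1) by (metis span_eq_iff)
  have eq: "D h = d \<bullet> h" if "h \<in> V" for h
  proof -
    have "D h = h \<bullet> adjoint D 1" using adjoint_works[OF lin, of h 1] by simp
    then show ?thesis using de(2)[OF span_base[OF that]] by (simp add: de(3) inner_simps inner_commute orthogonal_def)
  qed
  have "(\<phi> has_derivative (\<lambda>h. d \<bullet> h)) (at v within V)"
    unfolding has_derivative_within
  proof (intro conjI)
    show "bounded_linear (\<lambda>h. d \<bullet> h)" by (rule bounded_linear_inner_right)
    have "((\<lambda>w. (1 / norm (w - v)) *\<^sub>R (\<phi> w - (\<phi> v + D (w - v)))) \<longlongrightarrow> 0) (at v within V)"
      using D by (simp add: has_derivative_within)
    then show "((\<lambda>w. (1 / norm (w - v)) *\<^sub>R (\<phi> w - (\<phi> v + d \<bullet> (w - v)))) \<longlongrightarrow> 0) (at v within V)"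
      by (rule Lim_transform_within[OF _ zero_less_one]) (use eq V subspace_diff in auto)
  qed
  with grad_on_eqI[OF V dV this] dV
  show "grad_on V \<phi> v \<in> V" "(\<phi> has_derivative (\<lambda>h. grad_on V \<phi> v \<bullet> h)) (at v within V)" by simp_all
qed

text \<open>The whole line through \<open>a\<close> and \<open>b\<close> stays in the subspace, so
  the restriction is convex on all reals and the one-variable tangent inequality applies.\<close>

lemma convex_on_grad_le:
  assumes V: "subspace V" and conv: "convex_on V \<phi>" and diff: "\<phi> differentiable_on V" and ab: "a \<in> V" "b \<in> V"
  shows "\<phi> a + grad_on V \<phi> a \<bullet> (b - a) \<le> \<phi> b"
proof -
  have dV: "b - a \<in> V" using V ab subspace_diff by blast
  let ?\<psi> = "\<lambda>t::real. \<phi> (a + t *\<^sub>R (b - a))"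
  have der: "(?\<psi> has_real_derivative grad_on V \<phi> a \<bullet> (b - a)) (at 0 within UNIV)"
    using has_derivative_line[OF V ab(1) dV grad_on_derivative(2)[OF V ab(1)]] diff ab(1)
    by (auto simp: differentiable_on_def)
  have "convex_on UNIV ?\<psi>"
  proof (rule convex_onI)
    fix t s r :: real assume t: "0 < t" "t < 1"
    have "a + ((1 - t) *\<^sub>R s + t *\<^sub>R r) *\<^sub>R (b - a) = (1 - t) *\<^sub>R (a + s *\<^sub>R (b - a)) + t *\<^sub>R (a + r *\<^sub>R (b - a))"
      by (simp add: algebra_simps)
    moreover have "a + s *\<^sub>R (b - a) \<in> V" for s using V ab dV subspace_add subspace_mul by blast
    ultimately show "?\<psi> ((1 - t) *\<^sub>R s + t *\<^sub>R r) \<le> (1 - t) * ?\<psi> s + t * ?\<psi> r"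
      using convex_onD[OF conv, of t] t by simp
  qed simp
  from convex_on_imp_above_tangent[OF this _ _ _ der, of 1] show ?thesis by simp
qed

text \<open>The convexity inequality is combined with the majorization at the shifted points \<open>a + s\<close>
  and \<open>b - s\<close>, where \<open>h = 2 s + (a - b)\<close>; the direct combination only yields the constant \<open>1/2\<close>.\<close>

lemma majorized_grad_cocoercive:
  assumes V: "subspace V" and conv: "convex_on V \<phi>" and diff: "\<phi> differentiable_on V" and lin: "linear E"
    and maj: "\<And>v w. v \<in> V \<Longrightarrow> w \<in> V \<Longrightarrow> \<phi> v \<le> \<phi> w + grad_on V \<phi> w \<bullet> (v - w) + 1/2 * sqnorm E (v - w)"
    and abh: "a \<in> V" "b \<in> V" "h \<in> V"
  shows "- (1/4) * sqnorm E (h - (a - b)) \<le> (grad_on V \<phi> a - grad_on V \<phi> b) \<bullet> h"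
proof -
  define s where "s = (1/2) *\<^sub>R (h - (a - b))"
  have "h - (a - b) \<in> V" using V abh subspace_diff by blast
  then have sV: "s \<in> V" "a + s \<in> V" "b - s \<in> V"
    using V abh subspace_add subspace_diff subspace_mul unfolding s_def by blast+
  note maj[OF sV(2) abh(1)] maj[OF sV(3) abh(2)] convex_on_grad_le[OF V conv diff abh(2) sV(2)]
    convex_on_grad_le[OF V conv diff abh(1) sV(3)]
  moreover have "sqnorm E (b - s - b) = sqnorm E s"
    by (simp add: sqnorm_def linear_neg[OF lin])
  ultimately have "0 \<le> (grad_on V \<phi> a - grad_on V \<phi> b) \<bullet> (2 *\<^sub>R s + (a - b)) + sqnorm E s"
    by (simp add: inner_simps)
  moreover have "2 *\<^sub>R s + (a - b) = h" by (simp add: s_def algebra_simps)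
  moreover have "sqnorm E s = 1/4 * sqnorm E (h - (a - b))"
    by (simp add: s_def sqnorm_def linear_cmul[OF lin])
  ultimately show ?thesis by simp
qed

section \<open>Subdifferentials, minimizers and proximal points\<close>

lemma subdiff_on_finite:
  assumes "closed_proper_convex_on V \<phi>" "v \<in> V" "d \<in> subdiff_on V \<phi> v"
  shows "\<exists>r. \<phi> v = ereal r"
proof -
  obtain w where w: "w \<in> V" "\<phi> w < \<infinity>" using assms(1) by (auto simp: closed_proper_convex_on_def)
  have "\<phi> v + ereal (d \<bullet> (w - v)) \<le> \<phi> w" using assms(3) w by (auto simp: subdiff_on_def)
  then have "\<phi> v \<noteq> \<infinity>" using w(2) by auto
  moreover have "\<phi> v \<noteq> - \<infinity>" using assms(1,2) by (auto simp: closed_proper_convex_on_def)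
  ultimately show ?thesis by (cases "\<phi> v") auto
qed

lemma subdiff_on_monotone:
  assumes "closed_proper_convex_on V \<phi>" "a \<in> V" "b \<in> V" "d \<in> subdiff_on V \<phi> a" "e \<in> subdiff_on V \<phi> b"
  shows "0 \<le> (d - e) \<bullet> (a - b)"
proof -
  obtain r s where rs: "\<phi> a = ereal r" "\<phi> b = ereal s"
    using subdiff_on_finite assms by metis
  have "r + d \<bullet> (b - a) \<le> s" "s + e \<bullet> (a - b) \<le> r"
  proof -
    have "\<phi> a + ereal (d \<bullet> (b - a)) \<le> \<phi> b" "\<phi> b + ereal (e \<bullet> (a - b)) \<le> \<phi> a"
      using assms by (auto simp: subdiff_on_def)
    then show "r + d \<bullet> (b - a) \<le> s" "s + e \<bullet> (a - b) \<le> r" by (simp_all add: rs)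
  qed
  then show ?thesis by (simp add: inner_simps)
qed

text \<open>For fixed \<open>w\<close> with finite value, each subgradient inequality places a point
  in the epigraph; closedness of the epigraph then yields the inequality in the limit.\<close>

lemma subdiff_on_closed:
  assumes sub: "subspace V" and cpc: "closed_proper_convex_on V \<phi>" and v: "\<And>n::nat. v n \<in> V"
    and d: "\<And>n. d n \<in> subdiff_on V \<phi> (v n)" and lim: "v \<longlonglongrightarrow> a" "d \<longlonglongrightarrow> b"
  shows "b \<in> subdiff_on V \<phi> a"
proof -
  have clV: "closed V" by (rule closed_subspace[OF sub])
  have dV: "d n \<in> V" for n using d[of n] by (simp add: subdiff_on_def)
  have bV: "b \<in> V" by (rule closed_sequentially[OF clV dV lim(2)])
  have "\<phi> a + ereal (b \<bullet> (w - a)) \<le> \<phi> w" if w: "w \<in> V" for w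
  proof (cases "\<phi> w")
    case (real r)
    have "\<phi> (v n) \<le> ereal (r - d n \<bullet> (w - v n))" for n
    proof -
      have "\<phi> (v n) + ereal (d n \<bullet> (w - v n)) \<le> ereal r"
        using d[of n] w unfolding subdiff_on_def real[symmetric] by blast
      then show ?thesis by (cases "\<phi> (v n)") auto
    qed
    then have inepi: "(v n, r - d n \<bullet> (w - v n)) \<in> epi_on V \<phi>" for n using v by (simp add: epi_on_def)
    have epilim: "(\<lambda>n. (v n, r - d n \<bullet> (w - v n))) \<longlonglongrightarrow> (a, r - b \<bullet> (w - a))"
      by (intro tendsto_intros lim)
    have "closed (epi_on V \<phi>)" using cpc by (simp add: closed_proper_convex_on_def)
    from closed_sequentially[OF this inepi epilim] have "(a, r - b \<bullet> (w - a)) \<in> epi_on V \<phi>" .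
    then show ?thesis using real by (cases "\<phi> a") (auto simp: epi_on_def)
  next
    case MInf
    then show ?thesis using cpc w by (auto simp: closed_proper_convex_on_def)
  qed simp
  then show ?thesis using bV by (simp add: subdiff_on_def)
qed

lemma is_arg_min_finite:
  assumes "is_arg_min (\<lambda>v. \<theta> v + ereal (Q v)) (\<lambda>v. v \<in> V) m" "w \<in> V" "\<theta> w < \<infinity>" "\<theta> m \<noteq> - \<infinity>"
  shows "\<exists>r. \<theta> m = ereal r"
proof (cases "\<theta> m")
  case PInf
  then have "\<not> (\<theta> w + ereal (Q w) < \<infinity>)" using assms(1,2) by (auto simp: is_arg_min_def)
  then show ?thesis using assms(3) by (cases "\<theta> w") auto
qed (use assms in auto)

text \<open>On the segment from \<open>m\<close> towards \<open>w\<close>, minimality and convexity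
  of \<open>\<theta>\<close> bound the difference quotient of \<open>Q\<close> below by
  \<open>r - s\<close>; letting \<open>t\<close> decrease to zero turns the quotient into the
  directional derivative.\<close>

lemma is_arg_min_subdiff:
  assumes sub: "subspace V" and conv: "convex (epi_on V \<theta>)" and proper: "\<And>v. v \<in> V \<Longrightarrow> \<theta> v \<noteq> - \<infinity>"
    and m: "is_arg_min (\<lambda>v. \<theta> v + ereal (Q v)) (\<lambda>v. v \<in> V) m" and r: "\<theta> m = ereal r"
    and der: "\<And>h. h \<in> V \<Longrightarrow> ((\<lambda>t. Q (m + t *\<^sub>R h)) has_real_derivative - (d \<bullet> h)) (at 0)" and dV: "d \<in> V"
  shows "d \<in> subdiff_on V \<theta> m"
  unfolding subdiff_on_def
proof (intro CollectI conjI ballI dV)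
  have mV: "m \<in> V" using m by (simp add: is_arg_min_def)
  fix w assume w: "w \<in> V"
  show "\<theta> m + ereal (d \<bullet> (w - m)) \<le> \<theta> w"
  proof (cases "\<theta> w")
    case (real s)
    have hV: "w - m \<in> V" using sub w mV subspace_diff by blast
    have "((\<lambda>t. (Q (m + t *\<^sub>R (w - m)) - Q m) / t) \<longlongrightarrow> - (d \<bullet> (w - m))) (at_right 0)"
      using der[OF hV] by (simp add: has_field_derivative_iff filterlim_at_split)
    moreover have "\<forall>\<^sub>F t in at_right 0. r - s \<le> (Q (m + t *\<^sub>R (w - m)) - Q m) / t"
    proof (rule eventually_at_rightI[of 0 1])
      fix t :: real assume t: "t \<in> {0<..<1}"
      have eq: "m + t *\<^sub>R (w - m) = (1 - t) *\<^sub>R m + t *\<^sub>R w" by (simp add: algebra_simps)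
      have "(m, r) \<in> epi_on V \<theta>" "(w, s) \<in> epi_on V \<theta>" using mV w r real by (auto simp: epi_on_def)
      then have "(1 - t) *\<^sub>R (m, r) + t *\<^sub>R (w, s) \<in> epi_on V \<theta>"
        using convexD_alt[OF conv] t by auto
      then have le: "\<theta> (m + t *\<^sub>R (w - m)) \<le> ereal ((1 - t) * r + t * s)" and V: "m + t *\<^sub>R (w - m) \<in> V"
        by (auto simp: epi_on_def eq)
      then obtain q where q: "\<theta> (m + t *\<^sub>R (w - m)) = ereal q"
        using proper by (cases "\<theta> (m + t *\<^sub>R (w - m))") auto
      have "\<not> \<theta> (m + t *\<^sub>R (w - m)) + ereal (Q (m + t *\<^sub>R (w - m))) < \<theta> m + ereal (Q m)"
        using m V by (auto simp: is_arg_min_def)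
      then have "r + Q m \<le> q + Q (m + t *\<^sub>R (w - m))" using q r by simp
      then have "(r - s) * t \<le> Q (m + t *\<^sub>R (w - m)) - Q m" using le q by (simp add: algebra_simps)
      then show "r - s \<le> (Q (m + t *\<^sub>R (w - m)) - Q m) / t" using t by (simp add: pos_le_divide_eq)
    qed simp
    ultimately have "r - s \<le> - (d \<bullet> (w - m))" by (rule tendsto_lowerbound) simp
    then show ?thesis using real r by simp
  next
    case MInf
    then show ?thesis using proper w by simp
  qed simp
qed

text \<open>Reduces the directional derivatives of the proximal and block objectives to algebraic
  identities.\<close>

lemma quadratic_has_real_derivative:
  fixes Q :: "real \<Rightarrow> real"
  assumes "\<And>t. Q t = e + t * d + t\<^sup>2 * r"
  shows "(Q has_real_derivative d) (at 0)"
  unfolding assms by (auto intro!: derivative_eq_intros)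

text \<open>As \<open>prox_on\<close> is a choice among minimizers, existence must be established.
  It is shown on the epigraph, where \<open>J\<close> is continuous although \<open>\<phi>\<close>
  is only lower semicontinuous. The given subgradient at \<open>v0\<close> is the affine minorant
  that makes the sublevel set bounded.\<close>

lemma prox_on_subdiff:
  assumes sub: "subspace V" and cpc: "closed_proper_convex_on V \<phi>"
    and v0: "v0 \<in> V" "d \<in> subdiff_on V \<phi> v0" and a: "a \<in> V"
  shows "prox_on V \<phi> a \<in> V" "a - prox_on V \<phi> a \<in> subdiff_on V \<phi> (prox_on V \<phi> a)"
proof -
  obtain r0 where r0: "\<phi> v0 = ereal r0" using subdiff_on_finite[OF cpc v0] by blast
  have closed: "closed (epi_on V \<phi>)" and conv: "convex (epi_on V \<phi>)" and proper: "\<And>v. v \<in> V \<Longrightarrow> \<phi> v \<noteq> - \<infinity>"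
    using cpc by (auto simp: closed_proper_convex_on_def)
  define J where "J = (\<lambda>(w, r). r + 1/2 * (norm (w - a))\<^sup>2)"
  have contJ: "continuous_on S J" for S unfolding J_def case_prod_unfold by (intro continuous_intros)
  let ?K = "epi_on V \<phi> \<inter> {u. J u \<le> J (v0, r0)}"
  have affine: "r0 + d \<bullet> (w - v0) \<le> r" if "(w, r) \<in> epi_on V \<phi>" for w r
  proof -
    have "ereal r0 + ereal (d \<bullet> (w - v0)) \<le> ereal r"
    proof -
      have "w \<in> V" "\<phi> w \<le> ereal r" using that by (auto simp: epi_on_def)
      moreover have "\<phi> v0 + ereal (d \<bullet> (w - v0)) \<le> \<phi> w"
        using v0(2) \<open>w \<in> V\<close> unfolding subdiff_on_def by blast
      ultimately show ?thesis unfolding r0 by (meson order_trans)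
    qed
    then show ?thesis by simp
  qed
  have "closed ?K"
    by (intro closed_Int closed closed_Collect_le contJ continuous_on_const)
  moreover have "bounded ?K"
  proof -
    \<comment> \<open>The bound results from completing the square in \<open>norm (w - a)\<close>
      with the slope \<open>d\<close> of the minorant.\<close>
    define M where "M = 2 * (J (v0, r0) - r0 + d \<bullet> (v0 - a)) + (norm d)\<^sup>2"
    define R where "R = norm d + sqrt \<bar>M\<bar>"
    have "norm (w - a) \<le> R \<and> \<bar>r\<bar> \<le> \<bar>J (v0, r0)\<bar> + \<bar>r0\<bar> + norm d * (R + norm (a - v0))" if "(w, r) \<in> ?K" for w r
    proof -
      have aff: "r0 + d \<bullet> (w - v0) \<le> r" and J: "r + 1/2 * (norm (w - a))\<^sup>2 \<le> J (v0, r0)"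
        using affine that by (auto simp: J_def)
      have "(norm (w - a + d))\<^sup>2 = (norm (w - a))\<^sup>2 + 2 * (d \<bullet> (w - a)) + (norm d)\<^sup>2"
        by (simp add: power2_norm_eq_inner inner_simps inner_commute)
      also have "\<dots> \<le> M" using aff J by (simp add: M_def inner_simps)
      finally have "(norm (w - a + d))\<^sup>2 \<le> \<bar>M\<bar>" by simp
      then have "norm (w - a + d) \<le> sqrt \<bar>M\<bar>" by (rule real_le_rsqrt)
      moreover have "norm (w - a) \<le> norm (w - a + d) + norm d" using norm_triangle_ineq4[of "w - a + d" d] by simp
      ultimately have R: "norm (w - a) \<le> R" by (simp add: R_def)
      have "norm (w - v0) \<le> norm (w - a) + norm (a - v0)"
        using norm_triangle_ineq[of "w - a" "a - v0"] by simp
      then have "norm d * norm (w - v0) \<le> norm d * (R + norm (a - v0))"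
        using R by (intro mult_left_mono) auto
      then have "\<bar>d \<bullet> (w - v0)\<bar> \<le> norm d * (R + norm (a - v0))"
        using Cauchy_Schwarz_ineq2[of d "w - v0"] by linarith
      moreover have "r \<le> J (v0, r0)" using J zero_le_power2[of "norm (w - a)"] by linarith
      ultimately show ?thesis using R aff by linarith
    qed
    then have "?K \<subseteq> cball a R \<times> cball 0 (\<bar>J (v0, r0)\<bar> + \<bar>r0\<bar> + norm d * (R + norm (a - v0)))"
      by (auto simp: dist_norm norm_minus_commute)
    then show ?thesis using bounded_subset bounded_Times bounded_cball by metis
  qed
  ultimately have "compact ?K" by (simp add: compact_eq_bounded_closed)
  moreover have v0K: "(v0, r0) \<in> ?K" using v0 r0 by (simp add: epi_on_def)
  ultimately have "\<exists>m\<in>?K. \<forall>u\<in>?K. J m \<le> J u"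
    by (intro continuous_attains_inf contJ) blast+
  then obtain m where mK: "m \<in> ?K" and min: "\<And>u. u \<in> ?K \<Longrightarrow> J m \<le> J u" by blast
  obtain w r where m: "m = (w, r)" by (cases m) auto
  let ?Q = "\<lambda>v. 1/2 * (norm (v - a))\<^sup>2"
  have min': "r + ?Q w \<le> s + ?Q v" if "(v, s) \<in> epi_on V \<phi>" for v s
  proof (cases "J (v, s) \<le> J (v0, r0)")
    case True
    then show ?thesis using min[of "(v, s)"] that by (simp add: m J_def)
  next
    case False
    then show ?thesis using min[OF v0K] by (simp add: m J_def)
  qed
  have w: "w \<in> V" "\<phi> w \<le> ereal r" using mK by (auto simp: m epi_on_def)
  have "is_arg_min (\<lambda>v. \<phi> v + ereal (?Q v)) (\<lambda>v. v \<in> V) w"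
    unfolding is_arg_min_def
  proof (intro conjI notI)
    assume "\<exists>v. v \<in> V \<and> \<phi> v + ereal (?Q v) < \<phi> w + ereal (?Q w)"
    then obtain v where v: "v \<in> V" "\<phi> v + ereal (?Q v) < \<phi> w + ereal (?Q w)" by blast
    have "\<phi> w + ereal (?Q w) \<le> ereal r + ereal (?Q w)" using w by (intro add_right_mono)
    with v have lt: "\<phi> v + ereal (?Q v) < ereal (r + ?Q w)" by simp
    then obtain s where s: "\<phi> v = ereal s" using proper[OF v(1)] by (cases "\<phi> v") auto
    then have "s + ?Q v < r + ?Q w" using lt by simp
    with min'[of v s] v s show False by (simp add: epi_on_def)
  qed (use w in auto)
  then have am: "is_arg_min (\<lambda>v. \<phi> v + ereal (?Q v)) (\<lambda>v. v \<in> V) (prox_on V \<phi> a)"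
    unfolding prox_on_def arg_min_def by (rule someI)
  let ?w = "prox_on V \<phi> a"
  show wV: "?w \<in> V" using am by (simp add: is_arg_min_def)
  obtain s where s: "\<phi> ?w = ereal s"
    using is_arg_min_finite[OF am v0(1)] r0 proper[OF wV] by auto
  show "a - ?w \<in> subdiff_on V \<phi> ?w"
  proof (rule is_arg_min_subdiff[OF sub conv proper am s])
    fix h assume "h \<in> V"
    show "((\<lambda>t. ?Q (?w + t *\<^sub>R h)) has_real_derivative - ((a - ?w) \<bullet> h)) (at 0)"
      unfolding power2_norm_eq_inner
      by (rule quadratic_has_real_derivative[where e = "1/2 * ((?w - a) \<bullet> (?w - a))" and r = "1/2 * (h \<bullet> h)"])
        (simp add: power2_eq_square inner_simps inner_commute algebra_simps)
  next
    show "a - ?w \<in> V" using a wV sub subspace_diff by blast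
  qed
qed

section \<open>Product spaces and optimality of KKT points\<close>

lemma subspace_prod_space:
  assumes "\<And>i. subspace (Y i)"
  shows "subspace (prod_space Y)"
  using assms unfolding subspace_def prod_space_def by auto

lemma axis_in_prod_space:
  assumes "\<And>i. subspace (Y i)" "v \<in> Y i"
  shows "axis i v \<in> prod_space Y"
  using assms subspace_0 by (auto simp: prod_space_def axis_def)

section \<open>A group of blocks as one problem on the product space\<close>

locale mp_block =
  fixes Y :: "'s::{finite,linorder} \<Rightarrow> 'a::euclidean_space set" and f :: "'s \<Rightarrow> 'a \<Rightarrow> real"
    and p :: "'a \<Rightarrow> ereal" and A :: "'s \<Rightarrow> 'x::euclidean_space \<Rightarrow> 'a"
  assumes data: "mp_data Y f p A"
begin

abbreviation "V \<equiv> prod_space Y"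
abbreviation "F \<equiv> grad_on (prod_space Y) (sep_sum f)"
abbreviation "P \<equiv> subdiff_on (prod_space Y) (first_part p)"

lemma subspace_Y: "subspace (Y i)" and linear_A: "linear (A i)" and range_A: "A i u \<in> Y i"
  and convex_f: "convex_on (Y i) (f i)" and diff_f: "f i differentiable_on Y i"
  and lipschitz_f: "\<exists>L. L-lipschitz_on (Y i) (grad_on (Y i) (f i))"
  and cpc_p: "closed_proper_convex_on (Y first_block) p"
  using data by (auto simp: mp_data_def)

lemma subspace_V: "subspace V"
  by (rule subspace_prod_space) (rule subspace_Y)

lemma V_nth: "v \<in> V \<Longrightarrow> v $ i \<in> Y i"
  by (simp add: prod_space_def)

lemma linear_stack_op: "linear (stack_op A)"
  by (rule linearI) (simp_all add: stack_op_def vec_eq_iff linear_add[OF linear_A] linear_cmul[OF linear_A])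

lemma linear_stack_adj: "linear (stack_adj A)"
  by (rule linearI) (simp_all add: stack_adj_def linear_add[OF adjoint_linear[OF linear_A]]
      linear_cmul[OF adjoint_linear[OF linear_A]] sum.distrib scaleR_sum_right)

lemma stack_op_adj: "stack_op A u \<bullet> v = u \<bullet> stack_adj A v"
  by (simp add: stack_op_def stack_adj_def inner_vec_def inner_sum_right adjoint_works[OF linear_A])

lemma stack_op_in: "stack_op A u \<in> V"
  by (simp add: stack_op_def prod_space_def range_A)

lemma stack_adj_axis: "stack_adj A (axis i v) = adjoint (A i) v"
proof -
  have "stack_adj A (axis i v) = (\<Sum>l\<in>UNIV. if l = i then adjoint (A i) v else 0)"
    unfolding stack_adj_def axis_def
    by (rule sum.cong) (auto simp: linear_0[OF adjoint_linear[OF linear_A]])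
  then show ?thesis by simp
qed

lemma grad_f:
  assumes "v \<in> Y i"
  shows "grad_on (Y i) (f i) v \<in> Y i"
    "(f i has_derivative (\<lambda>h. grad_on (Y i) (f i) v \<bullet> h)) (at v within Y i)"
  using grad_on_derivative[OF subspace_Y assms] diff_f assms by (auto simp: differentiable_on_def)

lemma grad_sep_sum:
  assumes y: "y \<in> V"
  shows "F y = (\<chi> i. grad_on (Y i) (f i) (y $ i))"
proof (rule grad_on_eqI[OF subspace_V y])
  show "(\<chi> i. grad_on (Y i) (f i) (y $ i)) \<in> V"
    using grad_f(1) y by (simp add: prod_space_def)
  have "((\<lambda>y. f i (y $ i)) has_derivative (\<lambda>h. grad_on (Y i) (f i) (y $ i) \<bullet> (h $ i))) (at y within V)" for i
  proof -
    have "((\<lambda>y. y $ i) has_derivative (\<lambda>h. h $ i)) (at y within V)"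
      by (rule bounded_linear.has_derivative[OF bounded_linear_vec_nth has_derivative_ident])
    moreover have "(f i has_derivative (\<lambda>h. grad_on (Y i) (f i) (y $ i) \<bullet> h)) (at (y $ i) within (\<lambda>y. y $ i) ` V)"
      by (rule has_derivative_subset[OF grad_f(2)]) (use y V_nth in auto)
    ultimately show ?thesis by (rule has_derivative_in_compose)
  qed
  then have "((\<lambda>y. \<Sum>i\<in>UNIV. f i (y $ i)) has_derivative (\<lambda>h. \<Sum>i\<in>UNIV. grad_on (Y i) (f i) (y $ i) \<bullet> (h $ i))) (at y within V)"
    by (rule has_derivative_sum)
  then show "(sep_sum f has_derivative (\<lambda>h. (\<chi> i. grad_on (Y i) (f i) (y $ i)) \<bullet> h)) (at y within V)"
    by (simp add: sep_sum_def[abs_def] inner_vec_def)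
qed

lemma F_in: "y \<in> V \<Longrightarrow> F y \<in> V"
  using grad_f(1) by (simp add: grad_sep_sum) (simp add: prod_space_def)

lemma sep_sum_grad_le:
  assumes "a \<in> V" "b \<in> V"
  shows "sep_sum f a + F a \<bullet> (b - a) \<le> sep_sum f b"
proof -
  have "sep_sum f a + F a \<bullet> (b - a) = (\<Sum>i\<in>UNIV. f i (a $ i) + grad_on (Y i) (f i) (a $ i) \<bullet> (b $ i - a $ i))"
    by (simp add: grad_sep_sum[OF assms(1)] sep_sum_def inner_vec_def sum.distrib)
  also have "\<dots> \<le> sep_sum f b"
    unfolding sep_sum_def
    by (intro sum_mono convex_on_grad_le[OF subspace_Y convex_f diff_f] V_nth assms)
  finally show ?thesis .
qed

lemma F_lipschitz: "\<exists>L. \<forall>a\<in>V. \<forall>b\<in>V. norm (F a - F b) \<le> L * norm (a - b)"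
proof -
  obtain L where L: "\<And>i. (L i)-lipschitz_on (Y i) (grad_on (Y i) (f i))" using lipschitz_f by metis
  have "norm (F a - F b) \<le> (\<Sum>i\<in>UNIV. L i) * norm (a - b)" if ab: "a \<in> V" "b \<in> V" for a b
  proof -
    have "norm (F a - F b) \<le> (\<Sum>i\<in>UNIV. norm ((F a - F b) $ i))"
      unfolding norm_vec_def by (rule L2_set_le_sum) simp
    also have "\<dots> \<le> (\<Sum>i\<in>UNIV. L i * norm (a - b))"
    proof (rule sum_mono)
      fix i
      have "norm ((F a - F b) $ i) \<le> L i * norm ((a - b) $ i)"
        using lipschitz_on_normD[OF L V_nth[OF ab(1)] V_nth[OF ab(2)]] ab by (simp add: grad_sep_sum)
      also have "\<dots> \<le> L i * norm (a - b)"
        by (intro mult_left_mono Finite_Cartesian_Product.norm_nth_le lipschitz_on_nonneg[OF L])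
      finally show "norm ((F a - F b) $ i) \<le> L i * norm (a - b)" .
    qed
    finally show ?thesis by (simp add: sum_distrib_right)
  qed
  then show ?thesis by blast
qed

lemma sqnorm_Diag: "sqnorm (Diag D) v = (\<Sum>i\<in>UNIV. sqnorm (D i) (v $ i))"
  by (simp add: sqnorm_def Diag_def inner_vec_def)

lemma F_cocoercive:
  assumes maj: "majorizing Y f E" and abh: "a \<in> V" "b \<in> V" "h \<in> V"
  shows "- (1/4) * sqnorm (Diag E) (h - (a - b)) \<le> (F a - F b) \<bullet> h"
proof -
  have "- (1/4) * sqnorm (Diag E) (h - (a - b)) = (\<Sum>i\<in>UNIV. - (1/4) * sqnorm (E i) (h $ i - (a $ i - b $ i)))"
    by (simp add: sqnorm_Diag sum_distrib_left sum_negf)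
  also have "\<dots> \<le> (\<Sum>i\<in>UNIV. (grad_on (Y i) (f i) (a $ i) - grad_on (Y i) (f i) (b $ i)) \<bullet> (h $ i))"
    using maj
    by (intro sum_mono majorized_grad_cocoercive[OF subspace_Y convex_f diff_f] V_nth abh)
      (auto simp: majorizing_def psd_on_def self_adjoint_on_def)
  also have "\<dots> = (F a - F b) \<bullet> h"
    by (simp add: grad_sep_sum abh inner_vec_def)
  finally show ?thesis .
qed

text \<open>Over \<open>V\<close> the epigraph is a linear preimage of that of \<open>p\<close>,
  hence convex and closed.\<close>

lemma cpc_first_part: "closed_proper_convex_on V (first_part p)"
  unfolding closed_proper_convex_on_def
proof (intro conjI)
  let ?\<pi> = "\<lambda>u :: ('a, 's) vec \<times> real. (fst u $ first_block, snd u)"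
  have epi: "epi_on V (first_part p) = ?\<pi> -` epi_on (Y first_block) p \<inter> (V \<times> UNIV)"
    using V_nth by (auto simp: epi_on_def first_part_def)
  have lin: "linear ?\<pi>" by (rule linearI) auto
  have cpc: "convex (epi_on (Y first_block) p)" "closed (epi_on (Y first_block) p)"
    using cpc_p by (auto simp: closed_proper_convex_on_def)
  show "convex (epi_on V (first_part p))"
    unfolding epi using convex_linear_vimage[OF lin cpc(1)] subspace_imp_convex[OF subspace_V]
    by (intro convex_Int convex_Times) auto
  show "closed (epi_on V (first_part p))"
    unfolding epi using closed_subspace[OF subspace_V] cpc(2)
    by (intro closed_Int closed_Times closed_vimage continuous_intros) auto
  obtain v where v: "v \<in> Y first_block" "p v < \<infinity>" using cpc_p by (auto simp: closed_proper_convex_on_def)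
  then show "\<exists>v\<in>V. first_part p v < \<infinity>"
    using axis_in_prod_space[of Y v first_block] subspace_Y
    by (intro bexI[of _ "axis first_block v"]) (auto simp: first_part_def)
  show "\<forall>v\<in>V. first_part p v \<noteq> - \<infinity>"
    using cpc_p V_nth by (auto simp: closed_proper_convex_on_def first_part_def)
qed

text \<open>Assembles the optimality conditions of the single blocks into one for the whole group;
  only the first block has a nonsmooth term.\<close>

lemma subdiff_first_partI:
  assumes d: "d $ first_block \<in> subdiff_on (Y first_block) p (v $ first_block)"
    and 0: "\<And>i. i \<noteq> first_block \<Longrightarrow> d $ i = 0"
  shows "d \<in> P v"
proof -
  have "d \<bullet> w = d $ first_block \<bullet> w $ first_block" for w
    unfolding inner_vec_def using 0 by (subst sum.remove[of _ first_block]) auto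
  moreover have "d $ i \<in> Y i" for i
    using d 0 subspace_0[OF subspace_Y] by (cases "i = first_block") (auto simp: subdiff_on_def)
  moreover have "p (v $ first_block) + ereal (d $ first_block \<bullet> (w - v) $ first_block) \<le> p (w $ first_block)"
    if "w \<in> V" for w
    using d V_nth[OF that] by (simp add: subdiff_on_def)
  ultimately show ?thesis by (simp add: subdiff_on_def first_part_def prod_space_def)
qed

text \<open>Adding the subgradient inequality of the nonsmooth part to the gradient inequality of
  the smooth part cancels \<open>F ys\<close>; the adjoint moves what remains onto
  \<open>xs\<close>.\<close>

lemma lagrangian_minimal:
  assumes y: "ys \<in> V" "y \<in> V" and kkt: "- F ys - stack_op A xs \<in> P ys"
  shows "first_part p ys + ereal (sep_sum f ys)
    \<le> first_part p y + ereal (sep_sum f y) + ereal (xs \<bullet> stack_adj A (y - ys))"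
proof -
  obtain r where r: "first_part p ys = ereal r" using subdiff_on_finite[OF cpc_first_part y(1) kkt] by blast
  have le: "ereal r + ereal ((- F ys - stack_op A xs) \<bullet> (y - ys)) \<le> first_part p y"
    using kkt y(2) unfolding subdiff_on_def r[symmetric] by blast
  show ?thesis
  proof (cases "first_part p y")
    case (real s)
    have "r + (- F ys - stack_op A xs) \<bullet> (y - ys) \<le> s" using le real by simp
    then show ?thesis using sep_sum_grad_le[OF y] unfolding r real
      by (simp add: inner_diff_left stack_op_adj)
  qed (use le in auto)
qed

end

section \<open>KKT points as saddle points\<close>

lemma zero_in_translate:
  fixes a b :: "'v::ab_group_add"
  shows "0 \<in> {v + a + b | v. v \<in> S} \<longleftrightarrow> - a - b \<in> S"
proof
  assume "0 \<in> {v + a + b | v. v \<in> S}"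
  then obtain v where v: "v \<in> S" "v + a + b = 0" by auto
  then have "v = - a - b" by (metis add_diff_cancel_right' diff_0 diff_diff_eq minus_diff_commute uminus_add_conv_diff)
  with v show "- a - b \<in> S" by simp
next
  assume "- a - b \<in> S"
  then show "0 \<in> {v + a + b | v. v \<in> S}" by (intro CollectI exI[of _ "- a - b"]) simp
qed

lemma kkt_points_alt:
  "kkt_points Y f p A Z g q B c = {(y, z, x). y \<in> prod_space Y \<and> z \<in> prod_space Z \<and>
     - grad_on (prod_space Y) (sep_sum f) y - stack_op A x \<in> subdiff_on (prod_space Y) (first_part p) y \<and>
     - grad_on (prod_space Z) (sep_sum g) z - stack_op B x \<in> subdiff_on (prod_space Z) (first_part q) z \<and>
     stack_adj A y + stack_adj B z = c}"
  unfolding kkt_points_def zero_in_translate by (rule refl)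

text \<open>The fact \<open>min\<close> says that \<open>(ys, zs)\<close> minimizes the Lagrangian
  at \<open>xs\<close>. On feasible points this is primal optimality; since the residual at
  \<open>(ys, zs)\<close> vanishes, every dual value is at most the primal value there, and
  \<open>xs\<close> attains it.\<close>

lemma kkt_point_optimal:
  assumes data: "mp_data Y f p A" "mp_data Z g q B" and kkt: "(ys, zs, xs) \<in> kkt_points Y f p A Z g q B c"
  shows "mp_optimal Y f p A Z g q B c ys zs" "dual_optimal Y f p A Z g q B c xs"
proof -
  interpret Y: mp_block Y f p A by unfold_locales (rule data)
  interpret Z: mp_block Z g q B by unfold_locales (rule data)
  have K: "ys \<in> prod_space Y" "zs \<in> prod_space Z" "- Y.F ys - stack_op A xs \<in> Y.P ys"
    "- Z.F zs - stack_op B xs \<in> Z.P zs" "stack_adj A ys + stack_adj B zs = c"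
    using kkt by (auto simp: kkt_points_alt)
  let ?obj = "mp_objective f p g q"
  have min: "?obj ys zs \<le> ?obj y z + ereal (xs \<bullet> residual A B c y z)"
    if "y \<in> prod_space Y" "z \<in> prod_space Z" for y z
  proof -
    have "xs \<bullet> residual A B c y z = xs \<bullet> stack_adj A (y - ys) + xs \<bullet> stack_adj B (z - zs)"
      unfolding residual_def K(5)[symmetric] linear_diff[OF Y.linear_stack_adj] linear_diff[OF Z.linear_stack_adj]
      by (simp add: inner_simps)
    then have "?obj y z + ereal (xs \<bullet> residual A B c y z) =
       (first_part p y + ereal (sep_sum f y) + ereal (xs \<bullet> stack_adj A (y - ys))) +
       (first_part q z + ereal (sep_sum g z) + ereal (xs \<bullet> stack_adj B (z - zs)))"
      by (simp add: mp_objective_def ac_simps flip: plus_ereal.simps(1))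
    moreover have "?obj ys zs = (first_part p ys + ereal (sep_sum f ys)) + (first_part q zs + ereal (sep_sum g zs))"
      by (simp add: mp_objective_def ac_simps)
    ultimately show ?thesis
      using add_mono[OF Y.lagrangian_minimal[OF K(1) that(1) K(3)] Z.lagrangian_minimal[OF K(2) that(2) K(4)]]
      by simp
  qed
  show "mp_optimal Y f p A Z g q B c ys zs"
    unfolding mp_optimal_def is_arg_min_def
  proof (intro conjI notI)
    assume "\<exists>u. (case u of (y, z) \<Rightarrow> y \<in> prod_space Y \<and> z \<in> prod_space Z \<and> stack_adj A y + stack_adj B z = c)
      \<and> (case u of (y, z) \<Rightarrow> ?obj y z) < (case (ys, zs) of (y, z) \<Rightarrow> ?obj y z)"
    then obtain y z where yz: "y \<in> prod_space Y" "z \<in> prod_space Z" "stack_adj A y + stack_adj B z = c"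
      "?obj y z < ?obj ys zs" by auto
    from yz(3) have "residual A B c y z = 0" by (simp add: residual_def)
    with min[OF yz(1,2)] yz(4) show False by (simp flip: zero_ereal_def)
  qed (use K in auto)
  show "dual_optimal Y f p A Z g q B c xs"
    unfolding dual_optimal_def is_arg_max_def
  proof (intro conjI notI)
    let ?D = "dual_objective Y f p A Z g q B c"
    assume "\<exists>x. True \<and> ?D x > ?D xs"
    then obtain x where x: "?D xs < ?D x" by auto
    have "residual A B c ys zs = 0" using K(5) by (simp add: residual_def)
    then have "?D x \<le> ?obj ys zs"
      unfolding dual_objective_def using K
      by (intro INF_lower2[of "(ys, zs)"]) (auto simp flip: zero_ereal_def)
    also have "\<dots> \<le> ?D xs"
      unfolding dual_objective_def using min by (intro INF_greatest) auto
    finally show False using x by simp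
  qed simp
qed

section \<open>The symmetric Gauss-Seidel sweep\<close>

lemma sum_split_at:
  fixes g :: "'s::{finite,linorder} \<Rightarrow> 'b::ab_group_add"
  shows "(\<Sum>l\<in>UNIV. g l) = (\<Sum>l\<in>{..<i}. g l) + g i + (\<Sum>l\<in>{i<..}. g l)"
proof -
  have U: "UNIV = ({..<i} \<union> {i}) \<union> {i<..}" by auto
  show ?thesis unfolding U by (subst sum.union_disjoint; auto)+
qed

text \<open>The constant is the minimum of the form on the compact unit sphere of \<open>V\<close>,
  which is empty when \<open>V\<close> is trivial.\<close>

lemma quadratic_form_coercive:
  fixes V :: "'v::euclidean_space set"
  assumes V: "subspace V" and T: "linear T" and B: "linear (B :: 'v \<Rightarrow> 'w::euclidean_space)"
    and pos: "\<And>v. v \<in> V \<Longrightarrow> v \<noteq> 0 \<Longrightarrow> 0 < v \<bullet> T v + (norm (B v))\<^sup>2"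
  shows "\<exists>\<gamma>>0. \<forall>v\<in>V. \<gamma> * (norm v)\<^sup>2 \<le> v \<bullet> T v + (norm (B v))\<^sup>2"
proof (cases "V \<inter> sphere 0 1 = {}")
  case True
  have "v = 0" if "v \<in> V" for v
  proof (rule ccontr)
    assume "v \<noteq> 0"
    then have "inverse (norm v) *\<^sub>R v \<in> V \<inter> sphere 0 1" using that V by (simp add: subspace_mul)
    with True show False by blast
  qed
  then have "1 * (norm v)\<^sup>2 \<le> v \<bullet> T v + (norm (B v))\<^sup>2" if "v \<in> V" for v
    using that[THEN \<open>\<And>v. v \<in> V \<Longrightarrow> v = 0\<close>] by simp
  then show ?thesis by (intro exI[of _ 1]) auto
next
  case False
  let ?N = "\<lambda>v. v \<bullet> T v + (norm (B v))\<^sup>2"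
  have "compact (V \<inter> sphere 0 1)" by (intro closed_Int_compact closed_subspace V compact_sphere)
  moreover have "continuous_on (V \<inter> sphere 0 1) ?N"
    by (intro continuous_intros linear_continuous_on linear_conv_bounded_linear[THEN iffD1] T B)
  ultimately obtain m where m: "m \<in> V \<inter> sphere 0 1" and min: "\<forall>v\<in>V \<inter> sphere 0 1. ?N m \<le> ?N v"
    using continuous_attains_inf[of "V \<inter> sphere 0 1" ?N] False by blast
  show ?thesis
  proof (intro exI[of _ "?N m"] conjI ballI)
    show "0 < ?N m" using m by (intro pos) auto
    fix v assume v: "v \<in> V"
    show "?N m * (norm v)\<^sup>2 \<le> ?N v"
    proof (cases "v = 0")
      case False
      let ?w = "inverse (norm v) *\<^sub>R v"
      have "?w \<in> V \<inter> sphere 0 1" using False v V by (simp add: subspace_mul)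
      then have "?N m \<le> ?N ?w" using min by blast
      also have "?N ?w = ?N v / (norm v)\<^sup>2"
        by (simp add: linear_cmul[OF T] linear_cmul[OF B] power_mult_distrib power2_eq_square divide_inverse algebra_simps)
      finally show ?thesis using False by (simp add: pos_le_divide_eq)
    qed (simp add: linear_0[OF T] linear_0[OF B])
  qed
qed

lemma pd_on_inverse:
  assumes V: "subspace V" and pd: "pd_on V M"
  shows "\<exists>K. linear K \<and> (\<forall>v\<in>V. K v \<in> V \<and> M (K v) = v)"
proof -
  have lin: "linear M" and maps: "M ` V \<subseteq> V" using pd by (auto simp: pd_on_def self_adjoint_on_def)
  have "inj_on M V"
  proof (rule inj_onI)
    fix a b assume ab: "a \<in> V" "b \<in> V" "M a = M b"
    then have "a - b \<in> V" "(a - b) \<bullet> M (a - b) = 0" using V subspace_diff by (auto simp: linear_diff[OF lin])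
    then show "a = b" using pd unfolding pd_on_def by (metis less_irrefl right_minus_eq)
  qed
  then have "dim (M ` V) = dim V" using lin V by (metis dim_image_eq span_eq_iff)
  then have surj: "M ` V = V"
    using maps V lin by (intro subspace_dim_equal) (auto simp: linear_subspace_image)
  obtain K where K: "range K \<subseteq> V" "linear K" "\<forall>v\<in>M ` V. M (K v) = v"
    using linear_exists_right_inverse_on[OF lin V] by blast
  then show ?thesis using surj by (intro exI[of _ K]) auto
qed

text \<open>Lets the smooth blocks reuse the optimality condition of the nonsmooth one, with the
  zero function; testing at \<open>m + d\<close> forces \<open>d\<close> to vanish.\<close>

lemma subdiff_on_zero:
  assumes "subspace V" "m \<in> V" "d \<in> subdiff_on V (\<lambda>_. 0) m"
  shows "d = 0"
proof -
  have dV: "d \<in> V" using assms by (simp add: subdiff_on_def)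
  then have "0 + ereal (d \<bullet> ((m + d) - m)) \<le> 0"
    using assms(3) subspace_add[OF assms(1,2) dV] unfolding subdiff_on_def by blast
  then have "ereal (d \<bullet> d) \<le> ereal 0" unfolding zero_ereal_def[symmetric] by simp
  then have "d \<bullet> d \<le> 0" by (simp del: zero_ereal_def)
  then show ?thesis by (metis inner_eq_zero_iff inner_ge_zero order_antisym)
qed

section \<open>The metric of a symmetric Gauss-Seidel sweep\<close>

locale sgs_block = mp_block Y f p A
  for Y :: "'s::{finite,linorder} \<Rightarrow> 'a::euclidean_space set" and f p and A :: "'s \<Rightarrow> 'x::euclidean_space \<Rightarrow> 'a" +
  fixes E S :: "'s \<Rightarrow> 'a \<Rightarrow> 'a" and \<sigma> :: real
  assumes maj: "majorizing Y f E" and S_self_adjoint: "self_adjoint_on (Y i) (S i)"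
    and S_ge: "loewner_ge (Y i) (S i) (\<lambda>v. - ((1/2) *\<^sub>R E i v))"
    and pd: "pd_on (Y i) (\<lambda>v. (1/2) *\<^sub>R E i v + S i v + \<sigma> *\<^sub>R A i (adjoint (A i) v))"
    and \<sigma>_pos: "0 < \<sigma>"
begin

text \<open>The Hessian of a block subproblem: majorant, proximal term and penalty.\<close>

definition Md where "Md i v = E i v + S i v + \<sigma> *\<^sub>R A i (adjoint (A i) v)"

text \<open>With \<open>up\<close>, the strict triangular parts of the penalty Hessian; they are
  also those of the full Hessian, since \<open>E\<close> and \<open>S\<close> act blockwise.\<close>

definition low :: "('a, 's) vec \<Rightarrow> ('a, 's) vec" where
  "low v = (\<chi> i. \<Sum>l\<in>{..<i}. \<sigma> *\<^sub>R A i (adjoint (A l) (v $ l)))"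

definition up :: "('a, 's) vec \<Rightarrow> ('a, 's) vec" where
  "up v = (\<chi> i. \<Sum>l\<in>{i<..}. \<sigma> *\<^sub>R A i (adjoint (A l) (v $ l)))"

lemma E_self_adjoint: "self_adjoint_on (Y i) (E i)" and E_psd: "v \<in> Y i \<Longrightarrow> 0 \<le> v \<bullet> E i v"
  using maj by (auto simp: majorizing_def psd_on_def)

lemma linear_E: "linear (E i)" and linear_S: "linear (S i)"
  and E_sym: "v \<in> Y i \<Longrightarrow> w \<in> Y i \<Longrightarrow> E i v \<bullet> w = v \<bullet> E i w"
  and S_sym: "v \<in> Y i \<Longrightarrow> w \<in> Y i \<Longrightarrow> S i v \<bullet> w = v \<bullet> S i w"
  and E_in: "v \<in> Y i \<Longrightarrow> E i v \<in> Y i" and S_in: "v \<in> Y i \<Longrightarrow> S i v \<in> Y i"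
  using E_self_adjoint[of i] S_self_adjoint[of i] by (auto simp: self_adjoint_on_def)

lemma ES_nonneg: "v \<in> Y i \<Longrightarrow> 0 \<le> 1/2 * (v \<bullet> E i v) + v \<bullet> S i v"
  using S_ge[of i] by (auto simp: loewner_ge_def psd_on_def inner_simps)

lemma linear_adj: "linear (adjoint (A i))"
  by (rule adjoint_linear[OF linear_A])

lemma A_inner: "A i u \<bullet> v = u \<bullet> adjoint (A i) v"
  by (simp add: adjoint_works[OF linear_A])

lemma A_inner_right: "v \<bullet> A i u = adjoint (A i) v \<bullet> u"
  by (simp add: A_inner inner_commute[of v] inner_commute[of u])

lemma linear_Md: "linear (Md i)"
  unfolding Md_def
  by (intro linearI) (simp_all add: linear_add[OF linear_E] linear_add[OF linear_S] linear_add[OF linear_adj]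
      linear_add[OF linear_A] linear_cmul[OF linear_E] linear_cmul[OF linear_S] linear_cmul[OF linear_adj]
      linear_cmul[OF linear_A] scaleR_add_right)

lemma Md_sym: "v \<in> Y i \<Longrightarrow> w \<in> Y i \<Longrightarrow> Md i v \<bullet> w = v \<bullet> Md i w"
  by (simp add: Md_def inner_simps E_sym S_sym A_inner) (metis A_inner inner_commute)

lemma Md_in: "v \<in> Y i \<Longrightarrow> Md i v \<in> Y i"
  unfolding Md_def by (intro subspace_add subspace_mul subspace_Y E_in S_in range_A)

lemma half_pos: "v \<in> Y i \<Longrightarrow> v \<noteq> 0 \<Longrightarrow> 0 < 1/2 * (v \<bullet> E i v) + v \<bullet> S i v + \<sigma> * (norm (adjoint (A i) v))\<^sup>2"
  using pd[of i] by (auto simp: pd_on_def inner_simps power2_norm_eq_inner A_inner inner_commute[of v "A i _"])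

lemma Md_pd: "pd_on (Y i) (Md i)"
  unfolding pd_on_def self_adjoint_on_def
proof (intro conjI ballI impI linear_Md)
  show "Md i ` Y i \<subseteq> Y i" using Md_in by blast
  show "Md i v \<bullet> w = v \<bullet> Md i w" if "v \<in> Y i" "w \<in> Y i" for v w by (rule Md_sym[OF that])
  show "0 < v \<bullet> Md i v" if "v \<in> Y i" "v \<noteq> 0" for v
    using half_pos[OF that] E_psd[OF that(1)]
    by (simp add: Md_def inner_simps power2_norm_eq_inner A_inner inner_commute[of v "A i _"])
qed

definition Kd where "Kd i = (SOME K. linear K \<and> (\<forall>v\<in>Y i. K v \<in> Y i \<and> Md i (K v) = v))"

lemma Kd: "linear (Kd i)" "v \<in> Y i \<Longrightarrow> Kd i v \<in> Y i" "v \<in> Y i \<Longrightarrow> Md i (Kd i v) = v"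
  using someI_ex[OF pd_on_inverse[OF subspace_Y Md_pd], of i, folded Kd_def] by auto

lemma Kd_Md:
  assumes "v \<in> Y i"
  shows "Kd i (Md i v) = v"
proof (rule ccontr)
  let ?w = "Kd i (Md i v) - v"
  assume "Kd i (Md i v) \<noteq> v"
  moreover have "?w \<in> Y i" using assms Kd Md_in subspace_Y subspace_diff by blast
  ultimately have "0 < ?w \<bullet> Md i ?w" using Md_pd by (auto simp: pd_on_def)
  then show False using Kd(3)[OF Md_in[OF assms]] by (simp add: linear_diff[OF linear_Md])
qed

text \<open>In the sweep this is the backward displacement minus the forward one.\<close>

definition J where "J v = Diag Kd (low v)"

text \<open>The metric of the actual sweep. Every block subproblem contains the full majorant, so the
  diagonal blocks inverted here are those of \<open>E + S + \<sigma> A A\<^sup>*\<close>, not of \<^const>\<open>tilde_op\<close> with its factor \<open>1/2\<close>.\<close>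

definition G where "G v = Diag (\<lambda>i v. E i v + S i v) v + up (J v)"

lemma linear_low: "linear low" and linear_up: "linear up"
  unfolding low_def up_def
  by (rule linearI; simp add: vec_eq_iff linear_add[OF linear_adj] linear_add[OF linear_A]
      linear_cmul[OF linear_adj] linear_cmul[OF linear_A] scaleR_add_right sum.distrib scaleR_sum_right
      mult.commute[of \<sigma>])+

lemma linear_Diag:
  assumes "\<And>i. linear (D i)"
  shows "linear (Diag D)"
  by (intro linearI) (simp_all add: Diag_def vec_eq_iff linear_add[OF assms] linear_cmul[OF assms])

lemma linear_J: "linear J"
  unfolding J_def using linear_compose[OF linear_low linear_Diag[OF Kd(1)]] by (simp add: o_def)

lemma linear_ES: "linear (\<lambda>v. E i v + S i v)"
  by (intro linear_compose_add linear_E linear_S)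

lemma linear_G: "linear G"
  unfolding G_def using linear_compose[OF linear_J linear_up] linear_Diag[OF linear_ES]
  by (intro linear_compose_add) (simp_all add: o_def)

lemma low_in: "low v \<in> V"
  by (auto simp: low_def prod_space_def intro!: subspace_sum subspace_Y subspace_mul range_A)

lemma J_in: "J v \<in> V"
  using Kd(2) low_in by (simp add: J_def Diag_def prod_space_def)

lemma Md_J: "Diag Md (J v) = low v"
  using Kd(3) V_nth[OF low_in] by (simp add: J_def Diag_def vec_eq_iff)

lemma up_low: "up v \<bullet> w = v \<bullet> low w"
proof -
  have "up v \<bullet> w = (\<Sum>i\<in>UNIV. \<Sum>l | l \<in> UNIV \<and> i < l. \<sigma> * (adjoint (A l) (v $ l) \<bullet> adjoint (A i) (w $ i)))"
    by (simp add: up_def inner_vec_def inner_sum_left A_inner greaterThan_def)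
  also have "\<dots> = (\<Sum>l\<in>UNIV. \<Sum>i | i \<in> UNIV \<and> i < l. \<sigma> * (adjoint (A l) (v $ l) \<bullet> adjoint (A i) (w $ i)))"
    by (rule sum.swap_restrict) auto
  also have "\<dots> = v \<bullet> low w"
    by (simp add: low_def inner_vec_def inner_sum_right A_inner_right lessThan_def)
  finally show ?thesis .
qed

text \<open>Because \<open>up\<close> is adjoint to \<open>low\<close> and \<open>low\<close>
  factors through \<open>Md\<close> and \<open>J\<close>, the correction is the
  \<open>Md\<close>-form evaluated at \<open>J\<close>; symmetry, semidefiniteness and its kernel,
  that of \<open>low\<close>, follow from this.\<close>

lemma up_J_inner: "up (J v) \<bullet> w = (\<Sum>i\<in>UNIV. (J v $ i) \<bullet> Md i (J w $ i))"
  unfolding up_low Md_J[symmetric] by (simp add: inner_vec_def Diag_def)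

lemma up_J_sym: "up (J v) \<bullet> w = v \<bullet> up (J w)"
proof -
  have "(J v $ i) \<bullet> Md i (J w $ i) = (J w $ i) \<bullet> Md i (J v $ i)" for i
    using Md_sym[OF V_nth[OF J_in[of v]] V_nth[OF J_in[of w]], of i] by (simp only: inner_commute)
  then have "up (J v) \<bullet> w = up (J w) \<bullet> v" unfolding up_J_inner by (intro sum.cong) auto
  then show ?thesis by (simp only: inner_commute[of v])
qed

lemma up_J_nonneg: "0 \<le> up (J v) \<bullet> v" "up (J v) \<bullet> v = 0 \<Longrightarrow> low v = 0"
proof -
  have nn: "0 \<le> (J v $ i) \<bullet> Md i (J v $ i)" "(J v $ i) \<bullet> Md i (J v $ i) = 0 \<Longrightarrow> J v $ i = 0" for i
  proof -
    have "0 < (J v $ i) \<bullet> Md i (J v $ i)" if "J v $ i \<noteq> 0"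
      using Md_pd[of i] V_nth[OF J_in, of v i] that unfolding pd_on_def by blast
    then show "0 \<le> (J v $ i) \<bullet> Md i (J v $ i)" "(J v $ i) \<bullet> Md i (J v $ i) = 0 \<Longrightarrow> J v $ i = 0"
      by (cases "J v $ i = 0"; simp)+
  qed
  show "0 \<le> up (J v) \<bullet> v" unfolding up_J_inner by (intro sum_nonneg nn)
  assume "up (J v) \<bullet> v = 0"
  then have "\<forall>i\<in>UNIV. (J v $ i) \<bullet> Md i (J v $ i) = 0"
    unfolding up_J_inner by (subst (asm) sum_nonneg_eq_0_iff) (simp_all add: nn(1))
  then have "J v = 0" unfolding vec_eq_iff zero_index using nn(2) by blast
  then show "low v = 0" using Md_J[of v] linear_0[OF linear_Diag[of Md, OF linear_Md]] by simp
qed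

lemma G_sym:
  assumes "v \<in> V" "w \<in> V"
  shows "G v \<bullet> w = v \<bullet> G w"
  by (simp add: G_def inner_add_left inner_add_right up_J_sym)
    (simp add: inner_vec_def Diag_def inner_add_left inner_add_right E_sym S_sym V_nth assms)

lemma sqnorm_G: "sqnorm G v = (\<Sum>i\<in>UNIV. v $ i \<bullet> E i (v $ i) + v $ i \<bullet> S i (v $ i)) + up (J v) \<bullet> v"
  by (simp add: sqnorm_def G_def inner_add_right inner_vec_def Diag_def inner_commute sum.distrib)

lemma half_form:
  "sqnorm G v - 1/2 * sqnorm (Diag E) v = (\<Sum>i\<in>UNIV. 1/2 * (v $ i \<bullet> E i (v $ i)) + v $ i \<bullet> S i (v $ i)) + up (J v) \<bullet> v"
  unfolding sqnorm_G sqnorm_Diag by (simp add: sum.distrib sqnorm_def sum_divide_distrib[symmetric])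

lemma E_nonneg: "v \<in> V \<Longrightarrow> 0 \<le> sqnorm (Diag E) v"
  unfolding sqnorm_Diag by (simp add: sqnorm_def sum_nonneg E_psd V_nth)

lemma G_ge:
  assumes "v \<in> V"
  shows "1/2 * sqnorm (Diag E) v \<le> sqnorm G v"
proof -
  have "0 \<le> (\<Sum>i\<in>UNIV. 1/2 * (v $ i \<bullet> E i (v $ i)) + v $ i \<bullet> S i (v $ i))"
    using V_nth[OF assms] by (intro sum_nonneg ES_nonneg)
  then show ?thesis using half_form[of v] up_J_nonneg(1)[of v] by linarith
qed

lemma stack_op_adj_split:
  "\<sigma> *\<^sub>R A i (stack_adj A v) = low v $ i + \<sigma> *\<^sub>R A i (adjoint (A i) (v $ i)) + up v $ i"
  unfolding stack_adj_def sum_split_at[of _ i]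
  by (simp add: low_def up_def linear_add[OF linear_A] linear_sum[OF linear_A] scaleR_add_right scaleR_sum_right)

text \<open>If the form vanishes, so does each of its nonnegative parts. Then
  \<open>low v = 0\<close> removes the off-diagonal products from the squared norm of
  \<open>stack_adj A v\<close>, leaving the blockwise norms, which contradict the definiteness of
  each block.\<close>

lemma form_pos:
  assumes v: "v \<in> V" "v \<noteq> 0"
  shows "0 < sqnorm G v - 1/2 * sqnorm (Diag E) v + (norm (stack_adj A v))\<^sup>2"
proof (rule ccontr)
  assume neg: "\<not> ?thesis"
  let ?d = "\<lambda>i. 1/2 * (v $ i \<bullet> E i (v $ i)) + v $ i \<bullet> S i (v $ i)"
  have nn: "0 \<le> ?d i" for i using V_nth[OF v(1)] by (intro ES_nonneg)
  then have "0 \<le> (\<Sum>i\<in>UNIV. ?d i)" by (intro sum_nonneg)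
  with neg up_J_nonneg(1)[of v] zero_le_power2[of "norm (stack_adj A v)"]
  have 0: "(\<Sum>i\<in>UNIV. ?d i) = 0" "up (J v) \<bullet> v = 0" "(norm (stack_adj A v))\<^sup>2 = 0"
    unfolding half_form by linarith+
  have d0: "?d i = 0" for i using 0(1) nn by (subst (asm) sum_nonneg_eq_0_iff) auto
  have low: "low v = 0" using up_J_nonneg(2)[OF 0(2)] .
  then have "up v \<bullet> v = 0" using up_low[of v v] by simp
  moreover have "(\<Sum>i\<in>UNIV. (\<sigma> *\<^sub>R A i (stack_adj A v)) \<bullet> v $ i) = 0"
    using 0(3) by (simp add: linear_0[OF linear_A])
  ultimately have "(\<Sum>i\<in>UNIV. \<sigma> * (norm (adjoint (A i) (v $ i)))\<^sup>2) = 0"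
    unfolding stack_op_adj_split using low
    by (simp add: inner_add_left sum.distrib inner_vec_def A_inner power2_norm_eq_inner)
  then have "\<sigma> * (norm (adjoint (A i) (v $ i)))\<^sup>2 = 0" for i
    using \<sigma>_pos by (subst (asm) sum_nonneg_eq_0_iff) auto
  with d0 have "v $ i = 0" for i using half_pos[OF V_nth[OF v(1)], of i] by (metis add.right_neutral less_irrefl)
  then show False using v(2) by (simp add: vec_eq_iff)
qed

lemma coercive: "\<exists>\<gamma>>0. \<forall>v\<in>V. \<gamma> * (norm v)\<^sup>2 \<le> sqnorm G v - 1/2 * sqnorm (Diag E) v + (norm (stack_adj A v))\<^sup>2"
proof -
  have eq: "v \<bullet> (G v - (1/2) *\<^sub>R Diag E v) = sqnorm G v - 1/2 * sqnorm (Diag E) v" for v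
    by (simp add: sqnorm_def inner_simps)
  have "linear (\<lambda>v. G v - (1/2) *\<^sub>R Diag E v)"
    by (intro linear_compose_sub linear_G linear_compose_scale_right linear_Diag linear_E)
  from quadratic_form_coercive[OF subspace_V this linear_stack_adj] form_pos show ?thesis
    unfolding eq by blast
qed

end

section \<open>Optimality conditions of the block subproblems\<close>

context sgs_block begin

text \<open>The other group of variables is frozen in \<open>b\<close>, which holds its constraint
  image minus \<open>c\<close>; thus one definition serves the \<open>y\<close>- and the
  \<open>z\<close>-sweep.\<close>

definition smooth_part where
  "smooth_part x b y' \<eta> = majorized_fun Y f E \<eta> y' + x \<bullet> (stack_adj A \<eta> + b) + \<sigma>/2 * (norm (stack_adj A \<eta> + b))\<^sup>2"

lemma put_block_line: "put_block i a (m + t *\<^sub>R h) b = put_block i a m b + t *\<^sub>R axis i h"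
  by (simp add: put_block_def vec_eq_iff axis_def)

lemma put_block_nth: "put_block i a m b $ i = m"
  by (simp add: put_block_def)

lemma sqnorm_line:
  assumes "linear T"
  shows "sqnorm T (w + t *\<^sub>R h) = sqnorm T w + t * (w \<bullet> T h + h \<bullet> T w) + t\<^sup>2 * (h \<bullet> T h)"
  by (simp add: sqnorm_def linear_add[OF assms] linear_cmul[OF assms] inner_add_left inner_add_right
      power2_eq_square algebra_simps)

text \<open>Along a block direction the objective is a quadratic polynomial in \<open>t\<close>, and
  the derivative is its linear coefficient.\<close>

lemma block_derivative:
  fixes a d :: "('a, 's) vec"
  assumes y': "y' \<in> V" and m: "m \<in> Y i" and h: "h \<in> Y i"
  defines "\<eta> \<equiv> put_block i a m d"
  shows "((\<lambda>t. smooth_part x b y' (put_block i a (m + t *\<^sub>R h) d) + 1/2 * sqnorm (S i) (m + t *\<^sub>R h - y' $ i) + \<kappa>)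
     has_real_derivative
     (F y' $ i + E i (m - y' $ i) + S i (m - y' $ i) + A i (x + \<sigma> *\<^sub>R (stack_adj A \<eta> + b))) \<bullet> h) (at 0)"
proof (rule quadratic_has_real_derivative)
  fix t :: real
  let ?w = "\<eta> - y'" and ?n = "m - y' $ i" and ?r = "stack_adj A \<eta> + b" and ?k = "adjoint (A i) h"
  have nV: "?n \<in> Y i" using m V_nth[OF y'] subspace_Y subspace_diff by blast
  have wi: "?w $ i = ?n" by (simp add: \<eta>_def put_block_nth)
  have DE: "linear (Diag E)" by (intro linear_Diag linear_E)
  have DE_axis: "Diag E (axis i h) = axis i (E i h)"
    by (simp add: Diag_def axis_def vec_eq_iff linear_0[OF linear_E])
  have e: "sqnorm (Diag E) (?w + t *\<^sub>R axis i h) = sqnorm (Diag E) ?w + t * (2 * (E i ?n \<bullet> h)) + t\<^sup>2 * (h \<bullet> E i h)"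
  proof -
    have "?w \<bullet> axis i (E i h) = ?n \<bullet> E i h" "axis i h \<bullet> Diag E ?w = h \<bullet> E i ?n"
      "axis i h \<bullet> axis i (E i h) = h \<bullet> E i h"
      by (simp_all only: inner_axis inner_axis' wi Diag_def vec_lambda_beta axis_nth)
    moreover have "?n \<bullet> E i h = E i ?n \<bullet> h" "h \<bullet> E i ?n = E i ?n \<bullet> h"
      using E_sym[OF nV h] by (simp_all only: inner_commute)
    ultimately show ?thesis unfolding sqnorm_line[OF DE] DE_axis by simp
  qed
  have s: "sqnorm (S i) (?n + t *\<^sub>R h) = sqnorm (S i) ?n + t * (2 * (S i ?n \<bullet> h)) + t\<^sup>2 * (h \<bullet> S i h)"
  proof -
    have "?n \<bullet> S i h = S i ?n \<bullet> h" "h \<bullet> S i ?n = S i ?n \<bullet> h"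
      using S_sym[OF nV h] by (simp_all only: inner_commute)
    then show ?thesis unfolding sqnorm_line[OF linear_S] by simp
  qed
  have g: "F y' \<bullet> (?w + t *\<^sub>R axis i h) = F y' \<bullet> ?w + t * (F y' $ i \<bullet> h)"
    by (simp only: inner_add_right inner_scaleR_right inner_axis)
  have adj: "stack_adj A (\<eta> + t *\<^sub>R axis i h) + b = ?r + t *\<^sub>R ?k"
    by (simp add: linear_add[OF linear_stack_adj] linear_cmul[OF linear_stack_adj] stack_adj_axis)
  have n: "(norm (?r + t *\<^sub>R ?k))\<^sup>2 = (norm ?r)\<^sup>2 + t * (2 * (A i ?r \<bullet> h)) + t\<^sup>2 * (norm ?k)\<^sup>2"
    unfolding power2_norm_eq_inner A_inner dot_square_norm[symmetric]
    by (simp only: inner_add_left inner_add_right inner_scaleR_left inner_scaleR_right inner_commute[of ?k "stack_adj A \<eta>"]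
      inner_commute[of ?k b] power2_eq_square distrib_left)
  have ux: "x \<bullet> (?r + t *\<^sub>R ?k) = x \<bullet> ?r + t * (A i x \<bullet> h)"
    by (simp only: inner_add_right inner_scaleR_right A_inner)
  have put: "\<eta> + t *\<^sub>R axis i h - y' = ?w + t *\<^sub>R axis i h" "m + t *\<^sub>R h - y' $ i = ?n + t *\<^sub>R h"
    by simp_all
  have lin: "(F y' $ i + E i ?n + S i ?n + A i (x + \<sigma> *\<^sub>R ?r)) \<bullet> h
      = F y' $ i \<bullet> h + E i ?n \<bullet> h + S i ?n \<bullet> h + A i x \<bullet> h + \<sigma> * (A i ?r \<bullet> h)"
    by (simp only: linear_add[OF linear_A, of _ x] linear_cmul[OF linear_A] inner_add_left inner_scaleR_left add.assoc)
  \<comment> \<open>Stated for plain reals so that the final rearrangement never opens the vector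
    terms.\<close>
  have ring: "(a0 + (f0 + t * f1) + 1/2 * (e0 + t * (2 * e1) + t\<^sup>2 * e2)) + (x0 + t * x1)
        + \<sigma>/2 * (n0 + t * (2 * n1) + t\<^sup>2 * n2) + 1/2 * (s0 + t * (2 * s1) + t\<^sup>2 * s2) + \<kappa>
      = ((a0 + f0 + 1/2 * e0) + x0 + \<sigma>/2 * n0 + 1/2 * s0 + \<kappa>) + t * (f1 + e1 + s1 + x1 + \<sigma> * n1)
        + t\<^sup>2 * (1/2 * e2 + \<sigma>/2 * n2 + 1/2 * s2)"
    for a0 f0 f1 e0 e1 e2 x0 x1 n0 n1 n2 s0 s1 s2 :: real
    by (simp add: algebra_simps)
  show "smooth_part x b y' (put_block i a (m + t *\<^sub>R h) d) + 1/2 * sqnorm (S i) (m + t *\<^sub>R h - y' $ i) + \<kappa>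
     = (smooth_part x b y' \<eta> + 1/2 * sqnorm (S i) ?n + \<kappa>)
       + t * ((F y' $ i + E i ?n + S i ?n + A i (x + \<sigma> *\<^sub>R ?r)) \<bullet> h)
       + t\<^sup>2 * (1/2 * (h \<bullet> E i h) + \<sigma>/2 * (norm ?k)\<^sup>2 + 1/2 * (h \<bullet> S i h))"
    unfolding put_block_line \<eta>_def[symmetric] smooth_part_def majorized_fun_def put adj e s g n ux lin
    by (rule ring)
qed

lemma block_stationary:
  assumes conv: "convex (epi_on (Y i) \<theta>)" and proper: "\<And>v. v \<in> Y i \<Longrightarrow> \<theta> v \<noteq> - \<infinity>" and r: "\<theta> m = ereal r"
    and y': "y' \<in> V"
    and am: "is_arg_min (\<lambda>v. \<theta> v + ereal (smooth_part x b y' (put_block i a v d) + 1/2 * sqnorm (S i) (v - y' $ i) + \<kappa>))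
      (\<lambda>v. v \<in> Y i) m"
  shows "- (F y' $ i + E i (m - y' $ i) + S i (m - y' $ i)
      + A i (x + \<sigma> *\<^sub>R (stack_adj A (put_block i a m d) + b))) \<in> subdiff_on (Y i) \<theta> m"
proof (rule is_arg_min_subdiff[OF subspace_Y conv proper am r])
  have m: "m \<in> Y i" using am by (simp add: is_arg_min_def)
  have nV: "m - y' $ i \<in> Y i" using m V_nth[OF y'] subspace_Y subspace_diff by blast
  show "- (F y' $ i + E i (m - y' $ i) + S i (m - y' $ i)
      + A i (x + \<sigma> *\<^sub>R (stack_adj A (put_block i a m d) + b))) \<in> Y i"
    by (intro subspace_neg subspace_add subspace_Y E_in S_in nV range_A V_nth[OF F_in[OF y']])
  show "((\<lambda>t. smooth_part x b y' (put_block i a (m + t *\<^sub>R h) d) + 1/2 * sqnorm (S i) (m + t *\<^sub>R h - y' $ i) + \<kappa>)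
     has_real_derivative - (- (F y' $ i + E i (m - y' $ i) + S i (m - y' $ i)
      + A i (x + \<sigma> *\<^sub>R (stack_adj A (put_block i a m d) + b))) \<bullet> h)) (at 0)" if "h \<in> Y i" for h
    unfolding inner_minus_left minus_minus by (rule block_derivative[OF y' m that])
qed

lemma stack_adj_put_block:
  "stack_adj A (put_block i a v d) = (\<Sum>l\<in>{..<i}. adjoint (A l) (a $ l)) + adjoint (A i) v + (\<Sum>l\<in>{i<..}. adjoint (A l) (d $ l))"
  unfolding stack_adj_def sum_split_at[of _ i]
  by (intro arg_cong2[of _ _ _ _ "(+)"] sum.cong) (auto simp: put_block_def)

lemma first_block_le: "(first_block :: 's) \<le> i"
  by (simp add: first_block_def)

text \<open>One symmetric Gauss-Seidel sweep is a single proximal step with the metric \<open>G\<close>: with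
  \<open>\<delta>\<close> and \<open>\<delta>b\<close> the displacements after the forward and the backward sweep, subtracting the two
  optimality conditions of a block gives \<open>Diag Md (\<delta>b - \<delta>) = low \<delta>\<close>.\<close>

lemma sweep:
  assumes y': "y' \<in> V" "first_part p y' < \<infinity>"
    and L: "\<And>\<eta>. L \<eta> = first_part p \<eta> + ereal (smooth_part x b y' \<eta> + \<kappa>)"
    and bwd: "\<And>i. i \<noteq> first_block \<Longrightarrow>
      is_arg_min (\<lambda>v. L (put_block i y' v yb) + ereal (1/2 * sqnorm (S i) (v - y' $ i))) (\<lambda>v. v \<in> Y i) (yb $ i)"
    and first: "is_arg_min (\<lambda>v. L (put_block first_block y' v yb) + ereal (1/2 * sqnorm (S first_block) (v - y' $ first_block)))
      (\<lambda>v. v \<in> Y first_block) (yn $ first_block)"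
    and fwd: "\<And>i. i \<noteq> first_block \<Longrightarrow>
      is_arg_min (\<lambda>v. L (put_block i yn v yb) + ereal (1/2 * sqnorm (S i) (v - y' $ i))) (\<lambda>v. v \<in> Y i) (yn $ i)"
  shows "yn \<in> V" "first_part p yn < \<infinity>" "- F y' - G (yn - y') - stack_op A (x + \<sigma> *\<^sub>R (stack_adj A yn + b)) \<in> P yn"
proof -
  let ?o = "first_block :: 's"
  have "yn $ i \<in> Y i" for i
    using first fwd[of i] by (cases "i = ?o") (auto simp: is_arg_min_def)
  then show ynV: "yn \<in> V" by (simp add: prod_space_def)
  have conv: "convex (epi_on (Y ?o) p)" and proper: "\<And>v. v \<in> Y ?o \<Longrightarrow> p v \<noteq> - \<infinity>"
    using cpc_p by (auto simp: closed_proper_convex_on_def)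
  have first': "is_arg_min (\<lambda>v. p v + ereal (smooth_part x b y' (put_block ?o y' v yb) + 1/2 * sqnorm (S ?o) (v - y' $ ?o) + \<kappa>))
      (\<lambda>v. v \<in> Y ?o) (yn $ ?o)"
  proof -
    have "L (put_block ?o y' v yb) + ereal (1/2 * sqnorm (S ?o) (v - y' $ ?o))
       = p v + ereal (smooth_part x b y' (put_block ?o y' v yb) + 1/2 * sqnorm (S ?o) (v - y' $ ?o) + \<kappa>)" for v
      by (cases "p v") (simp_all add: L first_part_def put_block_nth)
    with first show ?thesis by simp
  qed
  obtain r where r: "p (yn $ ?o) = ereal r"
    using is_arg_min_finite[OF first' V_nth[OF y'(1)]] y'(2) proper[OF V_nth[OF ynV]] by (auto simp: first_part_def)
  then show "first_part p yn < \<infinity>" by (simp add: first_part_def)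
  obtain r' where r': "p (y' $ ?o) = ereal r'"
    using y' proper[OF V_nth[OF y'(1)]] by (cases "p (y' $ ?o)") (auto simp: first_part_def)
  have conv0: "convex (epi_on (Y i) (\<lambda>_. 0))" for i
  proof -
    have "epi_on (Y i) (\<lambda>_. 0) = Y i \<times> {0..}" by (auto simp: epi_on_def)
    then show ?thesis using subspace_imp_convex[OF subspace_Y] by (simp add: convex_Times)
  qed
  \<comment> \<open>Beyond the first block, the nonsmooth term is the constant \<open>s\<close>,
    finite because the first component comes from \<open>y'\<close> in the backward sweep and from
    \<open>yn\<close> in the forward one.\<close>
  have other: "F y' $ i + E i (m - y' $ i) + S i (m - y' $ i) + A i (x + \<sigma> *\<^sub>R (stack_adj A (put_block i a m yb) + b)) = 0"
    if i: "i \<noteq> ?o" and am: "is_arg_min (\<lambda>v. L (put_block i a v yb) + ereal (1/2 * sqnorm (S i) (v - y' $ i))) (\<lambda>v. v \<in> Y i) m"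
      and a: "p (a $ ?o) = ereal s" for i m a s
  proof -
    have "?o < i" using first_block_le[of i] i by simp
    then have "L (put_block i a v yb) + ereal (1/2 * sqnorm (S i) (v - y' $ i))
       = 0 + ereal (smooth_part x b y' (put_block i a v yb) + 1/2 * sqnorm (S i) (v - y' $ i) + (\<kappa> + s))" for v
      by (simp add: L first_part_def put_block_def a)
    then have am': "is_arg_min (\<lambda>v. 0 + ereal (smooth_part x b y' (put_block i a v yb) + 1/2 * sqnorm (S i) (v - y' $ i) + (\<kappa> + s)))
      (\<lambda>v. v \<in> Y i) m" using am by simp
    have "m \<in> Y i" using am by (simp add: is_arg_min_def)
    moreover have "- (F y' $ i + E i (m - y' $ i) + S i (m - y' $ i)
        + A i (x + \<sigma> *\<^sub>R (stack_adj A (put_block i a m yb) + b))) \<in> subdiff_on (Y i) (\<lambda>_. 0) m"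
      by (rule block_stationary[OF conv0 _ _ y'(1) am']) (simp_all add: zero_ereal_def)
    ultimately show ?thesis using subdiff_on_zero[OF subspace_Y] neg_equal_0_iff_equal by blast
  qed
  define \<delta> where "\<delta> = yn - y'"
  \<comment> \<open>The first block is updated only once, so both displacements are set equal there;
    this matches \<open>low\<close>, which vanishes at the first block.\<close>
  define \<delta>b where "\<delta>b = (\<chi> i. if i = ?o then \<delta> $ i else yb $ i - y' $ i)"
  have \<delta>V: "\<delta> \<in> V" unfolding \<delta>_def by (rule subspace_diff[OF subspace_V ynV y'(1)])
  have ybV: "yb $ i \<in> Y i" if "i \<noteq> ?o" for i using bwd[OF that] by (simp add: is_arg_min_def)
  have \<delta>bY: "\<delta>b $ i \<in> Y i" for i
    using V_nth[OF \<delta>V] ybV V_nth[OF y'(1)] subspace_diff[OF subspace_Y] by (simp add: \<delta>b_def)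
  define tail where "tail i = (\<Sum>l\<in>{i<..}. adjoint (A l) (\<delta>b $ l))" for i
  have tail: "(\<Sum>l\<in>{i<..}. adjoint (A l) (yb $ l)) = (\<Sum>l\<in>{i<..}. adjoint (A l) (y' $ l)) + tail i" for i
  proof -
    have "adjoint (A l) (yb $ l) = adjoint (A l) (y' $ l) + adjoint (A l) (\<delta>b $ l)" if "l \<in> {i<..}" for l
    proof -
      have "l \<noteq> ?o" using first_block_le[of i] that by auto
      then show ?thesis by (simp add: \<delta>b_def linear_diff[OF linear_adj])
    qed
    then show ?thesis by (simp add: tail_def sum.distrib[symmetric])
  qed
  have yn_eq: "yn $ l = y' $ l + \<delta> $ l" for l by (simp add: \<delta>_def)
  have At_fwd: "stack_adj A (put_block i yn (yn $ i) yb)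
      = stack_adj A y' + (\<Sum>l\<in>{..<i}. adjoint (A l) (\<delta> $ l)) + adjoint (A i) (\<delta> $ i) + tail i" for i
    unfolding stack_adj_put_block tail yn_eq linear_add[OF linear_adj] sum.distrib
    unfolding stack_adj_def sum_split_at[of _ i] by simp
  have At_back: "stack_adj A (put_block i y' (yb $ i) yb) = stack_adj A y' + adjoint (A i) (\<delta>b $ i) + tail i"
    if "i \<noteq> ?o" for i
  proof -
    have yb_eq: "yb $ i = y' $ i + \<delta>b $ i" using that by (simp add: \<delta>b_def)
    show ?thesis
      unfolding stack_adj_put_block tail unfolding yb_eq linear_add[OF linear_adj]
      unfolding stack_adj_def sum_split_at[of _ i] by simp
  qed
  \<comment> \<open>The block gradient at the forward update: new displacements up to
    \<open>i\<close>, backward ones in \<open>tail i\<close>.\<close>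
  define g where "g i = F y' $ i + E i (\<delta> $ i) + S i (\<delta> $ i) + A i (x + \<sigma> *\<^sub>R
      (stack_adj A y' + (\<Sum>l\<in>{..<i}. adjoint (A l) (\<delta> $ l)) + adjoint (A i) (\<delta> $ i) + tail i + b))" for i
  have g_fwd: "g i = 0" if "i \<noteq> ?o" for i
  proof -
    have "F y' $ i + E i (yn $ i - y' $ i) + S i (yn $ i - y' $ i)
      + A i (x + \<sigma> *\<^sub>R (stack_adj A (put_block i yn (yn $ i) yb) + b)) = 0"
      by (rule other[OF that fwd[OF that] r])
    then show ?thesis unfolding At_fwd g_def by (simp add: \<delta>_def)
  qed
  have g_first: "- g ?o \<in> subdiff_on (Y ?o) p (yn $ ?o)"
  proof -
    have "put_block ?o y' (yn $ ?o) yb = put_block ?o yn (yn $ ?o) yb"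
      using first_block_le by (auto simp: put_block_def vec_eq_iff not_less[symmetric])
    with block_stationary[OF conv proper r y'(1) first']
    show ?thesis unfolding g_def At_fwd[symmetric] by (simp add: \<delta>_def)
  qed
  have Md_diff: "Md i (\<delta>b $ i - \<delta> $ i) = low \<delta> $ i" for i
  proof (cases "i = ?o")
    case True
    have "{..<?o} = {}" using first_block_le by (auto simp: not_less[symmetric])
    then show ?thesis using True by (simp add: \<delta>b_def low_def linear_0[OF linear_Md])
  next
    case False
    have "F y' $ i + E i (yb $ i - y' $ i) + S i (yb $ i - y' $ i)
      + A i (x + \<sigma> *\<^sub>R (stack_adj A (put_block i y' (yb $ i) yb) + b)) = 0"
      by (rule other[OF False bwd[OF False] r'])
    then have bwd_0: "F y' $ i + E i (\<delta>b $ i) + S i (\<delta>b $ i)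
      + A i (x + \<sigma> *\<^sub>R (stack_adj A y' + adjoint (A i) (\<delta>b $ i) + tail i + b)) = 0" (is "?B = 0")
      unfolding At_back[OF False] using False by (simp add: \<delta>b_def)
    have low: "low \<delta> $ i = \<sigma> *\<^sub>R A i (\<Sum>l\<in>{..<i}. adjoint (A l) (\<delta> $ l))"
      by (simp add: low_def linear_sum[OF linear_A] scaleR_sum_right)
    \<comment> \<open>Both conditions of the block share \<open>F y'\<close>, the multiplier and
      \<open>tail i\<close>; their difference keeps only the diagonal block and the
      predecessors.\<close>
    have "Md i (\<delta>b $ i - \<delta> $ i) - low \<delta> $ i = ?B - g i"
      unfolding low g_def
      by (simp add: Md_def linear_diff[OF linear_E] linear_diff[OF linear_S] linear_diff[OF linear_adj]
          linear_add[OF linear_A] linear_diff[OF linear_A] linear_cmul[OF linear_A] algebra_simps)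
    then show ?thesis unfolding bwd_0 g_fwd[OF False] by simp
  qed
  have J_eq: "J \<delta> = \<delta>b - \<delta>"
  proof -
    have "\<delta>b $ i - \<delta> $ i \<in> Y i" for i using \<delta>bY V_nth[OF \<delta>V] subspace_diff[OF subspace_Y] by blast
    then show ?thesis using Kd_Md by (simp add: J_def Diag_def vec_eq_iff Md_diff[symmetric])
  qed
  \<comment> \<open>The block gradients use backward displacements above the diagonal, the
    simultaneous step uses \<open>\<delta>\<close>; the correction
    \<open>up (J \<delta>) = up \<delta>b - up \<delta>\<close> in \<open>G\<close> exchanges
    them.\<close>
  have "- F y' - G \<delta> - stack_op A (x + \<sigma> *\<^sub>R (stack_adj A yn + b)) = (\<chi> i. - g i)"
  proof -
    have "stack_adj A yn = stack_adj A y' + stack_adj A \<delta>" by (simp add: \<delta>_def linear_diff[OF linear_stack_adj])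
    moreover have "up \<delta>b $ i = \<sigma> *\<^sub>R A i (tail i)" for i
      by (simp add: up_def tail_def linear_sum[OF linear_A] scaleR_sum_right)
    moreover have "up (J \<delta>) = up \<delta>b - up \<delta>" by (simp add: J_eq linear_diff[OF linear_up])
    moreover have "low \<delta> $ i = \<sigma> *\<^sub>R A i (\<Sum>l\<in>{..<i}. adjoint (A l) (\<delta> $ l))" for i
      by (simp add: low_def linear_sum[OF linear_A] scaleR_sum_right)
    ultimately show ?thesis
      using stack_op_adj_split[of _ \<delta>]
      by (simp add: vec_eq_iff G_def Diag_def stack_op_def g_def linear_add[OF linear_A] linear_cmul[OF linear_A] algebra_simps)
  qed
  moreover have "(\<chi> i. - g i) \<in> P yn"
    using g_first g_fwd by (intro subdiff_first_partI) auto
  ultimately show "- F y' - G (yn - y') - stack_op A (x + \<sigma> *\<^sub>R (stack_adj A yn + b)) \<in> P yn"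
    unfolding \<delta>_def by simp
qed

end

section \<open>Convergence\<close>

lemma (in sgs_block) prox_block_exists:
  "\<exists>L \<gamma>. prox_block V F (Diag E) G P (stack_op A) (stack_adj A) L \<gamma>"
proof -
  obtain L where L: "\<forall>a\<in>V. \<forall>b\<in>V. norm (F a - F b) \<le> L * norm (a - b)" using F_lipschitz by blast
  obtain \<gamma> where \<gamma>: "0 < \<gamma>"
    "\<forall>v\<in>V. \<gamma> * (norm v)\<^sup>2 \<le> sqnorm G v - 1/2 * sqnorm (Diag E) v + (norm (stack_adj A v))\<^sup>2"
    using coercive by blast
  have "prox_block V F (Diag E) G P (stack_op A) (stack_adj A) L \<gamma>"
  proof (rule prox_block.intro)
    show "\<And>a b. a \<in> V \<Longrightarrow> b \<in> V \<Longrightarrow> norm (F a - F b) \<le> L * norm (a - b)" using L by blast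
    show "\<And>v. v \<in> V \<Longrightarrow> \<gamma> * (norm v)\<^sup>2 \<le> sqnorm G v - 1/2 * sqnorm (Diag E) v + (norm (stack_adj A v))\<^sup>2"
      using \<gamma>(2) by blast
    show "\<And>a b d e. a \<in> V \<Longrightarrow> b \<in> V \<Longrightarrow> d \<in> P a \<Longrightarrow> e \<in> P b \<Longrightarrow> 0 \<le> (d - e) \<bullet> (a - b)"
      by (rule subdiff_on_monotone[OF cpc_first_part])
    show "\<And>vs ds a b. (\<And>n::nat. vs n \<in> V) \<Longrightarrow> (\<And>n. ds n \<in> P (vs n)) \<Longrightarrow> vs \<longlonglongrightarrow> a \<Longrightarrow> ds \<longlonglongrightarrow> b \<Longrightarrow> b \<in> P a"
      by (rule subdiff_on_closed[OF subspace_V cpc_first_part])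
    show "\<And>u v. stack_op A u \<bullet> v = u \<bullet> stack_adj A v" by (rule stack_op_adj)
    show "\<And>a b h. a \<in> V \<Longrightarrow> b \<in> V \<Longrightarrow> h \<in> V \<Longrightarrow> - (1/4) * sqnorm (Diag E) (h - (a - b)) \<le> (F a - F b) \<bullet> h"
      by (rule F_cocoercive[OF maj])
    show "\<And>a b. a \<in> V \<Longrightarrow> b \<in> V \<Longrightarrow> G a \<bullet> b = a \<bullet> G b" by (rule G_sym)
    show "\<And>v. v \<in> V \<Longrightarrow> 0 \<le> sqnorm (Diag E) v" by (rule E_nonneg)
    show "\<And>v. v \<in> V \<Longrightarrow> 1/2 * sqnorm (Diag E) v \<le> sqnorm G v" by (rule G_ge)
  qed (fact subspace_V linear_stack_op linear_stack_adj linear_G \<gamma>(1))+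
  then show ?thesis by blast
qed

theorem proposition4p1:
  fixes Y :: "'s::{finite,linorder} \<Rightarrow> 'a::euclidean_space set"
    and Z :: "'t::{finite,linorder} \<Rightarrow> 'b::euclidean_space set"
    and A :: "'s \<Rightarrow> 'x::euclidean_space \<Rightarrow> 'a"
    and B :: "'t \<Rightarrow> 'x \<Rightarrow> 'b"
    and c :: 'x
    and f :: "'s \<Rightarrow> 'a \<Rightarrow> real" and g :: "'t \<Rightarrow> 'b \<Rightarrow> real"
    and p :: "'a \<Rightarrow> ereal" and q :: "'b \<Rightarrow> ereal"
    and \<Sigma>f Sb :: "'s \<Rightarrow> 'a \<Rightarrow> 'a"
    and \<Sigma>g Tb :: "'t \<Rightarrow> 'b \<Rightarrow> 'b"
    and S :: "('a, 's) vec \<Rightarrow> ('a, 's) vec" and T :: "('b, 't) vec \<Rightarrow> ('b, 't) vec"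
    and \<sigma> \<tau> :: real
    and y :: "nat \<Rightarrow> ('a, 's) vec" and z :: "nat \<Rightarrow> ('b, 't) vec" and x :: "nat \<Rightarrow> 'x"
  assumes y_data: "mp_data Y f p A" and z_data: "mp_data Z g q B"
    and maj_f: "majorizing Y f \<Sigma>f" and maj_g: "majorizing Z g \<Sigma>g"
    and kkt_nonempty: "kkt_points Y f p A Z g q B c \<noteq> {}"
    and sigma: "\<sigma> > 0"
    and tau: "0 < \<tau>" "\<tau> < (1 + sqrt 5) / 2"
    and Sb_self_adjoint: "\<And>i. self_adjoint_on (Y i) (Sb i)"
    and Tb_self_adjoint: "\<And>j. self_adjoint_on (Z j) (Tb j)"
    and Sb_ge: "\<And>i. loewner_ge (Y i) (Sb i) (\<lambda>v. - ((1/2) *\<^sub>R \<Sigma>f i v))"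
    and Tb_ge: "\<And>j. loewner_ge (Z j) (Tb j) (\<lambda>w. - ((1/2) *\<^sub>R \<Sigma>g j w))"
    and y_pd: "\<And>i. pd_on (Y i) (\<lambda>v. (1/2) *\<^sub>R \<Sigma>f i v + Sb i v + \<sigma> *\<^sub>R A i (adjoint (A i) v))"
    and z_pd: "\<And>j. pd_on (Z j) (\<lambda>w. (1/2) *\<^sub>R \<Sigma>g j w + Tb j w + \<sigma> *\<^sub>R B j (adjoint (B j) w))"
    and S_def: "S = (\<lambda>v. Diag Sb v + sGS Y (tilde_op A \<Sigma>f Sb \<sigma>) v)"
    and T_def: "T = (\<lambda>w. Diag Tb w + sGS Z (tilde_op B \<Sigma>g Tb \<sigma>) w)"
    and iterates: "sgs_ipadmm Y f p A \<Sigma>f Sb Z g q B \<Sigma>g Tb c \<sigma> \<tau> y z x"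
  shows "(\<exists>y' z' x'. (\<lambda>k. (y k, z k)) \<longlonglongrightarrow> (y', z') \<and> mp_optimal Y f p A Z g q B c y' z' \<and>
            x \<longlonglongrightarrow> x' \<and> dual_optimal Y f p A Z g q B c x') \<and>
         (\<forall>u'. (\<lambda>k. (y k, z k, x k)) \<longlonglongrightarrow> u' \<longrightarrow> u' \<in> kkt_points Y f p A Z g q B c \<longrightarrow>
            kkt_metrically_subregular Y f p A Z g q B c u' \<longrightarrow>
            linearly_convergent_to (\<lambda>k. (y k, z k, x k)) u')"
proof -
  interpret Y: sgs_block Y f p A \<Sigma>f Sb \<sigma>
    by unfold_locales (fact y_data maj_f Sb_self_adjoint Sb_ge y_pd sigma)+
  interpret Z: sgs_block Z g q B \<Sigma>g Tb \<sigma>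
    by unfold_locales (fact z_data maj_g Tb_self_adjoint Tb_ge z_pd sigma)+
  let ?L = "majorized_lagrangian Y f p A \<Sigma>f Z g q B \<Sigma>g c \<sigma>"
  let ?K = "kkt_points Y f p A Z g q B c"
  let ?R = "kkt_map Y f p A Z g q B c"
  obtain yb zb where init: "y 0 \<in> Y.V" "first_part p (y 0) < \<infinity>" "z 0 \<in> Z.V" "first_part q (z 0) < \<infinity>"
    and y_bwd: "\<And>k i. i \<noteq> first_block \<Longrightarrow>
      is_arg_min (\<lambda>v. ?L (put_block i (y k) v (yb k)) (z k) (x k) (y k) (z k) + ereal (1/2 * sqnorm (Sb i) (v - y k $ i)))
        (\<lambda>v. v \<in> Y i) (yb k $ i)"
    and y_first: "\<And>k. is_arg_min (\<lambda>v. ?L (put_block first_block (y k) v (yb k)) (z k) (x k) (y k) (z k)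
         + ereal (1/2 * sqnorm (Sb first_block) (v - y k $ first_block)))
        (\<lambda>v. v \<in> Y first_block) (y (Suc k) $ first_block)"
    and y_fwd: "\<And>k i. i \<noteq> first_block \<Longrightarrow>
      is_arg_min (\<lambda>v. ?L (put_block i (y (Suc k)) v (yb k)) (z k) (x k) (y k) (z k) + ereal (1/2 * sqnorm (Sb i) (v - y k $ i)))
        (\<lambda>v. v \<in> Y i) (y (Suc k) $ i)"
    and z_bwd: "\<And>k j. j \<noteq> first_block \<Longrightarrow>
      is_arg_min (\<lambda>w. ?L (y (Suc k)) (put_block j (z k) w (zb k)) (x k) (y k) (z k) + ereal (1/2 * sqnorm (Tb j) (w - z k $ j)))
        (\<lambda>w. w \<in> Z j) (zb k $ j)"
    and z_first: "\<And>k. is_arg_min (\<lambda>w. ?L (y (Suc k)) (put_block first_block (z k) w (zb k)) (x k) (y k) (z k)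
         + ereal (1/2 * sqnorm (Tb first_block) (w - z k $ first_block)))
        (\<lambda>w. w \<in> Z first_block) (z (Suc k) $ first_block)"
    and z_fwd: "\<And>k j. j \<noteq> first_block \<Longrightarrow>
      is_arg_min (\<lambda>w. ?L (y (Suc k)) (put_block j (z (Suc k)) w (zb k)) (x k) (y k) (z k) + ereal (1/2 * sqnorm (Tb j) (w - z k $ j)))
        (\<lambda>w. w \<in> Z j) (z (Suc k) $ j)"
    and x_step: "\<And>k. x (Suc k) = x k + (\<tau> * \<sigma>) *\<^sub>R residual A B c (y (Suc k)) (z (Suc k))"
    using iterates unfolding sgs_ipadmm_def Let_def by blast

  have real_part: "\<exists>r. first_part p \<eta> = ereal r" if "\<eta> \<in> Y.V" "first_part p \<eta> < \<infinity>" for \<eta>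
    using that Y.cpc_first_part by (cases "first_part p \<eta>") (auto simp: closed_proper_convex_on_def)
  have real_part': "\<exists>r. first_part q \<eta> = ereal r" if "\<eta> \<in> Z.V" "first_part q \<eta> < \<infinity>" for \<eta>
    using that Z.cpc_first_part by (cases "first_part q \<eta>") (auto simp: closed_proper_convex_on_def)

  have y_sweep: "y (Suc k) \<in> Y.V \<and> first_part p (y (Suc k)) < \<infinity> \<and>
      - Y.F (y k) - Y.G (y (Suc k) - y k) - stack_op A (x k + \<sigma> *\<^sub>R (stack_adj A (y (Suc k)) + (stack_adj B (z k) - c))) \<in> Y.P (y (Suc k))"
    if yk: "y k \<in> Y.V" "first_part p (y k) < \<infinity>" and zk: "z k \<in> Z.V" "first_part q (z k) < \<infinity>" for k
  proof -
    obtain r where r: "first_part q (z k) = ereal r" using real_part'[OF zk] by blast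
    have res: "residual A B c \<eta> (z k) = stack_adj A \<eta> + (stack_adj B (z k) - c)" for \<eta>
      by (simp add: residual_def)
    have L: "?L \<eta> (z k) (x k) (y k) (z k) = first_part p \<eta>
        + ereal (Y.smooth_part (x k) (stack_adj B (z k) - c) (y k) \<eta> + (majorized_fun Z g \<Sigma>g (z k) (z k) + r))" for \<eta>
      unfolding majorized_lagrangian_def res r Y.smooth_part_def by (cases "first_part p \<eta>") simp_all
    show ?thesis using Y.sweep[OF yk L y_bwd y_first y_fwd] by blast
  qed
  have z_sweep: "z (Suc k) \<in> Z.V \<and> first_part q (z (Suc k)) < \<infinity> \<and>
      - Z.F (z k) - Z.G (z (Suc k) - z k) - stack_op B (x k + \<sigma> *\<^sub>R (stack_adj B (z (Suc k)) + (stack_adj A (y (Suc k)) - c))) \<in> Z.P (z (Suc k))"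
    if yk: "y (Suc k) \<in> Y.V" "first_part p (y (Suc k)) < \<infinity>" and zk: "z k \<in> Z.V" "first_part q (z k) < \<infinity>" for k
  proof -
    obtain r where r: "first_part p (y (Suc k)) = ereal r" using real_part[OF yk] by blast
    have res: "residual A B c (y (Suc k)) \<eta> = stack_adj B \<eta> + (stack_adj A (y (Suc k)) - c)" for \<eta>
      by (simp add: residual_def)
    have L: "?L (y (Suc k)) \<eta> (x k) (y k) (z k) = first_part q \<eta>
        + ereal (Z.smooth_part (x k) (stack_adj A (y (Suc k)) - c) (z k) \<eta> + (majorized_fun Y f \<Sigma>f (y (Suc k)) (y k) + r))" for \<eta>
      unfolding majorized_lagrangian_def res r Z.smooth_part_def by (cases "first_part q \<eta>") simp_all
    show ?thesis using Z.sweep[OF zk L z_bwd z_first z_fwd] by blast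
  qed
  \<comment> \<open>Each sweep treats the other nonsmooth term as a real constant, so finiteness
    must be carried along: the \<open>y\<close>-sweep needs the old \<open>z\<close>, the
    \<open>z\<close>-sweep the new \<open>y\<close>.\<close>
  have dom: "y k \<in> Y.V \<and> first_part p (y k) < \<infinity> \<and> z k \<in> Z.V \<and> first_part q (z k) < \<infinity>" for k
  proof (induction k)
    case (Suc k)
    then show ?case using y_sweep[of k] z_sweep[of k] by blast
  qed (use init in blast)

  obtain Ly \<gamma>y where py: "prox_block Y.V Y.F (Diag \<Sigma>f) Y.G Y.P (stack_op A) (stack_adj A) Ly \<gamma>y"
    using Y.prox_block_exists by blast
  obtain Lz \<gamma>z where pz: "prox_block Z.V Z.F (Diag \<Sigma>g) Z.G Z.P (stack_op B) (stack_adj B) Lz \<gamma>z"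
    using Z.prox_block_exists by blast
  interpret PY: prox_block Y.V Y.F "Diag \<Sigma>f" Y.G Y.P "stack_op A" "stack_adj A" Ly \<gamma>y by (rule py)
  interpret PZ: prox_block Z.V Z.F "Diag \<Sigma>g" Z.G Z.P "stack_op B" "stack_adj B" Lz \<gamma>z by (rule pz)
  interpret TB: two_block Y.V Y.F "Diag \<Sigma>f" Y.G Y.P "stack_op A" "stack_adj A" Ly \<gamma>y
    Z.V Z.F "Diag \<Sigma>g" Z.G Z.P "stack_op B" "stack_adj B" Lz \<gamma>z c \<sigma> \<tau> y z x
  proof
    fix k
    show "y k \<in> Y.V" "z k \<in> Z.V" using dom by blast+
    show "- Y.F (y k) - Y.G (y (Suc k) - y k) - stack_op A (x k + \<sigma> *\<^sub>R (stack_adj A (y (Suc k)) + stack_adj B (z k) - c)) \<in> Y.P (y (Suc k))"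
      using y_sweep[of k] dom by (simp only: add_diff_eq)
    show "- Z.F (z k) - Z.G (z (Suc k) - z k) - stack_op B (x k + \<sigma> *\<^sub>R (stack_adj A (y (Suc k)) + stack_adj B (z (Suc k)) - c)) \<in> Z.P (z (Suc k))"
      using z_sweep[of k] dom by (simp only: add_diff_eq add.commute[of "stack_adj A _"])
    show "x (Suc k) = x k + (\<tau> * \<sigma>) *\<^sub>R (stack_adj A (y (Suc k)) + stack_adj B (z (Suc k)) - c)"
      using x_step[of k] by (simp only: residual_def)
  qed (fact sigma tau)+
  have KKT: "TB.KKT = ?K" unfolding TB.KKT_def kkt_points_alt by (rule refl)
  have ne: "TB.KKT \<noteq> {}" using kkt_nonempty by (simp add: KKT)

  have "\<exists>y' z' x'. (\<lambda>k. (y k, z k)) \<longlonglongrightarrow> (y', z') \<and> mp_optimal Y f p A Z g q B c y' z' \<and>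
            x \<longlonglongrightarrow> x' \<and> dual_optimal Y f p A Z g q B c x'"
  proof -
    obtain l where l: "l \<in> TB.KKT" "TB.u \<longlonglongrightarrow> l" using TB.converges_to_KKT[OF ne] by blast
    obtain y' z' x' where l_eq: "l = (y', z', x')" by (cases l) auto
    have lim: "(\<lambda>k. (y k, z k, x k)) \<longlonglongrightarrow> (y', z', x')" using l(2) unfolding l_eq TB.u_def .
    have "y \<longlonglongrightarrow> y'" "z \<longlonglongrightarrow> z'" "x \<longlonglongrightarrow> x'"
      using tendsto_fst[OF lim] tendsto_fst[OF tendsto_snd[OF lim]] tendsto_snd[OF tendsto_snd[OF lim]] by simp_all
    then show ?thesis
      using kkt_point_optimal[OF y_data z_data, of y' z' x' c] l(1)[unfolded KKT l_eq] tendsto_Pair by blast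
  qed
  moreover have "linearly_convergent_to (\<lambda>k. (y k, z k, x k)) u'"
    if lim: "(\<lambda>k. (y k, z k, x k)) \<longlonglongrightarrow> u'" and sub: "kkt_metrically_subregular Y f p A Z g q B c u'" for u'
  proof -
    obtain \<eta> \<rho> where \<eta>: "0 < \<eta>" and \<rho>: "0 < \<rho>" and
      sr: "\<And>u. u \<in> Y.V \<times> Z.V \<times> UNIV \<Longrightarrow> norm (u - u') \<le> \<rho> \<Longrightarrow> infdist u ?K \<le> \<eta> * norm (?R u)"
      using sub unfolding kkt_metrically_subregular_def by blast
    \<comment> \<open>A KKT point supplies the subgradients from which the proximal points are shown
      to exist.\<close>
    obtain ys zs xs where K: "(ys, zs, xs) \<in> TB.KKT" using ne by auto
    have ys: "ys \<in> Y.V" "- Y.F ys - stack_op A xs \<in> Y.P ys" and zs: "zs \<in> Z.V" "- Z.F zs - stack_op B xs \<in> Z.P zs"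
      using K by (auto simp: TB.KKT_def)
    note bl = linear_conv_bounded_linear[THEN iffD1]
    \<comment> \<open>These bound the gap between the multiplier in a step condition and
      \<open>x (Suc k)\<close>. The second term of \<open>ey\<close> is the lag of the
      \<open>y\<close>-step, which still uses the old \<open>z\<close>.\<close>
    define ey where "ey = \<bar>1 - \<tau>\<bar> * \<sigma> + \<sigma> * onorm (stack_adj B)"
    define ez where "ez = \<bar>1 - \<tau>\<bar> * \<sigma>"
    define C where "C = (\<bar>Ly\<bar> + onorm Y.G + onorm (stack_op A) * ey) + ((\<bar>Lz\<bar> + onorm Z.G + onorm (stack_op B) * ez) + 1)"
    have C: "norm (?R (TB.u (Suc k))) \<le> C * sqrt (TB.progress k)" for k
    proof -
      define s where "s = sqrt (TB.progress k)"
      let ?yn = "y (Suc k)" and ?zn = "z (Suc k)" and ?xn = "x (Suc k)" and ?r = "TB.res (Suc k)"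
      define wy where "wy = prox_on Y.V (first_part p) (?yn - (Y.F ?yn + stack_op A ?xn))"
      define wz where "wz = prox_on Z.V (first_part q) (?zn - (Z.F ?zn + stack_op B ?xn))"
      have n: "norm (?yn - y k) \<le> s" "norm (?zn - z k) \<le> s" "norm ?r \<le> s"
        unfolding s_def by (rule real_le_rsqrt, simp add: TB.progress_def)+
      have inV: "y k \<in> Y.V" "?yn \<in> Y.V" "z k \<in> Z.V" "?zn \<in> Z.V" using dom by blast+
      have wy: "wy \<in> Y.V" "?yn - (Y.F ?yn + stack_op A ?xn) - wy \<in> Y.P wy"
        unfolding wy_def by (rule prox_on_subdiff[OF Y.subspace_V Y.cpc_first_part ys];
          intro subspace_diff subspace_add Y.subspace_V inV Y.F_in Y.stack_op_in)+
      have wz: "wz \<in> Z.V" "?zn - (Z.F ?zn + stack_op B ?xn) - wz \<in> Z.P wz"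
        unfolding wz_def by (rule prox_on_subdiff[OF Z.subspace_V Z.cpc_first_part zs];
          intro subspace_diff subspace_add Z.subspace_V inV Z.F_in Z.stack_op_in)+
      have Bz: "norm (stack_adj B (?zn - z k)) \<le> onorm (stack_adj B) * s"
        using order_trans[OF onorm[OF bl[OF Z.linear_stack_adj]]
            mult_left_mono[OF n(2) onorm_pos_le[OF bl[OF Z.linear_stack_adj]]]] .
      have r: "norm (((1 - \<tau>) * \<sigma>) *\<^sub>R ?r) \<le> \<bar>1 - \<tau>\<bar> * \<sigma> * s"
        using n(3) sigma by (simp add: abs_mult mult_left_mono)
      have xz: "(x k + \<sigma> *\<^sub>R (stack_adj A ?yn + stack_adj B ?zn - c)) - ?xn = ((1 - \<tau>) * \<sigma>) *\<^sub>R ?r"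
        by (simp add: TB.x_step[of k] TB.res_def algebra_simps)
      have xy: "(x k + \<sigma> *\<^sub>R (stack_adj A ?yn + stack_adj B (z k) - c)) - ?xn
          = ((1 - \<tau>) * \<sigma>) *\<^sub>R ?r - \<sigma> *\<^sub>R stack_adj B (?zn - z k)"
        by (simp add: TB.x_step[of k] TB.res_def linear_diff[OF Z.linear_stack_adj] algebra_simps)
      have "norm (\<sigma> *\<^sub>R stack_adj B (?zn - z k)) \<le> \<sigma> * onorm (stack_adj B) * s"
        using mult_left_mono[OF Bz, of \<sigma>] sigma by (simp add: mult.assoc)
      then have xy_le: "norm ((x k + \<sigma> *\<^sub>R (stack_adj A ?yn + stack_adj B (z k) - c)) - ?xn) \<le> ey * s"
        unfolding xy ey_def distrib_right using r by (intro norm_triangle_le_diff add_mono)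
      have xz_le: "norm ((x k + \<sigma> *\<^sub>R (stack_adj A ?yn + stack_adj B ?zn - c)) - ?xn) \<le> ez * s"
        unfolding xz ez_def by (rule r)
      have "norm (?yn - wy) \<le> (\<bar>Ly\<bar> + onorm Y.G + onorm (stack_op A) * ey) * s"
        by (rule PY.prox_residual_bound[OF inV(2,1) wy(1) TB.y_step wy(2) n(1) xy_le])
      moreover have "norm (?zn - wz) \<le> (\<bar>Lz\<bar> + onorm Z.G + onorm (stack_op B) * ez) * s"
        by (rule PZ.prox_residual_bound[OF inV(4,3) wz(1) TB.z_step wz(2) n(2) xz_le])
      moreover have "c - stack_adj A ?yn - stack_adj B ?zn = - ?r" by (simp add: TB.res_def)
      then have "norm (c - stack_adj A ?yn - stack_adj B ?zn) \<le> s" using n(3) by simp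
      moreover have "?R (TB.u (Suc k)) = (?yn - wy, ?zn - wz, c - stack_adj A ?yn - stack_adj B ?zn)"
        by (simp add: kkt_map_def TB.u_def wy_def wz_def)
      then have "norm (?R (TB.u (Suc k))) \<le> norm (?yn - wy) + (norm (?zn - wz) + norm (c - stack_adj A ?yn - stack_adj B ?zn))"
        using order_trans[OF norm_Pair_le add_left_mono[OF norm_Pair_le]] by metis
      ultimately show ?thesis unfolding C_def s_def[symmetric] distrib_right by linarith
    qed
    have "\<forall>\<^sub>F k in sequentially. infdist (TB.u (Suc k)) TB.KKT \<le> \<eta> * C * sqrt (TB.progress k)"
    proof -
      have "(\<lambda>k. TB.u (Suc k)) \<longlonglongrightarrow> u'" using LIMSEQ_Suc[OF lim] unfolding TB.u_def .
      \<comment> \<open>Subregularity is local, so the error bound holds only once the iterates have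
        entered the ball of radius \<open>\<rho>\<close>.\<close>
      from tendstoD[OF this \<rho>] show ?thesis
      proof (rule eventually_mono)
        fix k assume "dist (TB.u (Suc k)) u' < \<rho>"
        then have "infdist (TB.u (Suc k)) ?K \<le> \<eta> * norm (?R (TB.u (Suc k)))"
          using dom by (intro sr) (auto simp: dist_norm TB.u_def)
        also have "\<dots> \<le> \<eta> * (C * sqrt (TB.progress k))" using C \<eta> by (intro mult_left_mono) auto
        finally show "infdist (TB.u (Suc k)) TB.KKT \<le> \<eta> * C * sqrt (TB.progress k)" by (simp add: KKT mult.assoc)
      qed
    qed
    moreover have "TB.u \<longlonglongrightarrow> u'" using lim unfolding TB.u_def .
    ultimately have "linearly_convergent_to TB.u u'" by (intro TB.linear_rate[OF ne])
    then show ?thesis unfolding TB.u_def .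
  qed
  ultimately show ?thesis by blast
qed

end
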